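(* For any smooth manifold $M$, the map $\ell:J_p^1(J_p^1M)\to J_p^1(J_p^1M)$ is a $J_p^1M$-isomorphism of vector bundles (i.e. a vector bundle isomorphism over the identity of $J_p^1M$) from $\tilde\pi:J_p^1(J_p^1M)\to J_p^1M$ with its primary vector bundle structure to $\pi_M^1:J_p^1(J_p^1M)\to J_p^1M$ with its secondary vector bundle structure; in particular $\pi_M^1\circ\ell=\tilde\pi$.
   Context: Fix $p\ge1$ and let $m=\dim M$. For a smooth manifold $N$, two smooth maps $\phi,\xi:\mathbb{R}^p\to N$ have the same 1-jet, $j^1\phi=j^1\xi$, if $\phi(0)=\xi(0)$ and, in local coordinates, their first partial derivatives at $0$ agree; $J_p^1N$ is the set of all 1-jets. For a chart $(U,x_1,\dots,x_n)$ of $N$, $J_p^1U=\{j^1\phi:\phi(0)\in U\}$ has the chart $x_i(j^1\phi)=x_i(\phi(0))$, $x^i_\alpha(j^1\phi)=\partial(x_i\circ\phi)/\partial u_\alpha|_0$ ($1\le\alpha\le p$), and these charts make $J_p^1N$ a smooth manifold. The projection $J_p^1N\to N$, $j^1\phi\mapsto\phi(0)$, is a vector bundle whose fibre operations are, in these charts, addition and scalar multiplication of the components $x^i_\alpha$. Write $\pi_M:J_p^1M\to M$ for this projection when $N=M$. A smooth map $h:N\to N'$ induces $h^1:J_p^1N\to J_p^1N'$, $h^1(j^1\phi)=j^1(h\circ\phi)$. The double jet bundle $J_p^1(J_p^1M)$ has two vector bundle structures over $J_p^1M$. For $j^1\Phi\in J_p^1(J_p^1M)$, $\Phi:\mathbb{R}^p\to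 J_p^1M$, and a chart $(x_i)$ of $M$ near $\pi_M(\Phi(0))$ with induced chart $(x_i,x^i_\alpha)$ of $J_p^1M$, put $y_i=x_i(\Phi(0))$, $Y^i_\alpha=x^i_\alpha(\Phi(0))$, $X^i_\alpha=\partial(x_i\circ\pi_M\circ\Phi)/\partial u_\alpha|_0$, $C^i_{\alpha\beta}=\partial(x^i_\beta\circ\Phi)/\partial u_\alpha|_0$. Primary structure: projection $\tilde\pi(j^1\Phi)=\Phi(0)$ (base coordinates $(y,Y)$), with fibre operations being addition and scalar multiplication of $(X,C)$. Secondary structure: projection $\pi_M^1(j^1\Phi)=j^1(\pi_M\circ\Phi)$ (base coordinates $(y,X)$), with fibre operations being addition and scalar multiplication of $(Y,C)$. Definition of $\ell$. Let $J_{2p}^2M$ be the manifold of 2-jets $j^2\phi$ at $(0,0)$ of smooth maps $\phi:\mathbb{R}^p\times\mathbb{R}^p\to M$ (two maps have the same 2-jet if their values and all their first and second partial derivatives at $(0,0)$ in local coordinates agree). Let $\Lambda:J_{2p}^2M\to J_p^1(J_p^1M)$ be the surjective submersion $\Lambda(j^2\phi)=j^1\Phi$, where $\Phi(u)=j^1(\phi_u)$ and $\phi_u(v)=\phi(u,v)$. Let $\hat\ell(j^2\phi)=j^2(\phi\circ\mathfrak{f})$, where $\mathfrak{f}(u,w)=(w,u)$. Then $\ell$ is the unique map with $\ell\circ\Lambda=\Lambda\circ\hat\ell$; it is a well-defined smooth involution. *)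

theory Defs
  imports "HOL-Analysis.Analysis"
begin

text \<open>
  \<open>Ck k f S\<close> is the usual notion of a \<open>k\<close> times continuously differentiable map when \<open>S\<close> is
  open and the domain of \<open>f\<close> is finite-dimensional; it is only used in that situation.
\<close>

primrec Ck :: "nat \<Rightarrow> ('a::real_normed_vector \<Rightarrow> 'b::real_normed_vector) \<Rightarrow> 'a set \<Rightarrow> bool" where
  "Ck 0 f S \<longleftrightarrow> continuous_on S f"
| "Ck (Suc k) f S \<longleftrightarrow>
     (\<forall>z\<in>S. f differentiable (at z)) \<and> (\<forall>v. Ck k (\<lambda>z. frechet_derivative f (at z) v) S)"

definition smooth_on :: "'a set \<Rightarrow> ('a::real_normed_vector \<Rightarrow> 'b::real_normed_vector) \<Rightarrow> bool" where
  "smooth_on S f \<longleftrightarrow> (\<forall>k. Ck k f S)"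

text \<open>
  A smooth manifold is given by a smooth atlas on its set of points; as usual the topology is the
  one determined by the charts. The atlas is not required to be maximal. The values of a chart
  outside its domain are irrelevant.
\<close>

type_synonym ('a, 'e) atlas = "('a set \<times> ('a \<Rightarrow> 'e)) set"

definition points :: "('a, 'e) atlas \<Rightarrow> 'a set" where
  "points A = (\<Union>(U, x)\<in>A. U)"

definition mtop :: "('a, 'e::topological_space) atlas \<Rightarrow> 'a topology" where
  "mtop A = topology (\<lambda>W. W \<subseteq> points A \<and> (\<forall>(U, x)\<in>A. open (x ` (W \<inter> U))))"

text \<open>
  The model space \<open>'e\<close> is any finite-dimensional inner product space. The class
  \<open>euclidean_space\<close> is not used for it because that class excludes dimension 0.
\<close>

definition smooth_manifold :: "('a, 'e::real_inner) atlas \<Rightarrow> bool" where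
  "smooth_manifold A \<longleftrightarrow>
     (\<exists>B::'e set. finite B \<and> span B = UNIV) \<and>
     (\<forall>(U, x)\<in>A. inj_on x U \<and> open (x ` U)) \<and>
     (\<forall>(U, x)\<in>A. \<forall>(V, y)\<in>A.
        open (x ` (U \<inter> V)) \<and> smooth_on (x ` (U \<inter> V)) (y \<circ> inv_into U x)) \<and>
     Hausdorff_space (mtop A) \<and> second_countable (mtop A)"

definition smooth_map ::
  "('a, 'e::real_inner) atlas \<Rightarrow> ('b, 'f::real_inner) atlas \<Rightarrow> ('a \<Rightarrow> 'b) \<Rightarrow> bool" where
  "smooth_map A B f \<longleftrightarrow>
     continuous_map (mtop A) (mtop B) f \<and>
     (\<forall>(U, x)\<in>A. \<forall>(V, y)\<in>B. smooth_on (x ` (U \<inter> f -` V)) (y \<circ> f \<circ> inv_into U x))"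

definition diffeomorphism ::
  "('a, 'e::real_inner) atlas \<Rightarrow> ('b, 'f::real_inner) atlas \<Rightarrow> ('a \<Rightarrow> 'b) \<Rightarrow> bool" where
  "diffeomorphism A B f \<longleftrightarrow>
     bij_betw f (points A) (points B) \<and> smooth_map A B f \<and> smooth_map B A (inv_into (points A) f)"

definition euclid :: "('e, 'e) atlas" where
  "euclid = {(UNIV, id)}"

definition restrict_atlas :: "('a, 'e) atlas \<Rightarrow> 'a set \<Rightarrow> ('a, 'e) atlas" where
  "restrict_atlas A W = (\<lambda>(U, x). (U \<inter> W, x)) ` A"

definition prod_atlas :: "('a, 'e) atlas \<Rightarrow> ('b, 'f) atlas \<Rightarrow> ('a \<times> 'b, 'e \<times> 'f) atlas" where
  "prod_atlas A B = {(U \<times> V, map_prod x y) |U x V y. (U, x) \<in> A \<and> (V, y) \<in> B}"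

text \<open>
  The total space is \<open>E\<close>, the base is \<open>B\<close>, and \<open>add\<close>, \<open>scl\<close> are the fibre operations, which are
  only meaningful for arguments in a common fibre. Locally over \<open>W\<close>, \<open>e \<mapsto> (\<pi> e, \<psi> e)\<close> is a
  trivialization with model fibre the vector space \<open>'f\<close>. As \<open>\<psi>\<close> then restricts to a bijection from
  each fibre over \<open>W\<close> onto \<open>'f\<close> that respects the operations, the fibres are real vector spaces.
\<close>

definition vector_bundle ::
  "'f::real_inner itself \<Rightarrow> ('t, 'e::real_inner) atlas \<Rightarrow> ('b, 'd::real_inner) atlas \<Rightarrow> ('t \<Rightarrow> 'b)
    \<Rightarrow> ('t \<Rightarrow> 't \<Rightarrow> 't) \<Rightarrow> (real \<Rightarrow> 't \<Rightarrow> 't) \<Rightarrow> bool" where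
  "vector_bundle F E B \<pi> add scl \<longleftrightarrow>
     smooth_manifold E \<and> smooth_manifold B \<and> smooth_map E B \<pi> \<and>
     (\<exists>C::'f set. finite C \<and> span C = UNIV) \<and>
     (\<forall>a\<in>points E. \<forall>b\<in>points E. \<pi> a = \<pi> b \<longrightarrow> add a b \<in> points E \<and> \<pi> (add a b) = \<pi> a) \<and>
     (\<forall>r. \<forall>a\<in>points E. scl r a \<in> points E \<and> \<pi> (scl r a) = \<pi> a) \<and>
     (\<forall>q\<in>points B. \<exists>W (\<psi> :: 't \<Rightarrow> 'f).
        openin (mtop B) W \<and> q \<in> W \<and>
        diffeomorphism (restrict_atlas E (\<pi> -` W)) (prod_atlas (restrict_atlas B W) euclid)
          (\<lambda>e. (\<pi> e, \<psi> e)) \<and>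
        (\<forall>a\<in>points E. \<forall>b\<in>points E. \<pi> a \<in> W \<and> \<pi> a = \<pi> b \<longrightarrow> \<psi> (add a b) = \<psi> a + \<psi> b) \<and>
        (\<forall>r. \<forall>a\<in>points E. \<pi> a \<in> W \<longrightarrow> \<psi> (scl r a) = r *\<^sub>R \<psi> a))"

definition vector_bundle_iso ::
  "'f::real_inner itself \<Rightarrow> ('b, 'd::real_inner) atlas
    \<Rightarrow> ('t, 'e::real_inner) atlas \<Rightarrow> ('t \<Rightarrow> 'b) \<Rightarrow> ('t \<Rightarrow> 't \<Rightarrow> 't) \<Rightarrow> (real \<Rightarrow> 't \<Rightarrow> 't)
    \<Rightarrow> ('s, 'c::real_inner) atlas \<Rightarrow> ('s \<Rightarrow> 'b) \<Rightarrow> ('s \<Rightarrow> 's \<Rightarrow> 's) \<Rightarrow> (real \<Rightarrow> 's \<Rightarrow> 's)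
    \<Rightarrow> ('t \<Rightarrow> 's) \<Rightarrow> bool" where
  "vector_bundle_iso F B E \<pi> add scl E' \<pi>' add' scl' f \<longleftrightarrow>
     vector_bundle F E B \<pi> add scl \<and> vector_bundle F E' B \<pi>' add' scl' \<and>
     diffeomorphism E E' f \<and>
     (\<forall>a\<in>points E. \<pi>' (f a) = \<pi> a) \<and>
     (\<forall>a\<in>points E. \<forall>b\<in>points E. \<pi> a = \<pi> b \<longrightarrow> f (add a b) = add' (f a) (f b)) \<and>
     (\<forall>r. \<forall>a\<in>points E. f (scl r a) = scl' r (f a))"

text \<open>A jet is an equivalence class of smooth maps, and \<open>rep\<close> picks a representative.\<close>

type_synonym ('p, 'a) jet = "(real^'p \<Rightarrow> 'a) set"

definition rep :: "'a set \<Rightarrow> 'a" where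
  "rep j = (SOME \<phi>. \<phi> \<in> j)"

abbreviation pderiv_at :: "('v::real_normed_vector \<Rightarrow> 'e::real_normed_vector) \<Rightarrow> 'v \<Rightarrow> 'v \<Rightarrow> 'e" where
  "pderiv_at f v z \<equiv> frechet_derivative f (at z) v"

definition same_jet1 ::
  "('a, 'e::real_inner) atlas \<Rightarrow> (real^'p \<Rightarrow> 'a) \<Rightarrow> (real^'p \<Rightarrow> 'a) \<Rightarrow> bool" where
  "same_jet1 A \<phi> \<xi> \<longleftrightarrow>
     \<phi> 0 = \<xi> 0 \<and>
     (\<forall>(U, x)\<in>A. \<phi> 0 \<in> U \<longrightarrow>
        (\<forall>\<alpha>. pderiv_at (x \<circ> \<phi>) (axis \<alpha> 1) 0 = pderiv_at (x \<circ> \<xi>) (axis \<alpha> 1) 0))"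

definition jet1 :: "('a, 'e::real_inner) atlas \<Rightarrow> (real^'p \<Rightarrow> 'a) \<Rightarrow> ('p::finite, 'a) jet" where
  "jet1 A \<phi> = {\<xi>. smooth_map euclid A \<xi> \<and> same_jet1 A \<phi> \<xi>}"

definition J1 :: "('a, 'e::real_inner) atlas \<Rightarrow> ('p::finite, 'a) jet set" where
  "J1 A = jet1 A ` {\<phi>. smooth_map euclid A \<phi>}"

definition jet_proj :: "('p::finite, 'a) jet \<Rightarrow> 'a" where
  "jet_proj j = rep j 0"

definition jet_chart :: "('a \<Rightarrow> 'e::real_inner) \<Rightarrow> ('p::finite, 'a) jet \<Rightarrow> 'e \<times> ('e^'p)" where
  "jet_chart x j = (x (jet_proj j), \<chi> \<alpha>. pderiv_at (x \<circ> rep j) (axis \<alpha> 1) 0)"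

definition jet_atlas :: "('a, 'e::real_inner) atlas \<Rightarrow> (('p::finite, 'a) jet, 'e \<times> ('e^'p)) atlas" where
  "jet_atlas A = (\<lambda>(U, x). ({j \<in> J1 A. jet_proj j \<in> U}, jet_chart x)) ` A"

text \<open>\<open>B\<close> is the atlas of the target of \<open>h\<close>.\<close>

definition jet_map :: "('b, 'f::real_inner) atlas \<Rightarrow> ('a \<Rightarrow> 'b) \<Rightarrow> ('p::finite, 'a) jet \<Rightarrow> ('p, 'b) jet" where
  "jet_map B h j = jet1 B (h \<circ> rep j)"

definition JJ :: "('a, 'e::real_inner) atlas \<Rightarrow> ('p::finite, ('p, 'a) jet) jet set" where
  "JJ M = J1 (jet_atlas M)"

definition JJ_atlas ::
  "('a, 'e::real_inner) atlas
    \<Rightarrow> (('p::finite, ('p, 'a) jet) jet, ('e \<times> ('e^'p)) \<times> (('e \<times> ('e^'p))^'p)) atlas" where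
  "JJ_atlas M = jet_atlas (jet_atlas M)"

definition prim_proj :: "('p::finite, ('p, 'a) jet) jet \<Rightarrow> ('p, 'a) jet" where
  "prim_proj a = jet_proj a"

definition sec_proj ::
  "('a, 'e::real_inner) atlas \<Rightarrow> ('p::finite, ('p, 'a) jet) jet \<Rightarrow> ('p, 'a) jet" where
  "sec_proj M a = jet_map M jet_proj a"

text \<open>
  The coordinates \<open>Y\<close>, \<open>X\<close> and \<open>C\<close> of a double jet with respect to a chart \<open>x\<close> of \<open>M\<close>, each with
  values in tuples of vectors of the model space \<open>'e\<close>; the index \<open>i\<close> numbering the coordinates of
  \<open>'e\<close> is left implicit. Thus \<open>coordC x a $ \<alpha> $ \<beta>\<close> is \<open>(C\<^sup>i\<^sub>\<alpha>\<^sub>\<beta>)\<^sub>i\<close>.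
\<close>

definition coordY :: "('a \<Rightarrow> 'e::real_inner) \<Rightarrow> ('p::finite, ('p, 'a) jet) jet \<Rightarrow> 'e^'p" where
  "coordY x a = snd (jet_chart x (rep a 0))"

definition coordX :: "('a \<Rightarrow> 'e::real_inner) \<Rightarrow> ('p::finite, ('p, 'a) jet) jet \<Rightarrow> 'e^'p" where
  "coordX x a = (\<chi> \<alpha>. pderiv_at (x \<circ> jet_proj \<circ> rep a) (axis \<alpha> 1) 0)"

definition coordC :: "('a \<Rightarrow> 'e::real_inner) \<Rightarrow> ('p::finite, ('p, 'a) jet) jet \<Rightarrow> 'e^'p^'p" where
  "coordC x a = (\<chi> \<alpha> \<beta>. pderiv_at (\<lambda>u. snd (jet_chart x (rep a u)) $ \<beta>) (axis \<alpha> 1) 0)"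

definition prim_add ::
  "('a, 'e::real_inner) atlas \<Rightarrow> ('p::finite, ('p, 'a) jet) jet \<Rightarrow> ('p, ('p, 'a) jet) jet
    \<Rightarrow> ('p::finite, ('p, 'a) jet) jet" where
  "prim_add M a b = (THE c. c \<in> JJ M \<and> prim_proj c = prim_proj a \<and>
     (\<forall>(U, x)\<in>M. jet_proj (prim_proj a) \<in> U \<longrightarrow>
        coordX x c = coordX x a + coordX x b \<and> coordC x c = coordC x a + coordC x b))"

definition prim_scale ::
  "('a, 'e::real_inner) atlas \<Rightarrow> real \<Rightarrow> ('p::finite, ('p, 'a) jet) jet \<Rightarrow> ('p, ('p, 'a) jet) jet" where
  "prim_scale M r a = (THE c. c \<in> JJ M \<and> prim_proj c = prim_proj a \<and>
     (\<forall>(U, x)\<in>M. jet_proj (prim_proj a) \<in> U \<longrightarrow>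
        coordX x c = r *\<^sub>R coordX x a \<and> coordC x c = r *\<^sub>R coordC x a))"

definition sec_add ::
  "('a, 'e::real_inner) atlas \<Rightarrow> ('p::finite, ('p, 'a) jet) jet \<Rightarrow> ('p, ('p, 'a) jet) jet
    \<Rightarrow> ('p::finite, ('p, 'a) jet) jet" where
  "sec_add M a b = (THE c. c \<in> JJ M \<and> sec_proj M c = sec_proj M a \<and>
     (\<forall>(U, x)\<in>M. jet_proj (prim_proj a) \<in> U \<longrightarrow>
        coordY x c = coordY x a + coordY x b \<and> coordC x c = coordC x a + coordC x b))"

definition sec_scale ::
  "('a, 'e::real_inner) atlas \<Rightarrow> real \<Rightarrow> ('p::finite, ('p, 'a) jet) jet \<Rightarrow> ('p, ('p, 'a) jet) jet" where
  "sec_scale M r a = (THE c. c \<in> JJ M \<and> sec_proj M c = sec_proj M a \<and>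
     (\<forall>(U, x)\<in>M. jet_proj (prim_proj a) \<in> U \<longrightarrow>
        coordY x c = r *\<^sub>R coordY x a \<and> coordC x c = r *\<^sub>R coordC x a))"

type_synonym ('p, 'a) jet2p = "((real^'p) \<times> (real^'p) \<Rightarrow> 'a) set"

definition same_jet2 ::
  "('a, 'e::real_inner) atlas \<Rightarrow> ((real^'p) \<times> (real^'p) \<Rightarrow> 'a) \<Rightarrow> ((real^'p) \<times> (real^'p) \<Rightarrow> 'a)
    \<Rightarrow> bool" where
  "same_jet2 M \<phi> \<xi> \<longleftrightarrow>
     \<phi> 0 = \<xi> 0 \<and>
     (\<forall>(U, x)\<in>M. \<phi> 0 \<in> U \<longrightarrow>
        (\<forall>b\<in>Basis. pderiv_at (x \<circ> \<phi>) b 0 = pderiv_at (x \<circ> \<xi>) b 0) \<and>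
        (\<forall>b\<in>Basis. \<forall>b'\<in>Basis.
           pderiv_at (pderiv_at (x \<circ> \<phi>) b) b' 0 = pderiv_at (pderiv_at (x \<circ> \<xi>) b) b' 0))"

definition jet2 ::
  "('a, 'e::real_inner) atlas \<Rightarrow> ((real^'p) \<times> (real^'p) \<Rightarrow> 'a) \<Rightarrow> ('p::finite, 'a) jet2p" where
  "jet2 M \<phi> = {\<xi>. smooth_map euclid M \<xi> \<and> same_jet2 M \<phi> \<xi>}"

definition J2 :: "('a, 'e::real_inner) atlas \<Rightarrow> ('p::finite, 'a) jet2p set" where
  "J2 M = jet2 M ` {\<phi>. smooth_map euclid M \<phi>}"

definition Lam :: "('a, 'e::real_inner) atlas \<Rightarrow> ('p::finite, 'a) jet2p \<Rightarrow> ('p, ('p, 'a) jet) jet" where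
  "Lam M j = jet1 (jet_atlas M) (\<lambda>u. jet1 M (\<lambda>v. rep j (u, v)))"

definition ell_hat :: "('a, 'e::real_inner) atlas \<Rightarrow> ('p::finite, 'a) jet2p \<Rightarrow> ('p, 'a) jet2p" where
  "ell_hat M j = jet2 M (rep j \<circ> prod.swap)"

definition ell ::
  "('a, 'e::real_inner) atlas \<Rightarrow> ('p::finite, ('p, 'a) jet) jet \<Rightarrow> ('p, ('p, 'a) jet) jet" where
  "ell M = (THE l. l \<in> JJ M \<rightarrow>\<^sub>E JJ M \<and> (\<forall>j\<in>J2 M. l (Lam M j) = Lam M (ell_hat M j)))"

end

theory Submission
  imports Defs
begin

text \<open>
  In a chart of \<open>M\<close> a double jet has coordinates \<open>(y, Y, X, C)\<close>. If it is \<open>\<Lambda>(j\<^sup>2\<phi>)\<close>, then \<open>y = \<phi>(0,0)\<close>,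
  \<open>X\<close> and \<open>Y\<close> are the first derivatives of \<open>\<phi>(u,v)\<close> in \<open>u\<close> and in \<open>v\<close>, and
  \<open>C\<^sub>\<alpha>\<^sub>\<beta> = \<partial>\<^sup>2\<phi>/\<partial>u\<^sub>\<alpha>\<partial>v\<^sub>\<beta>\<close>. Exchanging the two arguments of \<open>\<phi>\<close> exchanges \<open>X\<close> with \<open>Y\<close> and, as mixed
  derivatives commute, transposes \<open>C\<close> (\<open>flipped_iterated_jet\<close>). Every double jet is of the form
  \<open>\<Lambda>(j\<^sup>2\<phi>)\<close> (\<open>Lam_surj\<close>): prescribe a polynomial \<open>\<phi>\<close> of degree 2 in a chart and precompose it
  with a map that squeezes \<open>\<real>\<^sup>p\<close> into a small ball and is tangent to the identity at 0, so that
  the values stay in the chart. Hence \<open>\<ell>\<close> is in every chart the map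
  \<open>(y, Y, X, C) \<mapsto> (y, X, Y, C\<^sup>T)\<close> (\<open>flipped_ell\<close>, \<open>coords_ell\<close>). Being a linear involution in
  charts, it is a diffeomorphism.

  The primary projection is \<open>(y, Y)\<close> and the secondary one is \<open>(y, X)\<close>, so
  \<open>\<pi>\<^sub>M\<^sup>1 \<circ> \<ell> = \<pi>\<close> for the primary projection \<open>\<pi>\<close> (\<open>sec_proj_ell\<close>). The primary operations exist
  because over a fixed 1-jet the components \<open>(X, C)\<close> transform linearly between charts, namely by the
  derivative of a transition map of \<open>J\<^sup>1M\<close> (\<open>JJ_combination\<close>). The characterization of the secondary
  operations by \<open>(Y, C)\<close> is the image under \<open>\<ell>\<close> of that of the primary ones by \<open>(X, C)\<close>. This gives
  at once that the secondary operations exist and that \<open>\<ell>\<close> carries one structure to the other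
  (\<open>ell_prim_add\<close>, \<open>ell_prim_scale\<close>); the transformation law of \<open>C\<close> never has to be written out.

  Both projections are vector bundles because in each case a linear rearrangement of the coordinates
  of a chart of \<open>J\<^sup>1(J\<^sup>1M)\<close> separates the coordinates of the base point from those of the fibre
  (\<open>vector_bundleI\<close>).
\<close>

section \<open>Finite-dimensional inner product spaces\<close>

text \<open>
  A predicate on the type, because the model spaces need not be of class \<open>euclidean_space\<close>.
\<close>

definition fin_dim :: "'e::real_inner itself \<Rightarrow> bool" where
  "fin_dim _ \<longleftrightarrow> (\<exists>B::'e set. finite B \<and> span B = UNIV)"

lemma fin_dimI: "finite (B::'e::real_inner set) \<Longrightarrow> span B = UNIV \<Longrightarrow> fin_dim TYPE('e::real_inner)"
  by (auto simp: fin_dim_def)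

text \<open>
  Orthonormal expansions are the form in which finite dimension is used: they reduce statements about an arbitrary
  linear map to its finitely many values on \<open>C\<close>.
\<close>

lemma fin_dim_orthonormal:
  assumes "fin_dim TYPE('e::real_inner)"
  obtains C :: "'e::real_inner set" where "finite C" "\<And>x. x = (\<Sum>b\<in>C. (x \<bullet> b) *\<^sub>R b)"
proof -
  obtain B :: "'e set" where B: "finite B" "span B = UNIV"
    using assms by (auto simp: fin_dim_def)
  obtain C :: "'e set" where C: "finite C" "span C = UNIV" "pairwise orthogonal C"
    using basis_orthogonal[OF B(1)] B(2) by metis
  \<comment> \<open>An orthogonal spanning set may contain 0, which has to go before normalizing.\<close>
  define D where "D = (\<lambda>b. b /\<^sub>R norm b) ` (C - {0})"
  have inj: "inj_on (\<lambda>b. b /\<^sub>R norm b) (C - {0})"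
  proof (rule inj_onI)
    fix a b assume a: "a \<in> C - {0}" and b: "b \<in> C - {0}" and eq: "a /\<^sub>R norm a = b /\<^sub>R norm b"
    show "a = b"
    proof (rule ccontr)
      assume "a \<noteq> b"
      then have "a \<bullet> b = 0"
        using C(3) a b by (auto simp: pairwise_def orthogonal_def)
      then have "(a /\<^sub>R norm a) \<bullet> (b /\<^sub>R norm b) = 0" by simp
      then show False using eq b by simp
    qed
  qed
  have "finite D" using C by (simp add: D_def)
  moreover have "x = (\<Sum>d\<in>D. (x \<bullet> d) *\<^sub>R d)" for x
  proof -
    have "x \<in> span C" using C by simp
    then obtain u where u: "x = (\<Sum>b\<in>C. u b *\<^sub>R b)"
      using C(1) by (auto simp: span_finite)
    have ip: "x \<bullet> c = u c * (c \<bullet> c)" if "c \<in> C" for c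
    proof -
      have "x \<bullet> c = (\<Sum>b\<in>C. u b * (b \<bullet> c))"
        by (simp add: u inner_sum_left)
      also have "\<dots> = (\<Sum>b\<in>C. if b = c then u c * (c \<bullet> c) else 0)"
        by (rule sum.cong) (use C(3) that in \<open>auto simp: pairwise_def orthogonal_def\<close>)
      finally show ?thesis using that C(1) by simp
    qed
    have "(\<Sum>d\<in>D. (x \<bullet> d) *\<^sub>R d) = (\<Sum>b\<in>C - {0}. (x \<bullet> (b /\<^sub>R norm b)) *\<^sub>R (b /\<^sub>R norm b))"
      unfolding D_def by (subst sum.reindex[OF inj]) simp
    also have "\<dots> = (\<Sum>b\<in>C - {0}. u b *\<^sub>R b)"
    proof (rule sum.cong[OF refl])
      fix b assume b: "b \<in> C - {0}"
      then have nz: "norm b \<noteq> 0" by simp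
      have "x \<bullet> b = u b * (norm b * norm b)"
        using ip[of b] b by (metis DiffD1 dot_square_norm power2_eq_square)
      then have "x \<bullet> (b /\<^sub>R norm b) * inverse (norm b) = u b" using nz
        by (simp add: field_simps)
      then show "(x \<bullet> (b /\<^sub>R norm b)) *\<^sub>R (b /\<^sub>R norm b) = u b *\<^sub>R b"
        by (metis scaleR_scaleR)
    qed
    also have "\<dots> = (\<Sum>b\<in>C. u b *\<^sub>R b)"
      by (rule sum.mono_neutral_left) (use C in auto)
    finally show ?thesis using u by simp
  qed
  ultimately show thesis using that by blast
qed

lemma fin_dimI_expansion:
  fixes C :: "'i set"
  assumes "finite C" "\<And>x::'e::real_inner. \<exists>u. x = (\<Sum>i\<in>C. u i *\<^sub>R e i)"
  shows "fin_dim TYPE('e)"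
proof (rule fin_dimI)
  show "finite (e ` C)" using assms by simp
  show "span (e ` C) = UNIV"
  proof (intro equalityI subsetI UNIV_I)
    fix x
    obtain u where "x = (\<Sum>i\<in>C. u i *\<^sub>R e i)" using assms(2) by blast
    also have "\<dots> \<in> span (e ` C)"
      by (intro span_sum span_scale span_base imageI)
    finally show "x \<in> span (e ` C)" .
  qed
qed

lemma fin_dim_euclidean: "fin_dim TYPE('e::euclidean_space)"
  by (rule fin_dimI[of Basis]) auto

lemma bounded_linear_Pair_left: "bounded_linear (\<lambda>x. (x, 0))"
  by (intro bounded_linear_intros)

lemma bounded_linear_Pair_right: "bounded_linear (\<lambda>x. (0, x))"
  by (intro bounded_linear_intros)

lemma vec_eq_sum_axis: "(v::'e::real_inner^'p::finite) = (\<Sum>\<alpha>\<in>UNIV. axis \<alpha> (v $ \<alpha>))"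
  by (simp add: vec_eq_iff axis_def)

lemma linear_axis: "linear (axis \<alpha> :: 'e::real_inner \<Rightarrow> 'e^'p::finite)"
  by (rule linearI) (auto simp: axis_def vec_eq_iff)

lemma bounded_linear_axis: "bounded_linear (axis \<alpha> :: 'e::real_inner \<Rightarrow> 'e^'p::finite)"
proof (rule bounded_linear_intro[of _ 1])
  fix x :: 'e
  have "(axis \<alpha> x :: 'e^'p) \<bullet> axis \<alpha> x = x \<bullet> x"
    by (simp add: inner_axis)
  then show "norm (axis \<alpha> x :: 'e^'p) \<le> norm x * 1"
    by (simp add: norm_eq_sqrt_inner)
qed (auto simp: axis_def vec_eq_iff)

lemma bounded_linear_vec_lambda:
  assumes "\<And>\<alpha>. bounded_linear (L \<alpha> :: 'd::real_normed_vector \<Rightarrow> 'e::real_inner)"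
  shows "bounded_linear (\<lambda>x. (\<chi> \<alpha>. L \<alpha> x) :: 'e^'p::finite)"
proof -
  have "bounded_linear (\<lambda>x. \<Sum>\<alpha>\<in>(UNIV::'p set). axis \<alpha> (L \<alpha> x) :: 'e^'p)"
    by (intro bounded_linear_sum bounded_linear_compose[OF bounded_linear_axis] assms)
  moreover have "(\<lambda>x. \<Sum>\<alpha>\<in>UNIV. axis \<alpha> (L \<alpha> x) :: 'e^'p) = (\<lambda>x. \<chi> \<alpha>. L \<alpha> x)"
    using vec_eq_sum_axis[of "\<chi> \<alpha>. L \<alpha> _"] by (intro ext) (simp del: vec_lambda_eta)
  ultimately show ?thesis by simp
qed

lemma fin_dim_vec:
  assumes "fin_dim TYPE('e::real_inner)"
  shows "fin_dim TYPE(('e::real_inner)^('p::finite))"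
proof -
  obtain C :: "'e set" where C: "finite C" "\<And>x. x = (\<Sum>b\<in>C. (x \<bullet> b) *\<^sub>R b)"
    using fin_dim_orthonormal[OF assms] by blast
  show ?thesis
  proof (rule fin_dimI_expansion[of "UNIV \<times> C" "\<lambda>(\<alpha>, b). axis \<alpha> b"])
    show "finite ((UNIV::'p set) \<times> C)" using C by simp
    fix v :: "'e^'p"
    have "v = (\<Sum>\<alpha>\<in>UNIV. axis \<alpha> (\<Sum>b\<in>C. (v $ \<alpha> \<bullet> b) *\<^sub>R b))"
      using vec_eq_sum_axis[of v] by (simp flip: C(2))
    also have "\<dots> = (\<Sum>\<alpha>\<in>UNIV. \<Sum>b\<in>C. (v $ \<alpha> \<bullet> b) *\<^sub>R axis \<alpha> b)"
      by (simp add: linear_sum[OF linear_axis] linear_scale[OF linear_axis])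
    also have "\<dots> = (\<Sum>i\<in>UNIV\<times>C. (v $ fst i \<bullet> snd i) *\<^sub>R (\<lambda>(\<alpha>, b). axis \<alpha> b) i)"
      by (simp add: sum.cartesian_product case_prod_unfold)
    finally show "\<exists>u. v = (\<Sum>i\<in>UNIV\<times>C. u i *\<^sub>R (\<lambda>(\<alpha>, b). axis \<alpha> b) i)"
      by (rule exI[of _ "\<lambda>i. v $ fst i \<bullet> snd i"])
  qed
qed

lemma fin_dim_prod:
  assumes "fin_dim TYPE('e::real_inner)" "fin_dim TYPE('f::real_inner)"
  shows "fin_dim TYPE(('e::real_inner) \<times> ('f::real_inner))"
proof -
  obtain C :: "'e set" where C: "finite C" "\<And>x. x = (\<Sum>b\<in>C. (x \<bullet> b) *\<^sub>R b)"
    using fin_dim_orthonormal[OF assms(1)] by blast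
  obtain D :: "'f set" where D: "finite D" "\<And>x. x = (\<Sum>b\<in>D. (x \<bullet> b) *\<^sub>R b)"
    using fin_dim_orthonormal[OF assms(2)] by blast
  let ?B = "(\<lambda>b. (b, 0::'f)) ` C \<union> (\<lambda>b. (0::'e, b)) ` D"
  show ?thesis
  proof (rule fin_dimI)
    show "finite ?B" using C D by simp
    show "span ?B = UNIV"
    proof (intro equalityI subsetI UNIV_I)
      fix z :: "'e \<times> 'f"
      have "z = (\<Sum>b\<in>C. (fst z \<bullet> b) *\<^sub>R (b, 0)) + (\<Sum>b\<in>D. (snd z \<bullet> b) *\<^sub>R (0, b))"
        using C(2)[of "fst z"] D(2)[of "snd z"]
        by (intro prod_eqI) (simp_all add: fst_sum snd_sum)
      also have "\<dots> \<in> span ?B"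
        by (intro span_add span_sum span_scale span_base) auto
      finally show "z \<in> span ?B" .
    qed
  qed
qed

text \<open>
  Thus a linear map depends smoothly on parameters as soon as its values on finitely many vectors do.
\<close>

lemma linear_expansion:
  assumes "x = (\<Sum>b\<in>C. (x \<bullet> b) *\<^sub>R b)" "linear L"
  shows "L x = (\<Sum>b\<in>C. (x \<bullet> b) *\<^sub>R L b)"
proof -
  have "L x = L (\<Sum>b\<in>C. (x \<bullet> b) *\<^sub>R b)" using assms(1) by (rule arg_cong)
  then show ?thesis by (simp only: linear_sum[OF assms(2)] linear_scale[OF assms(2)])
qed

text \<open>
  Balls with radius \<open>1/(n+1)\<close> about the points with rational coordinates.
\<close>

lemma fin_dim_countable_basis:
  assumes "fin_dim TYPE('e::real_inner)"
  obtains \<B> :: "'e::real_inner set set" where "countable \<B>" "\<And>N. N \<in> \<B> \<Longrightarrow> open N"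
    "\<And>S x. open S \<Longrightarrow> x \<in> S \<Longrightarrow> \<exists>N\<in>\<B>. x \<in> N \<and> N \<subseteq> S"
proof -
  obtain C :: "'e set" where C: "finite C" "\<And>x. x = (\<Sum>b\<in>C. (x \<bullet> b) *\<^sub>R b)"
    using fin_dim_orthonormal[OF assms] by blast
  define D where "D = (\<lambda>q. \<Sum>b\<in>C. q b *\<^sub>R b) ` (C \<rightarrow>\<^sub>E \<rat>)"
  have cD: "countable D"
    unfolding D_def by (intro countable_image countable_PiE) (auto simp: C countable_rat)
  have dense: "\<exists>d\<in>D. dist d x < e" if e: "e > 0" for x :: 'e and e :: real
  proof -
    \<comment> \<open>Coordinates accurate to \<open>e / K\<close> give a point accurate to \<open>e\<close>.\<close>
    define K where "K = (\<Sum>b\<in>C. norm b) + 1"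
    have K: "K > 0" unfolding K_def by (simp add: add_nonneg_pos sum_nonneg)
    have "\<exists>q\<in>\<rat>. \<bar>q - x \<bullet> b\<bar> < e / K" for b
    proof -
      obtain q where "q \<in> \<rat>" "x \<bullet> b - e/K < q" "q < x \<bullet> b"
        using Rats_dense_in_real[of "x \<bullet> b - e/K" "x \<bullet> b"] e K by auto
      then show ?thesis by (intro bexI[of _ q]) auto
    qed
    then obtain q where q: "\<And>b. q b \<in> \<rat>" "\<And>b. \<bar>q b - x \<bullet> b\<bar> < e / K" by metis
    let ?d = "\<Sum>b\<in>C. restrict q C b *\<^sub>R b"
    have "?d \<in> D" unfolding D_def using q by (intro image_eqI[OF refl]) (auto simp: PiE_def Pi_def extensional_def)
    moreover have "dist ?d x < e"
    proof -
      have "?d - x = (\<Sum>b\<in>C. (q b - x \<bullet> b) *\<^sub>R b)"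
        using C(2)[of x] by (simp add: scaleR_left_diff_distrib sum_subtractf)
      then have "norm (?d - x) \<le> (\<Sum>b\<in>C. \<bar>q b - x \<bullet> b\<bar> * norm b)"
        by (simp add: order_trans[OF norm_sum])
      also have "\<dots> \<le> (\<Sum>b\<in>C. e / K * norm b)"
        by (intro sum_mono mult_right_mono) (use q in \<open>auto simp: less_imp_le\<close>)
      also have "\<dots> = e / K * (K - 1)" by (simp add: K_def sum_distrib_left)
      also have "\<dots> < e" using e K by (simp add: field_simps)
      finally show ?thesis by (simp add: dist_norm)
    qed
    ultimately show ?thesis by blast
  qed
  let ?\<B> = "(\<lambda>(d, n). ball d (1 / Suc n)) ` (D \<times> UNIV)"
  show thesis
  proof (rule that)
    show "countable ?\<B>" using cD by (intro countable_image countable_SIGMA) auto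
    show "open N" if "N \<in> ?\<B>" for N using that by auto
    fix S and x :: 'e assume "open S" "x \<in> S"
    then obtain e where e: "e > 0" "ball x e \<subseteq> S" using open_contains_ball by blast
    obtain n where n: "1 / Suc n < e / 2" using e nat_approx_posE[of "e/2"] by auto
    obtain d where d: "d \<in> D" "dist d x < 1 / Suc n" using dense[of "1 / Suc n" x] by auto
    have "ball d (1 / Suc n) \<subseteq> ball x e"
    proof
      fix y assume "y \<in> ball d (1 / Suc n)"
      then show "y \<in> ball x e"
        using dist_triangle[of x y d] d n by (simp add: dist_commute)
    qed
    then show "\<exists>N\<in>?\<B>. x \<in> N \<and> N \<subseteq> S"
      using d e by (intro bexI[of _ "ball d (1 / Suc n)"]) auto
  qed
qed

section \<open>Calculus of smooth maps\<close>

lemma Ck_subset: "Ck k f S \<Longrightarrow> T \<subseteq> S \<Longrightarrow> Ck k f T"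
  by (induction k arbitrary: f) (auto intro: continuous_on_subset)

text \<open>
  The derivatives in \<open>Ck\<close> are taken in the whole space, so \<open>S\<close> has to be open.
\<close>

lemma Ck_cong:
  assumes "open S" "\<And>z. z \<in> S \<Longrightarrow> f z = g z" "Ck k f S"
  shows "Ck k g S"
  using assms(2,3)
proof (induction k arbitrary: f g)
  case 0
  then show ?case by (simp cong: continuous_on_cong)
next
  case (Suc k)
  have d: "(g has_derivative frechet_derivative f (at z)) (at z)" if "z \<in> S" for z
    using Suc.prems(2) that assms(1) Suc.prems(1)
    by (auto simp: frechet_derivative_works intro: has_derivative_transform_within_open)
  then have e: "frechet_derivative f (at z) = frechet_derivative g (at z)" if "z \<in> S" for z
    using frechet_derivative_at that by blast
  show ?case
  proof -
    have "Ck k (\<lambda>z. frechet_derivative g (at z) v) S" for v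
      by (rule Suc.IH[of "\<lambda>z. frechet_derivative f (at z) v"]) (use e Suc.prems(2) in auto)
    then show ?thesis using d by (auto simp: differentiable_def)
  qed
qed

lemma Ck_local:
  assumes "\<And>z. z \<in> S \<Longrightarrow> \<exists>T. open T \<and> z \<in> T \<and> Ck k f T"
  shows "Ck k f S"
  using assms
proof (induction k arbitrary: f)
  case 0
  then show ?case
    by (simp add: continuous_on_eq_continuous_at[symmetric])
       (meson continuous_at_imp_continuous_at_within continuous_on_eq_continuous_at
         continuous_on_eq_continuous_within)
next
  case (Suc k)
  then show ?case by (fastforce)
qed

lemma Ck_Suc_D: "Ck (Suc k) f S \<Longrightarrow> Ck k f S"
proof (induction k arbitrary: f)
  case 0
  then show ?case
    by (auto intro!: differentiable_imp_continuous_on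
        simp: differentiable_on_def differentiable_at_withinI)
next
  case (Suc k)
  then show ?case by (metis Ck.simps(2))
qed

lemma Ck_SucI:
  assumes "open S" "\<And>z. z \<in> S \<Longrightarrow> (f has_derivative f' z) (at z)" "\<And>v. Ck k (\<lambda>z. f' z v) S"
  shows "Ck (Suc k) f S"
proof -
  have e: "frechet_derivative f (at z) = f' z" if "z \<in> S" for z
    using frechet_derivative_at assms(2) that by metis
  have "Ck k (\<lambda>z. frechet_derivative f (at z) v) S" for v
    by (rule Ck_cong[OF assms(1) _ assms(3)[of v]]) (simp add: e)
  then show ?thesis using assms(2) by (auto simp: differentiable_def)
qed

lemma Ck_has_derivative:
  "Ck (Suc k) f S \<Longrightarrow> z \<in> S \<Longrightarrow> (f has_derivative frechet_derivative f (at z)) (at z)"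
  by (simp add: frechet_derivative_works)

lemma Ck_const: "open S \<Longrightarrow> Ck k (\<lambda>z. c) S"
  by (induction k arbitrary: c) (auto simp: continuous_on_const)

lemma Ck_ident: "open S \<Longrightarrow> Ck k (\<lambda>z. z) S"
  by (cases k) (auto simp: continuous_on_id Ck_const)

lemma Ck_bounded_linear_compose:
  assumes "bounded_linear L" "open S"
  shows "Ck k f S \<Longrightarrow> Ck k (\<lambda>z. L (f z)) S"
proof (induction k arbitrary: f)
  case 0
  then show ?case using assms
    by (simp add: bounded_linear.continuous_on)
next
  case (Suc k)
  show ?case
  proof (rule Ck_SucI[OF assms(2)])
    show "((\<lambda>z. L (f z)) has_derivative (\<lambda>v. L (frechet_derivative f (at z) v))) (at z)"
      if "z \<in> S" for z
      by (rule bounded_linear.has_derivative[OF assms(1) Ck_has_derivative[OF Suc.prems that]])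
    show "Ck k (\<lambda>z. L (frechet_derivative f (at z) v)) S" for v
      using Suc by auto
  qed
qed

lemma Ck_add:
  assumes "open S"
  shows "Ck k f S \<Longrightarrow> Ck k g S \<Longrightarrow> Ck k (\<lambda>z. f z + g z) S"
proof (induction k arbitrary: f g)
  case 0
  then show ?case by (simp add: continuous_on_add)
next
  case (Suc k)
  show ?case
  proof (rule Ck_SucI[OF assms])
    show "((\<lambda>z. f z + g z) has_derivative
            (\<lambda>v. frechet_derivative f (at z) v + frechet_derivative g (at z) v)) (at z)"
      if "z \<in> S" for z
      by (intro has_derivative_add Ck_has_derivative[OF _ that]; fact Suc.prems)
    show "Ck k (\<lambda>z. frechet_derivative f (at z) v + frechet_derivative g (at z) v) S" for v
      using Suc by auto
  qed
qed

lemma Ck_sum: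
  assumes "open S" "\<And>i. i \<in> I \<Longrightarrow> Ck k (f i) S"
  shows "Ck k (\<lambda>z. \<Sum>i\<in>I. f i z) S"
  using assms(2)
  by (induction I rule: infinite_finite_induct) (auto intro: Ck_add Ck_const assms(1))

lemma Ck_scaleR:
  assumes "open S"
  shows "Ck k c S \<Longrightarrow> Ck k f S \<Longrightarrow> Ck k (\<lambda>z. (c z :: real) *\<^sub>R f z) S"
proof (induction k arbitrary: c f)
  case 0
  then show ?case by (simp add: continuous_on_scaleR)
next
  case (Suc k)
  show ?case
  proof (rule Ck_SucI[OF assms])
    show "((\<lambda>z. c z *\<^sub>R f z) has_derivative
            (\<lambda>v. c z *\<^sub>R frechet_derivative f (at z) v + frechet_derivative c (at z) v *\<^sub>R f z)) (at z)"
      if "z \<in> S" for z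
      by (intro has_derivative_scaleR Ck_has_derivative[OF _ that]; fact Suc.prems)
    show "Ck k (\<lambda>z. c z *\<^sub>R frechet_derivative f (at z) v + frechet_derivative c (at z) v *\<^sub>R f z) S"
      for v
      by (intro Ck_add[OF assms] Suc.IH) (use Suc.prems Ck_Suc_D in auto)
  qed
qed

lemma Ck_inverse:
  assumes "open S" "\<And>z. z \<in> S \<Longrightarrow> f z \<noteq> (0::real)"
  shows "Ck k f S \<Longrightarrow> Ck k (\<lambda>z. inverse (f z)) S"
proof (induction k)
  case 0
  then show ?case using assms by (auto intro: continuous_on_inverse)
next
  case (Suc k)
  have i: "Ck k (\<lambda>z. inverse (f z)) S" using Suc Ck_Suc_D by blast
  show ?case
  proof (rule Ck_SucI[OF assms(1)])
    show "((\<lambda>z. inverse (f z)) has_derivative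
            (\<lambda>v. - 1 *\<^sub>R (inverse (f z) *\<^sub>R (frechet_derivative f (at z) v *\<^sub>R inverse (f z))))) (at z)"
      if "z \<in> S" for z
      using Deriv.has_derivative_inverse[OF assms(2)[OF that] Ck_has_derivative[OF Suc.prems that]]
      by (simp add: mult.assoc)
    show "Ck k (\<lambda>z. - 1 *\<^sub>R (inverse (f z) *\<^sub>R (frechet_derivative f (at z) v *\<^sub>R inverse (f z)))) S" for v
      by (intro Ck_scaleR[OF assms(1)] Ck_const i assms(1)) (use Suc.prems in auto)
  qed
qed

text \<open>
  By the chain rule \<open>D(g \<circ> f)(z) v = Dg(f z)(Df(z) v)\<close>, but \<open>Ck\<close> speaks only
  about derivatives in constant directions. Expanding \<open>Df(z) v\<close> in an orthonormal basis turns the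
  right-hand side into a finite sum of products to which the induction hypothesis applies.
\<close>

lemma Ck_compose:
  assumes "fin_dim TYPE('e::real_inner)" "open S"
  shows "Ck k (f :: 'd::real_normed_vector \<Rightarrow> 'e) S \<Longrightarrow> Ck k g T \<Longrightarrow> f ` S \<subseteq> T \<Longrightarrow>
    Ck k (\<lambda>z. g (f z)) S"
proof (induction k arbitrary: f g)
  case 0
  then show ?case using continuous_on_compose2[of T g S f] by simp
next
  case (Suc k)
  obtain C :: "'e set" where C: "finite C" "\<And>x. x = (\<Sum>b\<in>C. (x \<bullet> b) *\<^sub>R b)"
    using fin_dim_orthonormal[OF assms(1)] by blast
  let ?Df = "\<lambda>z. frechet_derivative f (at z)" and ?Dg = "\<lambda>z. frechet_derivative g (at z)"
  show ?case
  proof (rule Ck_SucI[OF assms(2)])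
    fix z assume z: "z \<in> S"
    have g: "(g has_derivative ?Dg (f z)) (at (f z))"
      using Suc.prems z by (intro Ck_has_derivative) auto
    have "((\<lambda>z. g (f z)) has_derivative (\<lambda>v. ?Dg (f z) (?Df z v))) (at z)"
      using diff_chain_at[OF Ck_has_derivative[OF Suc.prems(1) z] g] by (simp add: o_def)
    moreover have "?Dg (f z) (?Df z v) = (\<Sum>b\<in>C. (?Df z v \<bullet> b) *\<^sub>R ?Dg (f z) b)" for v
      by (rule linear_expansion[OF C(2) has_derivative_linear[OF g]])
    ultimately show "((\<lambda>z. g (f z)) has_derivative
        (\<lambda>v. \<Sum>b\<in>C. (?Df z v \<bullet> b) *\<^sub>R ?Dg (f z) b)) (at z)"
      by (rule has_derivative_eq_rhs[OF _ ext])
  next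
    fix v
    show "Ck k (\<lambda>z. \<Sum>b\<in>C. (?Df z v \<bullet> b) *\<^sub>R ?Dg (f z) b) S"
    proof (intro Ck_sum[OF assms(2)] Ck_scaleR[OF assms(2)])
      fix b
      show "Ck k (\<lambda>z. ?Df z v \<bullet> b) S"
        by (rule Ck_bounded_linear_compose[OF bounded_linear_inner_left assms(2)])
          (use Suc.prems in auto)
      show "Ck k (\<lambda>z. ?Dg (f z) b) S"
        by (rule Suc.IH[OF Ck_Suc_D[OF Suc.prems(1)] _ Suc.prems(3)]) (use Suc.prems in auto)
    qed
  qed
qed

lemma smooth_on_subset: "smooth_on S f \<Longrightarrow> T \<subseteq> S \<Longrightarrow> smooth_on T f"
  unfolding smooth_on_def using Ck_subset by blast

lemma smooth_on_cong:
  "open S \<Longrightarrow> (\<And>z. z \<in> S \<Longrightarrow> f z = g z) \<Longrightarrow> smooth_on S f \<Longrightarrow> smooth_on S g"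
  unfolding smooth_on_def using Ck_cong by metis

lemma smooth_on_local:
  "(\<And>z. z \<in> S \<Longrightarrow> \<exists>T. open T \<and> z \<in> T \<and> smooth_on T f) \<Longrightarrow> smooth_on S f"
  unfolding smooth_on_def by (metis Ck_local)

lemma smooth_on_imp_continuous_on: "smooth_on S f \<Longrightarrow> continuous_on S f"
  unfolding smooth_on_def by (metis Ck.simps(1))

lemma smooth_on_has_derivative:
  "smooth_on S f \<Longrightarrow> z \<in> S \<Longrightarrow> (f has_derivative frechet_derivative f (at z)) (at z)"
  unfolding smooth_on_def by (metis Ck_has_derivative)

lemma smooth_on_differentiable: "smooth_on S f \<Longrightarrow> z \<in> S \<Longrightarrow> f differentiable (at z)"
  using smooth_on_has_derivative by (metis differentiableI)

lemma smooth_on_frechet_derivative: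
  "smooth_on S f \<Longrightarrow> smooth_on S (\<lambda>z. frechet_derivative f (at z) v)"
  unfolding smooth_on_def by (metis Ck.simps(2))

lemma smooth_on_const: "open S \<Longrightarrow> smooth_on S (\<lambda>z. c)"
  by (simp add: smooth_on_def Ck_const)

lemma smooth_on_ident: "open S \<Longrightarrow> smooth_on S (\<lambda>z. z)"
  by (simp add: smooth_on_def Ck_ident)

lemma smooth_on_bounded_linear_compose:
  "bounded_linear L \<Longrightarrow> open S \<Longrightarrow> smooth_on S f \<Longrightarrow> smooth_on S (\<lambda>z. L (f z))"
  by (simp add: smooth_on_def Ck_bounded_linear_compose)

lemma smooth_on_bounded_linear: "bounded_linear L \<Longrightarrow> open S \<Longrightarrow> smooth_on S L"
  by (rule smooth_on_bounded_linear_compose[OF _ _ smooth_on_ident])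

lemma smooth_on_add:
  "open S \<Longrightarrow> smooth_on S f \<Longrightarrow> smooth_on S g \<Longrightarrow> smooth_on S (\<lambda>z. f z + g z)"
  by (simp add: smooth_on_def Ck_add)

lemma smooth_on_sum:
  "open S \<Longrightarrow> (\<And>i. i \<in> I \<Longrightarrow> smooth_on S (f i)) \<Longrightarrow> smooth_on S (\<lambda>z. \<Sum>i\<in>I. f i z)"
  by (simp add: smooth_on_def Ck_sum)

lemma smooth_on_scaleR:
  "open S \<Longrightarrow> smooth_on S c \<Longrightarrow> smooth_on S f \<Longrightarrow> smooth_on S (\<lambda>z. (c z :: real) *\<^sub>R f z)"
  by (simp add: smooth_on_def Ck_scaleR)

lemma smooth_on_inverse:
  "open S \<Longrightarrow> (\<And>z. z \<in> S \<Longrightarrow> f z \<noteq> (0::real)) \<Longrightarrow> smooth_on S f \<Longrightarrow>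
    smooth_on S (\<lambda>z. inverse (f z))"
  by (simp add: smooth_on_def Ck_inverse)

lemma smooth_on_compose:
  assumes "fin_dim TYPE('e::real_inner)" "open S"
    "smooth_on S (f :: 'd::real_normed_vector \<Rightarrow> 'e)" "smooth_on T g" "f ` S \<subseteq> T"
  shows "smooth_on S (\<lambda>z. g (f z))"
  using assms unfolding smooth_on_def by (metis Ck_compose)

lemma smooth_on_Pair:
  assumes "open S" "smooth_on S f" "smooth_on S g"
  shows "smooth_on S (\<lambda>z. (f z, g z))"
proof -
  have "smooth_on S (\<lambda>z. (f z, 0) + (0, g z))"
    by (intro smooth_on_add assms smooth_on_bounded_linear_compose[OF bounded_linear_Pair_left]
        smooth_on_bounded_linear_compose[OF bounded_linear_Pair_right])
  then show ?thesis by simp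
qed

lemma smooth_on_vec_lambda:
  assumes "open S" "\<And>\<alpha>. smooth_on S (\<lambda>z. f z \<alpha> :: 'e::real_inner)"
  shows "smooth_on S (\<lambda>z. (\<chi> \<alpha>. f z \<alpha>) :: 'e^'p::finite)"
proof -
  have "smooth_on S (\<lambda>z. \<Sum>\<alpha>\<in>(UNIV::'p set). axis \<alpha> (f z \<alpha>) :: 'e^'p)"
    by (intro smooth_on_sum assms smooth_on_bounded_linear_compose[OF bounded_linear_axis])
  moreover have "(\<lambda>z. \<Sum>\<alpha>\<in>UNIV. axis \<alpha> (f z \<alpha>) :: 'e^'p) = (\<lambda>z. \<chi> \<alpha>. f z \<alpha>)"
    using vec_eq_sum_axis[of "\<chi> \<alpha>. f _ \<alpha>"] by (intro ext) (simp del: vec_lambda_eta)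
  ultimately show ?thesis by simp
qed

text \<open>
  For smoothness of derivatives of transition maps in both of their arguments.
\<close>

lemma smooth_on_linear_family_apply:
  assumes C: "finite C" "\<And>x::'e::real_inner. x = (\<Sum>b\<in>C. (x \<bullet> b) *\<^sub>R b)"
    and l: "\<And>z. z \<in> S \<Longrightarrow> linear (D z :: 'e \<Rightarrow> 'f::real_normed_vector)"
    and "open S" "\<And>b. b \<in> C \<Longrightarrow> smooth_on S (\<lambda>z. D z b)" "smooth_on S w"
  shows "smooth_on S (\<lambda>z. D z (w z))"
proof (rule smooth_on_cong[OF \<open>open S\<close>])
  show "smooth_on S (\<lambda>z. \<Sum>b\<in>C. (w z \<bullet> b) *\<^sub>R D z b)"
    by (intro smooth_on_sum smooth_on_scaleR assms
        smooth_on_bounded_linear_compose[OF bounded_linear_inner_left])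
  show "(\<Sum>b\<in>C. (w z \<bullet> b) *\<^sub>R D z b) = D z (w z)" if "z \<in> S" for z
    by (rule linear_expansion[OF C(2) l[OF that], symmetric])
qed

lemma pderiv_bounded_linear:
  assumes "bounded_linear L" "f differentiable (at z)"
  shows "pderiv_at (\<lambda>u. L (f u)) v z = L (pderiv_at f v z)"
  using frechet_derivative_at[OF bounded_linear.has_derivative[OF assms(1)]] assms(2)
  by (metis frechet_derivative_works)

lemma pderiv_cong:
  assumes "open S" "z \<in> S" "\<And>u. u \<in> S \<Longrightarrow> f u = g u" "f differentiable (at z)"
  shows "pderiv_at f v z = pderiv_at g v z"
proof -
  have "(g has_derivative frechet_derivative f (at z)) (at z)"
    using assms by (metis frechet_derivative_works has_derivative_transform_within_open)
  then show ?thesis by (metis frechet_derivative_at)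
qed

section \<open>Symmetry of second derivatives\<close>

text \<open>
  The mean value theorem, applied in direction \<open>a\<close> and then in direction \<open>b\<close>.
\<close>

lemma second_difference_mean_value:
  fixes f :: "'v::real_normed_vector \<Rightarrow> real"
  assumes S: "\<And>s t. 0 \<le> s \<Longrightarrow> s \<le> h \<Longrightarrow> 0 \<le> t \<Longrightarrow> t \<le> h \<Longrightarrow> z + s *\<^sub>R a + t *\<^sub>R b \<in> S"
    and d1: "\<And>p. p \<in> S \<Longrightarrow> (f has_derivative D1 p) (at p)"
    and d2: "\<And>p. p \<in> S \<Longrightarrow> ((\<lambda>p. D1 p a) has_derivative D2 p) (at p)"
    and h: "h > 0"
  shows "\<exists>s t. 0 \<le> s \<and> s \<le> h \<and> 0 \<le> t \<and> t \<le> h \<and>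
     f (z + h *\<^sub>R a + h *\<^sub>R b) - f (z + h *\<^sub>R a) - f (z + h *\<^sub>R b) + f z
       = h * h * D2 (z + s *\<^sub>R a + t *\<^sub>R b) b"
proof -
  \<comment> \<open>The second difference is the increment of \<open>g\<close> over \<open>[0, h]\<close>.\<close>
  define g where "g s = f (z + s *\<^sub>R a + h *\<^sub>R b) - f (z + s *\<^sub>R a + 0 *\<^sub>R b)" for s
  have fs: "((\<lambda>s. f (z + s *\<^sub>R a + t *\<^sub>R b)) has_real_derivative D1 (z + s *\<^sub>R a + t *\<^sub>R b) a) (at s)"
    if "0 \<le> s" "s \<le> h" "0 \<le> t" "t \<le> h" for s t
  proof -
    have "((\<lambda>s. z + s *\<^sub>R a + t *\<^sub>R b) has_derivative (\<lambda>r. r *\<^sub>R a)) (at s)"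
      by (auto intro!: derivative_eq_intros)
    from diff_chain_at[OF this d1[OF S[OF that]]]
    have "((\<lambda>s. f (z + s *\<^sub>R a + t *\<^sub>R b)) has_derivative (\<lambda>r. D1 (z + s *\<^sub>R a + t *\<^sub>R b) (r *\<^sub>R a))) (at s)"
      by (simp add: o_def)
    moreover have "D1 (z + s *\<^sub>R a + t *\<^sub>R b) (r *\<^sub>R a) = r * D1 (z + s *\<^sub>R a + t *\<^sub>R b) a" for r
      using linear_scale[OF has_derivative_linear[OF d1[OF S[OF that]]]] by simp
    ultimately show ?thesis by (simp add: has_field_derivative_def mult.commute[of _ "D1 _ _"])
  qed
  have "\<exists>s. 0 < s \<and> s < h \<and> g h - g 0 = (h - 0) *
      (D1 (z + s *\<^sub>R a + h *\<^sub>R b) a - D1 (z + s *\<^sub>R a + 0 *\<^sub>R b) a)"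
  proof (rule MVT2[OF h])
    fix s assume "0 \<le> s" "s \<le> h"
    then show "(g has_real_derivative (D1 (z + s *\<^sub>R a + h *\<^sub>R b) a - D1 (z + s *\<^sub>R a + 0 *\<^sub>R b) a)) (at s)"
      unfolding g_def using h by (intro DERIV_diff fs) auto
  qed
  then obtain s where s: "0 < s" "s < h" "g h - g 0 = h *
      (D1 (z + s *\<^sub>R a + h *\<^sub>R b) a - D1 (z + s *\<^sub>R a + 0 *\<^sub>R b) a)" by auto
  have "\<exists>t. 0 < t \<and> t < h \<and> D1 (z + s *\<^sub>R a + h *\<^sub>R b) a - D1 (z + s *\<^sub>R a + 0 *\<^sub>R b) a
      = (h - 0) * D2 (z + s *\<^sub>R a + t *\<^sub>R b) b"
  proof (rule MVT2[OF h])
    fix t assume t: "0 \<le> t" "t \<le> h"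
    have "((\<lambda>t. z + s *\<^sub>R a + t *\<^sub>R b) has_derivative (\<lambda>r. r *\<^sub>R b)) (at t)"
      by (auto intro!: derivative_eq_intros)
    from diff_chain_at[OF this d2[OF S]]
    have "((\<lambda>t. D1 (z + s *\<^sub>R a + t *\<^sub>R b) a) has_derivative (\<lambda>r. D2 (z + s *\<^sub>R a + t *\<^sub>R b) (r *\<^sub>R b))) (at t)"
      using s t by (simp add: o_def)
    moreover have "D2 (z + s *\<^sub>R a + t *\<^sub>R b) (r *\<^sub>R b) = r * D2 (z + s *\<^sub>R a + t *\<^sub>R b) b" for r
      using linear_scale[OF has_derivative_linear[OF d2[OF S]]] s t by simp
    ultimately show "((\<lambda>t. D1 (z + s *\<^sub>R a + t *\<^sub>R b) a) has_real_derivative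
        D2 (z + s *\<^sub>R a + t *\<^sub>R b) b) (at t)"
      by (simp add: has_field_derivative_def mult.commute[of _ "D2 _ _"])
  qed
  then obtain t where t: "0 < t" "t < h" "D1 (z + s *\<^sub>R a + h *\<^sub>R b) a - D1 (z + s *\<^sub>R a + 0 *\<^sub>R b) a
      = h * D2 (z + s *\<^sub>R a + t *\<^sub>R b) b" by auto
  have "f (z + h *\<^sub>R a + h *\<^sub>R b) - f (z + h *\<^sub>R a) - f (z + h *\<^sub>R b) + f z = g h - g 0"
    by (simp add: g_def)
  also have "\<dots> = h * h * D2 (z + s *\<^sub>R a + t *\<^sub>R b) b"
    unfolding s(3) t(3) by simp
  finally show ?thesis using s t by (intro exI[of _ s] exI[of _ t]) auto
qed

text \<open>
  The second difference over a small parallelogram is symmetric in \<open>a\<close> and \<open>b\<close>. The mean value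
  theorem identifies it with \<open>h\<^sup>2\<close> times either mixed derivative at some nearby point, and the mixed
  derivatives are continuous.
\<close>

lemma mixed_derivatives_commute_real:
  fixes f :: "'v::real_normed_vector \<Rightarrow> real"
  assumes "open S" "z \<in> S" and f: "Ck 2 f S"
  shows "pderiv_at (pderiv_at f a) b z = pderiv_at (pderiv_at f b) a z"
proof -
  let ?D1 = "\<lambda>p. frechet_derivative f (at p)"
  let ?D2 = "\<lambda>a p. frechet_derivative (\<lambda>p. frechet_derivative f (at p) a) (at p)"
  have f2: "Ck (Suc (Suc 0)) f S" using f by (simp add: numeral_2_eq_2)
  have d1: "(f has_derivative ?D1 p) (at p)" if "p \<in> S" for p
    by (rule Ck_has_derivative[OF f2 that])
  have C1: "Ck (Suc 0) (\<lambda>p. ?D1 p a) S" for a using f2 by auto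
  have d2: "((\<lambda>p. ?D1 p a) has_derivative ?D2 a p) (at p)" if "p \<in> S" for a p
    by (rule Ck_has_derivative[OF C1 that])
  have cont: "continuous_on S (\<lambda>p. ?D2 a p b)" for a b using f2 by simp
  have "\<bar>?D2 a z b - ?D2 b z a\<bar> \<le> e" if e: "e > 0" for e
  proof -
    have "\<exists>d>0. \<forall>p. dist p z < d \<longrightarrow> dist (?D2 a p b) (?D2 a z b) < e / 2" for a b
    proof -
      have "isCont (\<lambda>p. ?D2 a p b) z"
        using cont[of a b] assms(2) by (simp add: continuous_on_eq_continuous_at[OF assms(1)])
      then show ?thesis
        using e half_gt_zero unfolding continuous_at_eps_delta by blast
    qed
    then obtain d1 d2 where d: "d1 > 0" "\<And>p. dist p z < d1 \<Longrightarrow> dist (?D2 a p b) (?D2 a z b) < e / 2"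
      "d2 > 0" "\<And>p. dist p z < d2 \<Longrightarrow> dist (?D2 b p a) (?D2 b z a) < e / 2" by metis
    obtain d0 where d0: "d0 > 0" "ball z d0 \<subseteq> S" using assms open_contains_ball by blast
    define d where "d = min d0 (min d1 d2)"
    have dp: "d > 0" using d d0 by (simp add: d_def)
    \<comment> \<open>For \<open>h = d / (2 K)\<close> the whole parallelogram spanned by \<open>h a\<close> and \<open>h b\<close> stays within distance \<open>d\<close> of \<open>z\<close>.\<close>
    define K where "K = norm a + norm b + 1"
    have K: "K > 0" by (simp add: K_def add_nonneg_pos)
    define h where "h = d / (2 * K)"
    have h: "h > 0" using dp K by (simp add: h_def)
    have hK: "h * (norm a + norm b) < d"
    proof -
      have "h * (norm a + norm b) \<le> h * K" using h by (simp add: K_def)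
      also have "\<dots> = d / 2" using K by (simp add: h_def)
      finally show ?thesis using dp by simp
    qed
    have near: "dist (z + s *\<^sub>R u + t *\<^sub>R v) z < d"
      if "0 \<le> s" "s \<le> h" "0 \<le> t" "t \<le> h" "norm u + norm v = norm a + norm b" for s t u v
    proof -
      have "norm (s *\<^sub>R u + t *\<^sub>R v) \<le> s * norm u + t * norm v"
        using norm_triangle_ineq[of "s *\<^sub>R u" "t *\<^sub>R v"] that by simp
      also have "\<dots> \<le> h * norm u + h * norm v"
        using that by (intro add_mono mult_right_mono) auto
      also have "\<dots> = h * (norm a + norm b)"
        using that(5) by (simp flip: distrib_left)
      also note hK
      finally show ?thesis by (simp add: dist_norm add.assoc)
    qed
    have inS: "z + s *\<^sub>R u + t *\<^sub>R v \<in> S"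
      if "0 \<le> s" "s \<le> h" "0 \<le> t" "t \<le> h" "norm u + norm v = norm a + norm b" for s t u v
    proof -
      have "dist (z + s *\<^sub>R u + t *\<^sub>R v) z < d0" using near[OF that] by (simp add: d_def)
      then show ?thesis using d0(2) by (auto simp: subset_iff dist_commute)
    qed
    obtain s t where st: "0 \<le> s" "s \<le> h" "0 \<le> t" "t \<le> h"
       "f (z + h *\<^sub>R a + h *\<^sub>R b) - f (z + h *\<^sub>R a) - f (z + h *\<^sub>R b) + f z
         = h * h * ?D2 a (z + s *\<^sub>R a + t *\<^sub>R b) b"
      using second_difference_mean_value[OF inS d1 d2 h, of a b] by auto
    obtain s' t' where st': "0 \<le> s'" "s' \<le> h" "0 \<le> t'" "t' \<le> h"
       "f (z + h *\<^sub>R b + h *\<^sub>R a) - f (z + h *\<^sub>R b) - f (z + h *\<^sub>R a) + f z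
         = h * h * ?D2 b (z + s' *\<^sub>R b + t' *\<^sub>R a) a"
      using second_difference_mean_value[OF inS d1 d2 h, of b a] by (auto simp: add.commute)
    have swap: "z + h *\<^sub>R b + h *\<^sub>R a = z + h *\<^sub>R a + h *\<^sub>R b" by (simp add: algebra_simps)
    have "h * h * ?D2 a (z + s *\<^sub>R a + t *\<^sub>R b) b = h * h * ?D2 b (z + s' *\<^sub>R b + t' *\<^sub>R a) a"
      using st(5) st'(5)[unfolded swap] by linarith
    then have eq: "?D2 a (z + s *\<^sub>R a + t *\<^sub>R b) b = ?D2 b (z + s' *\<^sub>R b + t' *\<^sub>R a) a"
      using h by simp
    have "dist (?D2 a (z + s *\<^sub>R a + t *\<^sub>R b) b) (?D2 a z b) < e / 2"
      using near[OF st(1-4), of a b] by (intro d(2)) (simp add: d_def)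
    moreover have "dist (?D2 b (z + s' *\<^sub>R b + t' *\<^sub>R a) a) (?D2 b z a) < e / 2"
      using near[OF st'(1-4), of b a] by (intro d(4)) (simp add: d_def add.commute)
    ultimately show ?thesis using eq unfolding dist_real_def by linarith
  qed
  then have "\<bar>?D2 a z b - ?D2 b z a\<bar> \<le> 0" by (rule field_le_epsilon) simp
  then show ?thesis by simp
qed

lemma mixed_derivatives_commute:
  fixes f :: "'v::real_normed_vector \<Rightarrow> 'e::real_inner"
  assumes "open S" "z \<in> S" and f: "smooth_on S f"
  shows "pderiv_at (pderiv_at f a) b z = pderiv_at (pderiv_at f b) a z"
proof -
  have comp: "pderiv_at (pderiv_at (\<lambda>p. f p \<bullet> w) a) b z = pderiv_at (pderiv_at f a) b z \<bullet> w"
    for w a b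
  proof -
    have 1: "pderiv_at (\<lambda>p. f p \<bullet> w) a p = pderiv_at f a p \<bullet> w" if "p \<in> S" for p
      using frechet_derivative_at[OF bounded_linear.has_derivative[OF bounded_linear_inner_left
            smooth_on_has_derivative[OF f that], of w]] by metis
    have "((\<lambda>p. pderiv_at f a p \<bullet> w) has_derivative (\<lambda>v. pderiv_at (pderiv_at f a) v z \<bullet> w)) (at z)"
      by (rule bounded_linear.has_derivative[OF bounded_linear_inner_left
            smooth_on_has_derivative[OF smooth_on_frechet_derivative[OF f] assms(2)]])
    then have "((\<lambda>p. pderiv_at (\<lambda>p. f p \<bullet> w) a p) has_derivative
        (\<lambda>v. pderiv_at (pderiv_at f a) v z \<bullet> w)) (at z)"
      by (rule has_derivative_transform_within_open[OF _ assms(1,2)]) (simp add: 1)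
    from frechet_derivative_at[OF this] show ?thesis by metis
  qed
  have "Ck 2 (\<lambda>p. f p \<bullet> w) S" for w
    using f unfolding smooth_on_def
    by (intro Ck_bounded_linear_compose[OF bounded_linear_inner_left assms(1)]) auto
  then have "pderiv_at (pderiv_at f a) b z \<bullet> w = pderiv_at (pderiv_at f b) a z \<bullet> w" for w
    unfolding comp[symmetric] by (rule mixed_derivatives_commute_real[OF assms(1,2)])
  then show ?thesis by (metis inner_commute vector_eq_ldot)
qed

lemma slice_right_has_derivative:
  assumes "f differentiable (at (u, v))"
  shows "((\<lambda>v. f (u, v)) has_derivative (\<lambda>w. pderiv_at f (0, w) (u, v))) (at v)"
proof -
  have "((\<lambda>v. (u, v)) has_derivative (\<lambda>w. (0, w))) (at v)"
    by (auto intro!: derivative_eq_intros)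
  from diff_chain_at[OF this] show ?thesis
    using assms by (fastforce simp: frechet_derivative_works o_def)
qed

lemma slice_left_has_derivative:
  assumes "f differentiable (at (u, v))"
  shows "((\<lambda>u. f (u, v)) has_derivative (\<lambda>w. pderiv_at f (w, 0) (u, v))) (at u)"
proof -
  have "((\<lambda>u. (u, v)) has_derivative (\<lambda>w. (w, 0))) (at u)"
    by (auto intro!: derivative_eq_intros)
  from diff_chain_at[OF this] show ?thesis
    using assms by (fastforce simp: frechet_derivative_works o_def)
qed

lemma open_slice_left:
  fixes S :: "('a::topological_space \<times> 'b::topological_space) set"
  assumes "open S"
  shows "open {u. (u, v) \<in> S}"
proof -
  have "continuous_on UNIV (\<lambda>u::'a. (u, v))" by (intro continuous_intros)
  from open_vimage[OF assms this] show ?thesis by (simp add: vimage_def)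
qed

lemma open_slice_right:
  fixes S :: "('a::topological_space \<times> 'b::topological_space) set"
  assumes "open S"
  shows "open {v. (u, v) \<in> S}"
proof -
  have "continuous_on UNIV (\<lambda>v::'b. (u, v))" by (intro continuous_intros)
  from open_vimage[OF assms this] show ?thesis by (simp add: vimage_def)
qed

lemma iterated_pderiv_left:
  assumes "open S" "(u, v) \<in> S" "smooth_on S f"
  shows "((\<lambda>u. pderiv_at (\<lambda>v. f (u, v)) w v) has_derivative
    (\<lambda>w'. pderiv_at (pderiv_at f (0, w)) (w', 0) (u, v))) (at u)"
proof (rule has_derivative_transform_within_open[OF _ open_slice_left[OF assms(1)]])
  show "((\<lambda>u. pderiv_at f (0, w) (u, v)) has_derivative
    (\<lambda>w'. pderiv_at (pderiv_at f (0, w)) (w', 0) (u, v))) (at u)"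
    by (rule slice_left_has_derivative
          [OF smooth_on_differentiable[OF smooth_on_frechet_derivative[OF assms(3)] assms(2)]])
  show "u \<in> {u. (u, v) \<in> S}" using assms by simp
  show "pderiv_at f (0, w) (u, v) = pderiv_at (\<lambda>v. f (u, v)) w v" if "u \<in> {u. (u, v) \<in> S}" for u
    using frechet_derivative_at[OF slice_right_has_derivative[OF smooth_on_differentiable[OF assms(3)]]] that
    by (metis mem_Collect_eq)
qed

lemma iterated_pderiv_right:
  assumes "open S" "(u, v) \<in> S" "smooth_on S f"
  shows "((\<lambda>v. pderiv_at (\<lambda>u. f (u, v)) w u) has_derivative
    (\<lambda>w'. pderiv_at (pderiv_at f (w, 0)) (0, w') (u, v))) (at v)"
proof (rule has_derivative_transform_within_open[OF _ open_slice_right[OF assms(1)]])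
  show "((\<lambda>v. pderiv_at f (w, 0) (u, v)) has_derivative
    (\<lambda>w'. pderiv_at (pderiv_at f (w, 0)) (0, w') (u, v))) (at v)"
    by (rule slice_right_has_derivative
          [OF smooth_on_differentiable[OF smooth_on_frechet_derivative[OF assms(3)] assms(2)]])
  show "v \<in> {v. (u, v) \<in> S}" using assms by simp
  show "pderiv_at f (w, 0) (u, v) = pderiv_at (\<lambda>u. f (u, v)) w u" if "v \<in> {v. (u, v) \<in> S}" for v
    using frechet_derivative_at[OF slice_left_has_derivative[OF smooth_on_differentiable[OF assms(3)]]] that
    by (metis mem_Collect_eq)
qed

text \<open>
  Symmetry of the second derivative in the form in which it occurs in double jets, where one variable is frozen before
  differentiating in the other.
\<close>

lemma iterated_pderiv_commute:
  assumes "open S" "(u, v) \<in> S" "smooth_on S (f :: _ \<Rightarrow> 'e::real_inner)"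
  shows "pderiv_at (\<lambda>u. pderiv_at (\<lambda>v. f (u, v)) w v) w' u =
    pderiv_at (\<lambda>v. pderiv_at (\<lambda>u. f (u, v)) w' u) w v"
  using frechet_derivative_at[OF iterated_pderiv_left[OF assms]]
    frechet_derivative_at[OF iterated_pderiv_right[OF assms]]
    mixed_derivatives_commute[OF assms]
  by metis

section \<open>Maps into small balls\<close>

text \<open>
  Agrees with the identity up to first order at 0 but has a bounded range, which is arbitrarily small for large
  \<open>c\<close>. Precomposition with it makes a map defined near 0 in a chart into one that is defined on the whole
  space and takes values in the chart.
\<close>

definition squash :: "real \<Rightarrow> 'v::real_inner \<Rightarrow> 'v" where
  "squash c u = inverse (1 + c * (u \<bullet> u)) *\<^sub>R u"

lemma squash_0 [simp]: "squash c 0 = 0"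
  by (simp add: squash_def)

lemma squash_denominator_pos: "c > 0 \<Longrightarrow> 1 + c * (u \<bullet> u) > 0"
  by (simp add: add_pos_nonneg)

lemma smooth_on_squash:
  assumes "fin_dim TYPE('v::real_inner)" "c > 0"
  shows "smooth_on UNIV (squash c :: 'v \<Rightarrow> 'v)"
proof -
  obtain C :: "'v set" where C: "finite C" "\<And>x. x = (\<Sum>b\<in>C. (x \<bullet> b) *\<^sub>R b)"
    using fin_dim_orthonormal[OF assms(1)] by blast
  have ip: "u \<bullet> u = (\<Sum>b\<in>C. (u \<bullet> b) * (u \<bullet> b))" for u
    using arg_cong[OF C(2)[of u], of "\<lambda>w. u \<bullet> w"] by (simp add: inner_sum_right)
  have lin: "smooth_on UNIV (\<lambda>u::'v. u \<bullet> b)" for b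
    by (intro smooth_on_bounded_linear bounded_linear_inner_left open_UNIV)
  have "smooth_on UNIV (\<lambda>u::'v. c *\<^sub>R (\<Sum>b\<in>C. (u \<bullet> b) *\<^sub>R (u \<bullet> b)))"
    by (intro smooth_on_scaleR[OF open_UNIV] smooth_on_const[OF open_UNIV]
        smooth_on_sum[OF open_UNIV] lin)
  then have "smooth_on UNIV (\<lambda>u::'v. c * (u \<bullet> u))" by (simp flip: ip)
  then have "smooth_on UNIV (\<lambda>u::'v. 1 + c * (u \<bullet> u))"
    by (intro smooth_on_add[OF open_UNIV] smooth_on_const[OF open_UNIV])
  moreover have "1 + c * (u \<bullet> u) \<noteq> 0" for u :: 'v
    using squash_denominator_pos[OF assms(2), of u] by simp
  ultimately have "smooth_on UNIV (\<lambda>u::'v. inverse (1 + c * (u \<bullet> u)) *\<^sub>R u)"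
    by (intro smooth_on_scaleR[OF open_UNIV] smooth_on_inverse[OF open_UNIV]
        smooth_on_ident[OF open_UNIV]) auto
  then show ?thesis by (simp add: squash_def[abs_def])
qed

lemma squash_has_derivative_0:
  assumes "c > 0"
  shows "(squash c has_derivative (\<lambda>v. v)) (at 0)"
  unfolding squash_def[abs_def]
  by (rule derivative_eq_intros refl | simp)+

lemma norm_squash_less:
  assumes "e > 0"
  shows "norm (squash (1 / e\<^sup>2) u) < e"
proof -
  define n where "n = norm u"
  have n: "n \<ge> 0" by (simp add: n_def)
  have p: "1 + n\<^sup>2 / e\<^sup>2 > 0" by (simp add: add_pos_nonneg)
  have "norm (squash (1 / e\<^sup>2) u) = n / (1 + n\<^sup>2 / e\<^sup>2)"
    using p by (simp add: squash_def n_def power2_norm_eq_inner divide_inverse mult.commute)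
  also have "\<dots> < e"
  proof -
    \<comment> \<open>The bound is \<open>n * e < e\<^sup>2 + n\<^sup>2\<close>, and \<open>e\<^sup>2 + n\<^sup>2 - e * n = (e - n)\<^sup>2 + e * n\<close>.\<close>
    have "0 < (e - n)\<^sup>2 + e * n"
    proof (cases "n = 0")
      case True then show ?thesis using assms by simp
    next
      case False
      then have "e * n > 0" using n assms by simp
      then show ?thesis by (simp add: add_nonneg_pos)
    qed
    then have "e * n < e\<^sup>2 + n\<^sup>2" by (simp add: power2_eq_square algebra_simps)
    then have "n < (e\<^sup>2 + n\<^sup>2) / e" using assms by (simp add: field_simps)
    also have "\<dots> = e * (1 + n\<^sup>2 / e\<^sup>2)" using assms by (simp add: field_simps power2_eq_square)
    finally show ?thesis using p by (simp add: pos_divide_less_eq)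
  qed
  finally show ?thesis .
qed

text \<open>
  Both factors are squeezed into balls of radius \<open>d / 2\<close>, where \<open>Q\<close> maps the ball of radius
  \<open>d\<close> to \<open>S\<close>.
\<close>

lemma squash_into_open:
  fixes Q :: "'u::real_inner \<times> 'v::real_inner \<Rightarrow> 'e::real_normed_vector"
  assumes "continuous_on UNIV Q" "open S" "Q 0 \<in> S"
  obtains c where "c > 0" "\<And>u v. Q (squash c u, squash c v) \<in> S"
proof -
  have "open (Q -` S)" by (rule open_vimage[OF assms(2,1)])
  then obtain d where d: "d > 0" "ball 0 d \<subseteq> Q -` S"
    using assms(3) open_contains_ball by (metis vimage_eq)
  have "Q (squash (1 / (d/2)\<^sup>2) u, squash (1 / (d/2)\<^sup>2) v) \<in> S" for u v
  proof -
    have "norm (squash (1 / (d/2)\<^sup>2) u, squash (1 / (d/2)\<^sup>2) v) < d / 2 + d / 2"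
      using norm_squash_less[of "d/2" u] norm_squash_less[of "d/2" v] d(1)
      by (intro le_less_trans[OF norm_Pair_le]) auto
    then show ?thesis using d(2) by (auto simp: subset_iff)
  qed
  then show thesis using d(1) by (intro that[of "1 / (d/2)\<^sup>2"]) auto
qed

text \<open>
  The linear map whose partial derivatives are the components of \<open>v\<close>.
\<close>

definition lin_comb :: "'e::real_inner^'p::finite \<Rightarrow> real^'p \<Rightarrow> 'e" where
  "lin_comb v w = (\<Sum>\<alpha>\<in>UNIV. (w $ \<alpha>) *\<^sub>R (v $ \<alpha>))"

lemma bounded_linear_lin_comb: "bounded_linear (lin_comb v)"
  unfolding lin_comb_def[abs_def]
  by (intro bounded_linear_sum bounded_linear_scaleR_const bounded_linear_vec_nth)

lemma lin_comb_0 [simp]: "lin_comb v 0 = 0"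
  by (simp add: lin_comb_def)

lemma lin_comb_axis [simp]: "lin_comb v (axis \<alpha> 1) = v $ \<alpha>"
  by (simp add: lin_comb_def axis_def if_distrib[of "\<lambda>r. r *\<^sub>R _"] cong: if_cong)

lemma smooth_on_lin_comb_squash:
  assumes "c > 0"
  shows "smooth_on UNIV (\<lambda>u. lin_comb v (squash c u))"
  by (rule smooth_on_bounded_linear_compose[OF bounded_linear_lin_comb open_UNIV
        smooth_on_squash[OF fin_dim_euclidean assms]])

lemma pderiv_lin_comb_squash:
  assumes "c > 0"
  shows "pderiv_at (\<lambda>u. k + lin_comb v (squash c u)) w 0 = lin_comb v w"
proof -
  have "(lin_comb v has_derivative lin_comb v) (at (squash c 0))"
    by (rule bounded_linear_imp_has_derivative[OF bounded_linear_lin_comb])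
  from diff_chain_at[OF squash_has_derivative_0[OF assms] this]
  have "((\<lambda>u. k + lin_comb v (squash c u)) has_derivative lin_comb v) (at 0)"
    by (auto simp: o_def intro!: derivative_eq_intros)
  then show ?thesis by (metis frechet_derivative_at)
qed

section \<open>Atlases and smooth maps between manifolds\<close>

text \<open>
  The differentiable part of the notion of a smooth manifold. Products and restrictions, which occur in local
  trivializations, are treated at this level.
\<close>

definition smooth_atlas :: "('a, 'e::real_inner) atlas \<Rightarrow> bool" where
  "smooth_atlas A \<longleftrightarrow>
     fin_dim TYPE('e) \<and>
     (\<forall>(U, x)\<in>A. inj_on x U \<and> open (x ` U)) \<and>
     (\<forall>(U, x)\<in>A. \<forall>(V, y)\<in>A.
        open (x ` (U \<inter> V)) \<and> smooth_on (x ` (U \<inter> V)) (y \<circ> inv_into U x))"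

lemma smooth_manifold_iff:
  "smooth_manifold A \<longleftrightarrow>
     smooth_atlas A \<and> Hausdorff_space (mtop A) \<and> second_countable (mtop A)"
  by (auto simp: smooth_manifold_def smooth_atlas_def fin_dim_def)

lemma smooth_atlas_fin_dim: "smooth_atlas (A :: ('a, 'e::real_inner) atlas) \<Longrightarrow> fin_dim TYPE('e)"
  by (simp add: smooth_atlas_def)

lemma smooth_atlas_chart:
  assumes "smooth_atlas A" "(U, x) \<in> A"
  shows "inj_on x U" "open (x ` U)"
  using assms by (auto simp: smooth_atlas_def)

lemma smooth_atlas_transition:
  assumes "smooth_atlas A" "(U, x) \<in> A" "(V, y) \<in> A"
  shows "open (x ` (U \<inter> V))" "smooth_on (x ` (U \<inter> V)) (y \<circ> inv_into U x)"
  using assms by (fastforce simp: smooth_atlas_def)+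

text \<open>
  Any function \<open>g\<close> that represents the change of charts may replace
  \<open>y \<circ> inv_into U x\<close>.
\<close>

lemma smooth_atlasI:
  assumes "fin_dim TYPE('e::real_inner)"
    and "\<And>U x. (U, x) \<in> A \<Longrightarrow> inj_on x U"
    and "\<And>U x V y. (U, x) \<in> A \<Longrightarrow> (V, y) \<in> A \<Longrightarrow> open (x ` (U \<inter> V))"
    and "\<And>U x V y. (U, x) \<in> A \<Longrightarrow> (V, y) \<in> A \<Longrightarrow>
           \<exists>g. smooth_on (x ` (U \<inter> V)) g \<and> (\<forall>p\<in>U \<inter> V. y p = g (x p))"
  shows "smooth_atlas (A :: ('a, 'e) atlas)"
proof -
  have chart: "inj_on x U \<and> open (x ` U)" if "(U, x) \<in> A" for U x
    using assms(2)[OF that] assms(3)[OF that that] by simp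
  have "open (x ` (U \<inter> V)) \<and> smooth_on (x ` (U \<inter> V)) (y \<circ> inv_into U x)"
    if U: "(U, x) \<in> A" and V: "(V, y) \<in> A" for U x V y
  proof
    show o: "open (x ` (U \<inter> V))" by (rule assms(3)[OF U V])
    obtain g where g: "smooth_on (x ` (U \<inter> V)) g" "\<forall>p\<in>U \<inter> V. y p = g (x p)"
      using assms(4)[OF U V] by blast
    show "smooth_on (x ` (U \<inter> V)) (y \<circ> inv_into U x)"
      by (rule smooth_on_cong[OF o _ g(1)])
         (use g(2) assms(2)[OF U] in \<open>auto simp: inv_into_f_f\<close>)
  qed
  then show ?thesis
    using assms(1) chart unfolding smooth_atlas_def by auto
qed

lemma points_chart: "(U, x) \<in> A \<Longrightarrow> p \<in> U \<Longrightarrow> p \<in> points A"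
  by (auto simp: points_def)

lemma pointsE:
  assumes "p \<in> points A"
  obtains U x where "(U, x) \<in> A" "p \<in> U"
  using assms by (auto simp: points_def)

lemma openin_mtop:
  assumes "smooth_atlas A"
  shows "openin (mtop A) W \<longleftrightarrow> W \<subseteq> points A \<and> (\<forall>(U, x)\<in>A. open (x ` (W \<inter> U)))"
proof -
  let ?P = "\<lambda>W. W \<subseteq> points A \<and> (\<forall>(U, x)\<in>A. open (x ` (W \<inter> U)))"
  have "istopology ?P"
    unfolding istopology_def
  proof (intro conjI allI impI)
    fix S T assume S: "?P S" and T: "?P T"
    show "S \<inter> T \<subseteq> points A" using S by auto
    show "\<forall>(U, x)\<in>A. open (x ` (S \<inter> T \<inter> U))"
    proof clarify
      fix U x assume U: "(U, x) \<in> A"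
      have "x ` (S \<inter> T \<inter> U) = x ` (S \<inter> U) \<inter> x ` (T \<inter> U)"
        using smooth_atlas_chart(1)[OF assms U] by (auto simp: inj_on_def)
      then show "open (x ` (S \<inter> T \<inter> U))" using S T U by auto
    qed
  next
    fix K assume K: "\<forall>S\<in>K. ?P S"
    show "\<Union>K \<subseteq> points A" using K by auto
    show "\<forall>(U, x)\<in>A. open (x ` (\<Union>K \<inter> U))"
    proof clarify
      fix U x assume U: "(U, x) \<in> A"
      have "x ` (\<Union>K \<inter> U) = (\<Union>S\<in>K. x ` (S \<inter> U))" by auto
      moreover have "open (x ` (S \<inter> U))" if "S \<in> K" for S using K U that by auto
      ultimately show "open (x ` (\<Union>K \<inter> U))" by (simp add: open_UN)
    qed
  qed
  then show ?thesis by (simp add: mtop_def topology_inverse')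
qed

lemma topspace_mtop:
  assumes "smooth_atlas A"
  shows "topspace (mtop A) = points A"
proof -
  have "openin (mtop A) (points A)"
  proof -
    have "points A \<inter> U = U" if "(U, x) \<in> A" for U x
      using that by (auto simp: points_def)
    then show ?thesis
      unfolding openin_mtop[OF assms] using smooth_atlas_chart(2)[OF assms] by auto
  qed
  then show ?thesis
    using openin_mtop[OF assms] openin_topspace by (metis openin_subset subset_antisym)
qed

lemma open_chart_image:
  assumes "smooth_atlas A" "(U, x) \<in> A" "openin (mtop A) W"
  shows "open (x ` (U \<inter> W))"
  using assms openin_mtop[OF assms(1)] by (auto simp: Int_commute)

lemma openin_chart_vimage:
  assumes A: "smooth_atlas A" and U: "(U, x) \<in> A" and "open N"
  shows "openin (mtop A) {p \<in> U. x p \<in> N}"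
  unfolding openin_mtop[OF A]
proof (intro conjI)
  show "{p \<in> U. x p \<in> N} \<subseteq> points A" using U by (auto simp: points_def)
  show "\<forall>(V, y)\<in>A. open (y ` ({p \<in> U. x p \<in> N} \<inter> V))"
  proof clarify
    fix V y assume V: "(V, y) \<in> A"
    have "y ` ({p \<in> U. x p \<in> N} \<inter> V) = y ` (V \<inter> U) \<inter> (x \<circ> inv_into V y) -` N"
      using smooth_atlas_chart(1)[OF A V] by (auto simp: inv_into_f_f)
    then show "open (y ` ({p \<in> U. x p \<in> N} \<inter> V))"
      using smooth_atlas_transition[OF A V U] \<open>open N\<close>
      by (metis continuous_open_preimage smooth_on_imp_continuous_on)
  qed
qed

lemma openin_chart_domain:
  assumes "smooth_atlas A" "(U, x) \<in> A"
  shows "openin (mtop A) U"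
  using openin_chart_vimage[OF assms open_UNIV] by simp

text \<open>
  Smoothness may be checked near each point in one suitable pair of charts, with any function \<open>g\<close>
  representing \<open>f\<close> there. Both continuity and smoothness in all other charts follow because transition maps
  are smooth.
\<close>

lemma smooth_mapI:
  fixes A :: "('a, 'e::real_inner) atlas" and B :: "('b, 'f::real_inner) atlas"
  assumes A: "smooth_atlas A" and B: "smooth_atlas B"
    and loc: "\<And>p. p \<in> points A \<Longrightarrow> \<exists>U x V y W g. (U, x) \<in> A \<and> (V, y) \<in> B \<and>
      openin (mtop A) W \<and> p \<in> W \<and> W \<subseteq> U \<and> f ` W \<subseteq> V \<and>
      smooth_on (x ` W) g \<and> (\<forall>q\<in>W. y (f q) = g (x q))"
  shows "smooth_map A B f"
proof -
  have op: "openin (mtop A) {p \<in> points A. f p \<in> W'}" if W': "openin (mtop B) W'" for W'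
  proof (subst openin_subopen, clarify)
    fix p assume p: "p \<in> points A" "f p \<in> W'"
    obtain U x V y W g where U: "(U, x) \<in> A" and V: "(V, y) \<in> B"
      and W: "openin (mtop A) W" "p \<in> W" "W \<subseteq> U" "f ` W \<subseteq> V"
      and g: "smooth_on (x ` W) g" "\<forall>q\<in>W. y (f q) = g (x q)"
      using loc[OF p(1)] by blast
    have oW: "open (x ` W)" using open_chart_image[OF A U W(1)] W(3) by (simp add: Int_absorb1)
    have "open (x ` W \<inter> g -` (y ` (V \<inter> W')))" (is "open ?N")
      by (rule continuous_open_preimage[OF smooth_on_imp_continuous_on[OF g(1)] oW
            open_chart_image[OF B V W']])
    then have "openin (mtop A) {q \<in> U. x q \<in> ?N}" by (rule openin_chart_vimage[OF A U])
    moreover have "p \<in> {q \<in> U. x q \<in> ?N}"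
    proof -
      have "f p \<in> V" "g (x p) = y (f p)" using W(2,4) g(2) by auto
      then show ?thesis using W(2,3) p(2) by auto
    qed
    moreover have "{q \<in> U. x q \<in> ?N} \<subseteq> {p \<in> points A. f p \<in> W'}"
    proof clarify
      fix q r r' assume q: "q \<in> U" and r: "x q = x r" "r \<in> W" and r': "g (x q) = y r'" "r' \<in> V" "r' \<in> W'"
      have "q = r" using smooth_atlas_chart(1)[OF A U] q r W(3) by (auto simp: inj_on_def)
      then have "y (f q) = y r'" using r r' g(2) by auto
      then have "f q = r'"
        using smooth_atlas_chart(1)[OF B V] r' W(4) \<open>q = r\<close> r by (auto simp: inj_on_def)
      then show "q \<in> points A \<and> f q \<in> W'" using r' points_chart[OF U q] by simp
    qed
    ultimately show "\<exists>T. openin (mtop A) T \<and> p \<in> T \<and> T \<subseteq> {p \<in> points A. f p \<in> W'}" by blast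
  qed
  have maps: "f p \<in> points B" if "p \<in> points A" for p
    using loc[OF that] points_chart by (metis image_subset_iff)
  have "continuous_map (mtop A) (mtop B) f"
    using maps op by (auto simp: continuous_map_def topspace_mtop[OF A] topspace_mtop[OF B])
  moreover have "smooth_on (x1 ` (U1 \<inter> f -` V1)) (y1 \<circ> f \<circ> inv_into U1 x1)"
    if U1: "(U1, x1) \<in> A" and V1: "(V1, y1) \<in> B" for U1 x1 V1 y1
  proof (rule smooth_on_local)
    fix z assume "z \<in> x1 ` (U1 \<inter> f -` V1)"
    then obtain p where p: "p \<in> U1" "f p \<in> V1" "z = x1 p" by auto
    obtain U x V y W g where U: "(U, x) \<in> A" and V: "(V, y) \<in> B"
      and W: "openin (mtop A) W" "p \<in> W" "W \<subseteq> U" "f ` W \<subseteq> V"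
      and g: "smooth_on (x ` W) g" "\<forall>q\<in>W. y (f q) = g (x q)"
      using loc[OF points_chart[OF U1 p(1)]] by blast
    let ?T = "U1 \<inter> (W \<inter> {q \<in> points A. f q \<in> V1})"
    have o: "open (x1 ` ?T)"
      by (intro open_chart_image[OF A U1] openin_Int W(1) op openin_chart_domain[OF B V1])
    have inv1: "inv_into U1 x1 (x1 q) = q" if "q \<in> U1" for q
      using smooth_atlas_chart(1)[OF A U1] that by simp
    have invV: "inv_into V y (y q) = q" if "q \<in> V" for q
      using smooth_atlas_chart(1)[OF B V] that by simp
    have s1: "smooth_on (x1 ` ?T) (x \<circ> inv_into U1 x1)"
      by (rule smooth_on_subset[OF smooth_atlas_transition(2)[OF A U1 U]]) (use W(3) in auto)
    have s2: "smooth_on (x1 ` ?T) (\<lambda>z. g ((x \<circ> inv_into U1 x1) z))"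
      by (rule smooth_on_compose[OF smooth_atlas_fin_dim[OF A] o s1 g(1)]) (auto simp: inv1)
    \<comment> \<open>The representative of \<open>f\<close> in the given charts is the good one between two transition maps.\<close>
    have "smooth_on (x1 ` ?T) (\<lambda>z. (y1 \<circ> inv_into V y) (g ((x \<circ> inv_into U1 x1) z)))"
    proof (rule smooth_on_compose[OF smooth_atlas_fin_dim[OF B] o s2 smooth_atlas_transition(2)[OF B V V1]])
      show "(\<lambda>z. g ((x \<circ> inv_into U1 x1) z)) ` x1 ` ?T \<subseteq> y ` (V \<inter> V1)"
      proof clarify
        fix q assume q: "q \<in> U1" "q \<in> W" "f q \<in> V1"
        have "g ((x \<circ> inv_into U1 x1) (x1 q)) = y (f q)" using g(2) q by (simp add: inv1)
        then show "g ((x \<circ> inv_into U1 x1) (x1 q)) \<in> y ` (V \<inter> V1)" using W(4) q by auto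
      qed
    qed
    then have "smooth_on (x1 ` ?T) (y1 \<circ> f \<circ> inv_into U1 x1)"
    proof (rule smooth_on_cong[OF o, rotated])
      fix z assume "z \<in> x1 ` ?T"
      then obtain q where q: "q \<in> U1" "q \<in> W" "z = x1 q" by auto
      have "g (x q) = y (f q)" and "f q \<in> V" using g(2) q W(4) by auto
      then show "(y1 \<circ> inv_into V y) (g ((x \<circ> inv_into U1 x1) z)) = (y1 \<circ> f \<circ> inv_into U1 x1) z"
        using q by (simp add: inv1 invV)
    qed
    moreover have "z \<in> x1 ` ?T" using p W points_chart[OF U1 p(1)] by auto
    ultimately show "\<exists>T. open T \<and> z \<in> T \<and> smooth_on T (y1 \<circ> f \<circ> inv_into U1 x1)"
      using o by blast
  qed
  ultimately show ?thesis unfolding smooth_map_def by auto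
qed

lemma smooth_map_points:
  assumes "smooth_atlas A" "smooth_atlas B" "smooth_map A B f" "p \<in> points A"
  shows "f p \<in> points B"
  using assms(3,4) topspace_mtop[OF assms(1)] topspace_mtop[OF assms(2)]
  by (auto simp: smooth_map_def continuous_map_def)

lemma smooth_map_openin_vimage:
  assumes "smooth_atlas A" "smooth_map A B f" "openin (mtop B) W"
  shows "openin (mtop A) {p \<in> points A. f p \<in> W}"
  using assms(2,3) topspace_mtop[OF assms(1)]
  by (auto simp: smooth_map_def continuous_map_def)

lemma points_euclid [simp]: "points euclid = UNIV"
  by (auto simp: points_def euclid_def)

lemma smooth_atlas_euclid:
  assumes "fin_dim TYPE('e::real_inner)"
  shows "smooth_atlas (euclid :: ('e, 'e) atlas)"
  by (rule smooth_atlasI[OF assms])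
     (auto simp: euclid_def intro: exI[of _ "\<lambda>z. z"] smooth_on_ident[OF open_UNIV])

lemma openin_mtop_euclid:
  assumes "fin_dim TYPE('e::real_inner)"
  shows "openin (mtop (euclid :: ('e, 'e) atlas)) W \<longleftrightarrow> open W"
  using openin_mtop[OF smooth_atlas_euclid[OF assms]] by (simp add: points_def euclid_def)

lemma smooth_map_from_euclidI:
  fixes f :: "'d::real_inner \<Rightarrow> 'a"
  assumes "fin_dim TYPE('d)" "smooth_atlas A"
    and "\<And>u. \<exists>U x N. (U, x) \<in> A \<and> open N \<and> u \<in> N \<and> f ` N \<subseteq> U \<and> smooth_on N (\<lambda>u. x (f u))"
  shows "smooth_map euclid A f"
proof (rule smooth_mapI[OF smooth_atlas_euclid[OF assms(1)] assms(2)])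
  fix u :: 'd
  obtain U x N where N: "(U, x) \<in> A" "open N" "u \<in> N" "f ` N \<subseteq> U" "smooth_on N (\<lambda>u. x (f u))"
    using assms(3) by metis
  show "\<exists>W i V y N g. (W, i) \<in> euclid \<and> (V, y) \<in> A \<and> openin (mtop euclid) N \<and> u \<in> N \<and>
      N \<subseteq> W \<and> f ` N \<subseteq> V \<and> smooth_on (i ` N) g \<and> (\<forall>q\<in>N. y (f q) = g (i q))"
    using N unfolding openin_mtop_euclid[OF assms(1)]
    by (intro exI[of _ UNIV] exI[of _ id] exI[of _ U] exI[of _ x] exI[of _ N]
        exI[of _ "\<lambda>u. x (f u)"]) (auto simp: euclid_def)
qed

lemma smooth_map_from_euclidD:
  fixes f :: "'d::real_inner \<Rightarrow> 'a"
  assumes "fin_dim TYPE('d)" "smooth_atlas A" "smooth_map euclid A f"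
  shows "f u \<in> points A"
    and "(U, x) \<in> A \<Longrightarrow> open (f -` U)"
    and "(U, x) \<in> A \<Longrightarrow> smooth_on (f -` U) (\<lambda>u. x (f u))"
proof -
  note E = smooth_atlas_euclid[OF assms(1)]
  show "f u \<in> points A" using smooth_map_points[OF E assms(2,3)] by simp
  assume U: "(U, x) \<in> A"
  show "open (f -` U)"
    using smooth_map_openin_vimage[OF E assms(3) openin_chart_domain[OF assms(2) U]]
    by (simp add: openin_mtop_euclid[OF assms(1)] vimage_def)
  have "inv_into UNIV id = (id :: 'd \<Rightarrow> 'd)" by (simp add: fun_eq_iff inv_into_def)
  then show "smooth_on (f -` U) (\<lambda>u. x (f u))"
    using assms(3) U by (fastforce simp: smooth_map_def euclid_def o_def)
qed

lemma smooth_map_from_euclid_compose: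
  fixes f :: "'d::real_inner \<Rightarrow> 'a" and g :: "'c::real_inner \<Rightarrow> 'd"
  assumes "fin_dim TYPE('c)" "fin_dim TYPE('d)" "smooth_atlas A" "smooth_map euclid A f"
    and g: "smooth_on UNIV g"
  shows "smooth_map euclid A (\<lambda>u. f (g u))"
proof (rule smooth_map_from_euclidI[OF assms(1,3)])
  fix u
  obtain U x where U: "(U, x) \<in> A" "f (g u) \<in> U"
    using smooth_map_from_euclidD(1)[OF assms(2-4)] pointsE by metis
  note D = smooth_map_from_euclidD(2,3)[OF assms(2-4) U(1)]
  have o: "open (g -` (f -` U))"
    using continuous_open_preimage[OF smooth_on_imp_continuous_on[OF g] open_UNIV D(1)] by simp
  moreover have "smooth_on (g -` (f -` U)) (\<lambda>u. x (f (g u)))"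
    by (rule smooth_on_compose[OF assms(2) o smooth_on_subset[OF g] D(2)]) auto
  ultimately show "\<exists>U x N. (U, x) \<in> A \<and> open N \<and> u \<in> N \<and> (\<lambda>u. f (g u)) ` N \<subseteq> U \<and>
      smooth_on N (\<lambda>u. x (f (g u)))"
    using U by (intro exI[of _ U] exI[of _ x] exI[of _ "g -` (f -` U)"]) auto
qed

text \<open>
  How maps with prescribed jets are obtained: it is enough to write them down in a chart.
\<close>

lemma smooth_map_into_chart:
  fixes g :: "'d::real_inner \<Rightarrow> 'e::real_inner" and A :: "('a, 'e) atlas"
  assumes "fin_dim TYPE('d)" "smooth_atlas A" "(U, x) \<in> A" "smooth_on UNIV g" "range g \<subseteq> x ` U"
  shows "smooth_map euclid A (\<lambda>u. inv_into U x (g u))"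
proof (rule smooth_map_from_euclidI[OF assms(1,2)])
  fix u
  have "(\<lambda>u. x (inv_into U x (g u))) = g"
    using assms(5) by (intro ext f_inv_into_f) auto
  then show "\<exists>U' x' N. (U', x') \<in> A \<and> open N \<and> u \<in> N \<and> (\<lambda>u. inv_into U x (g u)) ` N \<subseteq> U' \<and>
      smooth_on N (\<lambda>u. x' (inv_into U x (g u)))"
    using assms by (intro exI[of _ U] exI[of _ x] exI[of _ UNIV]) (auto intro!: inv_into_into)
qed

lemma chart_derivative:
  fixes \<phi> :: "'d::real_inner \<Rightarrow> 'a"
  assumes "fin_dim TYPE('d)" "smooth_atlas A" "smooth_map euclid A \<phi>" "(U, x) \<in> A" "\<phi> u \<in> U"
  shows "((x \<circ> \<phi>) has_derivative frechet_derivative (x \<circ> \<phi>) (at u)) (at u)"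
  using smooth_on_has_derivative[OF smooth_map_from_euclidD(3)[OF assms(1-4)]] assms(5)
  by (simp add: o_def)

lemma transition_derivative:
  assumes "smooth_atlas A" "(U, x) \<in> A" "(V, y) \<in> A" "p \<in> U" "p \<in> V"
  shows "((y \<circ> inv_into U x) has_derivative frechet_derivative (y \<circ> inv_into U x) (at (x p))) (at (x p))"
  using smooth_on_has_derivative[OF smooth_atlas_transition(2)[OF assms(1-3)]] assms(4,5) by simp

lemma chart_change_derivative:
  fixes \<phi> :: "'d::real_inner \<Rightarrow> 'a"
  assumes d: "fin_dim TYPE('d)" and A: "smooth_atlas A" and \<phi>: "smooth_map euclid A \<phi>"
    and U: "(U, x) \<in> A" "\<phi> u \<in> U" and V: "(V, y) \<in> A" "\<phi> u \<in> V"
  shows "frechet_derivative (y \<circ> \<phi>) (at u) v =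
    frechet_derivative (y \<circ> inv_into U x) (at (x (\<phi> u))) (frechet_derivative (x \<circ> \<phi>) (at u) v)"
proof -
  let ?\<tau> = "y \<circ> inv_into U x"
  have "(?\<tau> \<circ> (x \<circ> \<phi>) has_derivative
      frechet_derivative ?\<tau> (at (x (\<phi> u))) \<circ> frechet_derivative (x \<circ> \<phi>) (at u)) (at u)"
    using transition_derivative[OF A U(1) V(1) U(2) V(2)]
    by (intro diff_chain_at[OF chart_derivative[OF d A \<phi> U]]) simp
  then have "(y \<circ> \<phi> has_derivative
      frechet_derivative ?\<tau> (at (x (\<phi> u))) \<circ> frechet_derivative (x \<circ> \<phi>) (at u)) (at u)"
    by (rule has_derivative_transform_within_open[OF _ smooth_map_from_euclidD(2)[OF d A \<phi> U(1)]])
       (use U smooth_atlas_chart(1)[OF A U(1)] in auto)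
  from frechet_derivative_at[OF this] show ?thesis by (metis comp_apply)
qed

lemma points_restrict_atlas: "points (restrict_atlas A W) = points A \<inter> W"
  by (auto simp: points_def restrict_atlas_def)

lemma restrict_atlas_chart: "(U, x) \<in> A \<Longrightarrow> (U \<inter> W, x) \<in> restrict_atlas A W"
  by (force simp: restrict_atlas_def)

lemma smooth_atlas_restrict:
  assumes A: "smooth_atlas A" and W: "openin (mtop A) (points A \<inter> W)"
  shows "smooth_atlas (restrict_atlas A W)"
proof (rule smooth_atlasI[OF smooth_atlas_fin_dim[OF A]])
  have sub: "\<exists>U'. (U', x) \<in> A \<and> U = U' \<inter> (points A \<inter> W)" if "(U, x) \<in> restrict_atlas A W" for U x
  proof -
    from that obtain U' where U': "(U', x) \<in> A" "U = U' \<inter> W"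
      unfolding restrict_atlas_def image_def by (auto split: prod.splits)
    moreover have "U' \<subseteq> points A" using points_chart[OF U'(1)] by auto
    ultimately show ?thesis by auto
  qed
  fix U x assume "(U, x) \<in> restrict_atlas A W"
  then obtain U' where U': "(U', x) \<in> A" "U = U' \<inter> (points A \<inter> W)" using sub by blast
  note i = smooth_atlas_chart(1)[OF A U'(1)]
  show "inj_on x U" using i U' by (auto intro: inj_on_subset)
  fix V y assume "(V, y) \<in> restrict_atlas A W"
  then obtain V' where V': "(V', y) \<in> A" "V = V' \<inter> (points A \<inter> W)" using sub by blast
  have "U \<inter> V = U' \<inter> (V' \<inter> (points A \<inter> W))" using U' V' by auto
  then show "open (x ` (U \<inter> V))"
    using open_chart_image[OF A U'(1) openin_Int[OF openin_chart_domain[OF A V'(1)] W]] by simp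
  show "\<exists>g. smooth_on (x ` (U \<inter> V)) g \<and> (\<forall>p\<in>U \<inter> V. y p = g (x p))"
  proof (intro exI conjI ballI)
    show "smooth_on (x ` (U \<inter> V)) (y \<circ> inv_into U' x)"
      by (rule smooth_on_subset[OF smooth_atlas_transition(2)[OF A U'(1) V'(1)]])
         (use U' V' in auto)
    show "y p = (y \<circ> inv_into U' x) (x p)" if "p \<in> U \<inter> V" for p
      using that i U' by simp
  qed
qed

lemma points_prod_atlas: "points (prod_atlas A B) = points A \<times> points B"
proof (rule equalityI)
  show "points (prod_atlas A B) \<subseteq> points A \<times> points B"
    by (auto simp: points_def prod_atlas_def)
  show "points A \<times> points B \<subseteq> points (prod_atlas A B)"
  proof clarify
    fix p q assume "p \<in> points A" "q \<in> points B"
    then obtain U x V y where "(U, x) \<in> A" "p \<in> U" "(V, y) \<in> B" "q \<in> V"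
      by (auto simp: points_def)
    then have "(U \<times> V, map_prod x y) \<in> prod_atlas A B" "(p, q) \<in> U \<times> V"
      by (auto simp: prod_atlas_def)
    then show "(p, q) \<in> points (prod_atlas A B)" by (rule points_chart)
  qed
qed

lemma smooth_atlas_prod:
  fixes A :: "('a, 'e::real_inner) atlas" and B :: "('b, 'f::real_inner) atlas"
  assumes A: "smooth_atlas A" and B: "smooth_atlas B"
  shows "smooth_atlas (prod_atlas A B)"
proof (rule smooth_atlasI)
  note fA = smooth_atlas_fin_dim[OF A] and fB = smooth_atlas_fin_dim[OF B]
  show "fin_dim TYPE('e \<times> 'f)" by (rule fin_dim_prod[OF fA fB])
  fix W w assume "(W, w) \<in> prod_atlas A B"
  then obtain U x V y where W: "W = U \<times> V" "w = map_prod x y" and U: "(U, x) \<in> A" and V: "(V, y) \<in> B"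
    by (auto simp: prod_atlas_def)
  note iU = smooth_atlas_chart(1)[OF A U] and iV = smooth_atlas_chart(1)[OF B V]
  show "inj_on w W" using iU iV unfolding W by (rule map_prod_inj_on)
  fix W' w' assume "(W', w') \<in> prod_atlas A B"
  then obtain U' x' V' y' where W': "W' = U' \<times> V'" "w' = map_prod x' y'"
    and U': "(U', x') \<in> A" and V': "(V', y') \<in> B"
    by (auto simp: prod_atlas_def)
  have im: "w ` (W \<inter> W') = x ` (U \<inter> U') \<times> y ` (V \<inter> V')"
    unfolding W W' by (auto simp: Times_Int_Times map_prod_surj_on)
  note tA = smooth_atlas_transition[OF A U U'] and tB = smooth_atlas_transition[OF B V V']
  show o: "open (w ` (W \<inter> W'))" unfolding im by (intro open_Times tA tB)
  let ?g = "\<lambda>z. ((x' \<circ> inv_into U x) (fst z), (y' \<circ> inv_into V y) (snd z))"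
  have "smooth_on (w ` (W \<inter> W')) ?g"
    by (intro smooth_on_Pair[OF o] smooth_on_compose[OF fA o smooth_on_bounded_linear[OF bounded_linear_fst o] tA(2)]
        smooth_on_compose[OF fB o smooth_on_bounded_linear[OF bounded_linear_snd o] tB(2)])
       (auto simp: im)
  moreover have "\<forall>p\<in>W \<inter> W'. w' p = ?g (w p)"
    using iU iV by (auto simp: W W')
  ultimately show "\<exists>g. smooth_on (w ` (W \<inter> W')) g \<and> (\<forall>p\<in>W \<inter> W'. w' p = g (w p))" by blast
qed

text \<open>
  The preimages under countably many charts of the members of a countable basis of the model space form a countable
  basis.
\<close>

lemma second_countable_mtopI:
  fixes A :: "('a, 'e::real_inner) atlas"
  assumes A: "smooth_atlas A" and "countable A'" "A' \<subseteq> A" and cover: "points A \<subseteq> \<Union>(fst ` A')"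
  shows "second_countable (mtop A)"
proof -
  obtain \<B> :: "'e set set" where \<B>: "countable \<B>" "\<And>N. N \<in> \<B> \<Longrightarrow> open N"
    "\<And>S x. open S \<Longrightarrow> x \<in> S \<Longrightarrow> \<exists>N\<in>\<B>. x \<in> N \<and> N \<subseteq> S"
    using fin_dim_countable_basis[OF smooth_atlas_fin_dim[OF A]] by blast
  let ?\<C> = "(\<lambda>((U, x), N). {p \<in> U. x p \<in> N}) ` (A' \<times> \<B>)"
  show ?thesis
    unfolding second_countable_def
  proof (intro exI[of _ ?\<C>] conjI ballI allI impI)
    show "countable ?\<C>" using assms \<B> by auto
    show "openin (mtop A) V" if "V \<in> ?\<C>" for V
      using that \<open>A' \<subseteq> A\<close> \<B>(2) by (auto intro!: openin_chart_vimage[OF A])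
    fix W p assume W: "openin (mtop A) W \<and> p \<in> W"
    then have "p \<in> points A" using openin_mtop[OF A] by auto
    then obtain U x where U: "(U, x) \<in> A'" "p \<in> U" using cover by auto
    then have UA: "(U, x) \<in> A" using assms by auto
    obtain N where N: "N \<in> \<B>" "x p \<in> N" "N \<subseteq> x ` (U \<inter> W)"
      using \<B>(3)[OF open_chart_image[OF A UA, of W], of "x p"] W U by auto
    have "{q \<in> U. x q \<in> N} \<subseteq> W"
      using N(3) smooth_atlas_chart(1)[OF A UA] by (auto simp: inj_on_def subset_iff)
    then show "\<exists>V\<in>?\<C>. p \<in> V \<and> V \<subseteq> W"
      using U N by (intro bexI[of _ "{q \<in> U. x q \<in> N}"]) force+
  qed
qed

text \<open>
  A second countable space is Lindelof. Together with the preceding lemma this transfers second countability from a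
  manifold to its jet manifold, whose charts are indexed by the same atlas.
\<close>

lemma countable_subatlas:
  assumes A: "smooth_atlas A" and "second_countable (mtop A)"
  obtains A' where "countable A'" "A' \<subseteq> A" "points A \<subseteq> \<Union>(fst ` A')"
proof -
  have "Lindelof_space (mtop A)" by (rule second_countable_imp_Lindelof_space) fact
  moreover have "\<forall>U\<in>fst ` A. openin (mtop A) U" using openin_chart_domain[OF A] by auto
  moreover have "topspace (mtop A) \<subseteq> \<Union>(fst ` A)"
    by (auto simp: topspace_mtop[OF A] points_def)
  ultimately obtain \<V> where "countable \<V>" "\<V> \<subseteq> fst ` A" "points A \<subseteq> \<Union>\<V>"
    unfolding Lindelof_space_alt by (metis topspace_mtop[OF A])
  then show thesis using that countable_subset_image by metis
qed

section \<open>Vector bundles from adapted charts\<close>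

text \<open>
  The chart \<open>x\<close> of the total space is, up to the linear isomorphism \<open>L\<close> with inverse
  \<open>L'\<close>, the pair of a chart \<open>y\<close> of the base and a fibre coordinate \<open>\<psi>\<close> that
  respects the operations; moreover it covers all fibre coordinates over its domain.
\<close>

definition adapted_chart where
  "adapted_chart E B \<pi> add scl U x V y \<psi> L L' \<longleftrightarrow>
     (U, x) \<in> E \<and> (V, y) \<in> B \<and> U = {a \<in> points E. \<pi> a \<in> V} \<and>
     bounded_linear L \<and> bounded_linear L' \<and> (\<forall>z. L (L' z) = z) \<and> (\<forall>z. L' (L z) = z) \<and>
     (\<forall>a\<in>U. L (x a) = (y (\<pi> a), \<psi> a)) \<and> (\<forall>q\<in>V. \<forall>w. L' (y q, w) \<in> x ` U) \<and>
     (\<forall>a\<in>U. \<forall>b\<in>U. \<pi> a = \<pi> b \<longrightarrow> \<psi> (add a b) = \<psi> a + \<psi> b) \<and>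
     (\<forall>r. \<forall>a\<in>U. \<psi> (scl r a) = r *\<^sub>R \<psi> a)"

text \<open>
  In the adapted charts the trivialization \<open>a \<mapsto> (\<pi> a, \<psi> a)\<close> is the linear isomorphism
  \<open>L\<close>, hence a diffeomorphism.
\<close>

lemma vector_bundleI:
  fixes E :: "('t, 'e::real_inner) atlas" and B :: "('b, 'd::real_inner) atlas"
  assumes E: "smooth_manifold E" and B: "smooth_manifold B" and F: "fin_dim TYPE('f::real_inner)"
    and \<pi>: "\<And>a. a \<in> points E \<Longrightarrow> \<pi> a \<in> points B"
    and add: "\<And>a b. a \<in> points E \<Longrightarrow> b \<in> points E \<Longrightarrow> \<pi> a = \<pi> b \<Longrightarrow>
      add a b \<in> points E \<and> \<pi> (add a b) = \<pi> a"
    and scl: "\<And>r a. a \<in> points E \<Longrightarrow> scl r a \<in> points E \<and> \<pi> (scl r a) = \<pi> a"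
    and adapted: "\<And>p. p \<in> points B \<Longrightarrow>
      \<exists>U x V y (\<psi> :: 't \<Rightarrow> 'f) L L'. p \<in> V \<and> adapted_chart E B \<pi> add scl U x V y \<psi> L L'"
  shows "vector_bundle TYPE('f) E B \<pi> add scl"
proof -
  have aE: "smooth_atlas E" and aB: "smooth_atlas B" using E B by (simp_all add: smooth_manifold_iff)
  have "smooth_map E B \<pi>"
  proof (rule smooth_mapI[OF aE aB])
    fix a assume a: "a \<in> points E"
    obtain U x V y L L' and \<psi> :: "'t \<Rightarrow> 'f"
      where c: "\<pi> a \<in> V" "adapted_chart E B \<pi> add scl U x V y \<psi> L L'"
      using adapted[OF \<pi>[OF a]] by blast
    then have c: "(U, x) \<in> E" "(V, y) \<in> B" "\<pi> a \<in> V" "U = {a \<in> points E. \<pi> a \<in> V}"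
      "bounded_linear L" "\<forall>a\<in>U. L (x a) = (y (\<pi> a), \<psi> a)"
      unfolding adapted_chart_def by blast+
    have "smooth_on (x ` U) (\<lambda>z. fst (L z))"
      by (intro smooth_on_bounded_linear bounded_linear_compose[OF bounded_linear_fst] c
          smooth_atlas_chart(2)[OF aE c(1)])
    moreover have "openin (mtop E) U" by (rule openin_chart_domain[OF aE c(1)])
    moreover have "a \<in> U" "\<pi> ` U \<subseteq> V" using a c(3,4) by auto
    moreover have "\<forall>q\<in>U. y (\<pi> q) = fst (L (x q))" using c(6) by simp
    ultimately show "\<exists>U x V y W g. (U, x) \<in> E \<and> (V, y) \<in> B \<and> openin (mtop E) W \<and> a \<in> W \<and> W \<subseteq> U \<and>
        \<pi> ` W \<subseteq> V \<and> smooth_on (x ` W) g \<and> (\<forall>q\<in>W. y (\<pi> q) = g (x q))"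
      using c(1,2) by blast
  qed
  moreover have "\<exists>W (\<psi> :: 't \<Rightarrow> 'f). openin (mtop B) W \<and> p \<in> W \<and>
        diffeomorphism (restrict_atlas E (\<pi> -` W)) (prod_atlas (restrict_atlas B W) euclid)
          (\<lambda>e. (\<pi> e, \<psi> e)) \<and>
        (\<forall>a\<in>points E. \<forall>b\<in>points E. \<pi> a \<in> W \<and> \<pi> a = \<pi> b \<longrightarrow> \<psi> (add a b) = \<psi> a + \<psi> b) \<and>
        (\<forall>r. \<forall>a\<in>points E. \<pi> a \<in> W \<longrightarrow> \<psi> (scl r a) = r *\<^sub>R \<psi> a)"
    if p: "p \<in> points B" for p
  proof -
    obtain U x V y L L' and \<psi> :: "'t \<Rightarrow> 'f"
      where V: "p \<in> V" and ad: "adapted_chart E B \<pi> add scl U x V y \<psi> L L'"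
      using adapted[OF p] by blast
    have U: "(U, x) \<in> E" and V: "(V, y) \<in> B" "p \<in> V"
      and UV: "U = {a \<in> points E. \<pi> a \<in> V}"
      and L: "bounded_linear L" "bounded_linear L'" "\<And>z. L (L' z) = z" "\<And>z. L' (L z) = z"
      and L\<psi>: "\<And>a. a \<in> U \<Longrightarrow> L (x a) = (y (\<pi> a), \<psi> a)"
      and onto: "\<And>q w. q \<in> V \<Longrightarrow> L' (y q, w) \<in> x ` U"
      and ops: "\<And>a b. a \<in> U \<Longrightarrow> b \<in> U \<Longrightarrow> \<pi> a = \<pi> b \<Longrightarrow> \<psi> (add a b) = \<psi> a + \<psi> b"
        "\<And>r a. a \<in> U \<Longrightarrow> \<psi> (scl r a) = r *\<^sub>R \<psi> a"
      using V ad unfolding adapted_chart_def by blast+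
    let ?T = "\<lambda>e. (\<pi> e, \<psi> e)"
    let ?E = "restrict_atlas E (\<pi> -` V)"
    let ?B = "prod_atlas (restrict_atlas B V) (euclid :: ('f, 'f) atlas)"
    have oV: "openin (mtop B) V" by (rule openin_chart_domain[OF aB V(1)])
    have VB: "points B \<inter> V = V" using points_chart[OF V(1)] by auto
    have EU: "points E \<inter> \<pi> -` V = U" by (auto simp: UV)
    have aE': "smooth_atlas ?E"
      by (rule smooth_atlas_restrict[OF aE]) (simp add: EU openin_chart_domain[OF aE U])
    have aB': "smooth_atlas ?B"
      by (intro smooth_atlas_prod smooth_atlas_restrict[OF aB] smooth_atlas_euclid F) (simp add: VB oV)
    have pE: "points ?E = U" by (simp add: points_restrict_atlas EU)
    have pB: "points ?B = V \<times> UNIV" by (simp add: points_prod_atlas points_restrict_atlas VB)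
    have "U \<inter> \<pi> -` V = U" by (auto simp: UV)
    then have cE: "(U, x) \<in> ?E" using restrict_atlas_chart[OF U, of "\<pi> -` V"] by simp
    have "(V, y) \<in> restrict_atlas B V" using restrict_atlas_chart[OF V(1), of V] by simp
    then have cB: "(V \<times> UNIV, map_prod y id) \<in> ?B" by (auto simp: prod_atlas_def euclid_def)
    have T: "map_prod y id (?T a) = L (x a)" if "a \<in> U" for a using L\<psi>[OF that] by simp
    have iU: "inj_on x U" and iV: "inj_on y V"
      using smooth_atlas_chart(1)[OF aE U] smooth_atlas_chart(1)[OF aB V(1)] .
    have inj: "inj_on ?T U"
    proof (rule inj_onI)
      fix a b assume ab: "a \<in> U" "b \<in> U" "?T a = ?T b"
      then have "L (x a) = L (x b)" using T by metis
      then have "x a = x b" using L(4) by metis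
      then show "a = b" using iU ab by (auto simp: inj_on_def)
    qed
    have im: "?T ` U = V \<times> UNIV"
    proof (intro equalityI subsetI)
      fix z assume z: "z \<in> V \<times> (UNIV :: 'f set)"
      then obtain a where a: "a \<in> U" "x a = L' (y (fst z), snd z)" using onto[of "fst z" "snd z"] by auto
      have "(y (\<pi> a), \<psi> a) = (y (fst z), snd z)" using L\<psi>[OF a(1)] by (simp add: a(2) L(3))
      moreover have "\<pi> a \<in> V" using a(1) by (simp add: UV)
      ultimately have "?T a = z" using iV z by (auto simp: inj_on_def prod_eq_iff)
      then show "z \<in> ?T ` U" using a(1) by blast
    qed (auto simp: UV)
    have bij: "bij_betw ?T (points ?E) (points ?B)" unfolding pE pB using inj im by (simp add: bij_betw_def)
    have "smooth_map ?E ?B ?T"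
    proof (rule smooth_mapI[OF aE' aB'])
      fix a assume a: "a \<in> points ?E"
      have "smooth_on (x ` U) L" by (rule smooth_on_bounded_linear[OF L(1) smooth_atlas_chart(2)[OF aE U]])
      then show "\<exists>U x V y W g. (U, x) \<in> ?E \<and> (V, y) \<in> ?B \<and> openin (mtop ?E) W \<and> a \<in> W \<and> W \<subseteq> U \<and>
          ?T ` W \<subseteq> V \<and> smooth_on (x ` W) g \<and> (\<forall>q\<in>W. y (?T q) = g (x q))"
        using cE cB openin_chart_domain[OF aE' cE] a im T unfolding pE
        by (intro exI[of _ U] exI[of _ x] exI[of _ "V \<times> UNIV"] exI[of _ "map_prod y id"] exI[of _ L]) auto
    qed
    moreover have "smooth_map ?B ?E (inv_into (points ?E) ?T)"
    proof (rule smooth_mapI[OF aB' aE'])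
      fix z assume z: "z \<in> points ?B"
      have inv: "inv_into U ?T z \<in> U" "?T (inv_into U ?T z) = z" if "z \<in> V \<times> UNIV" for z
        using that unfolding im[symmetric] by (rule inv_into_into, rule f_inv_into_f)
      have "x (inv_into U ?T z) = L' (map_prod y id z)" if "z \<in> V \<times> UNIV" for z
        using T[OF inv(1)[OF that]] inv(2)[OF that] L(4) by metis
      moreover have "smooth_on (map_prod y id ` (V \<times> UNIV)) L'"
        by (rule smooth_on_bounded_linear[OF L(2) smooth_atlas_chart(2)[OF aB' cB]])
      ultimately show "\<exists>U x V y W g. (U, x) \<in> ?B \<and> (V, y) \<in> ?E \<and> openin (mtop ?B) W \<and> z \<in> W \<and> W \<subseteq> U \<and>
          inv_into (points ?E) ?T ` W \<subseteq> V \<and> smooth_on (x ` W) g \<and>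
          (\<forall>q\<in>W. y (inv_into (points ?E) ?T q) = g (x q))"
        using cE cB openin_chart_domain[OF aB' cB] z inv(1) unfolding pE pB
        by (intro exI[of _ "V \<times> UNIV"] exI[of _ "map_prod y id"] exI[of _ U] exI[of _ x] exI[of _ L']) auto
    qed
    ultimately have "diffeomorphism ?E ?B ?T" using bij by (simp add: diffeomorphism_def)
    then show ?thesis
      using oV V(2) ops by (intro exI[of _ V] exI[of _ \<psi>]) (auto simp: UV)
  qed
  ultimately show ?thesis
    unfolding vector_bundle_def using E B F add scl by (auto simp: fin_dim_def)
qed

section \<open>The manifold of 1-jets\<close>

lemma fin_dim_jet_source: "fin_dim TYPE(real^'p::finite)"
  by (rule fin_dim_euclidean)

lemmas jet_source_D = smooth_map_from_euclidD[OF fin_dim_jet_source]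

lemma same_jet1_iff:
  "same_jet1 A \<phi> \<xi> \<longleftrightarrow> \<phi> 0 = \<xi> 0 \<and> (\<forall>U x. (U, x) \<in> A \<longrightarrow> \<phi> 0 \<in> U \<longrightarrow>
     (\<forall>\<alpha>. pderiv_at (x \<circ> \<phi>) (axis \<alpha> 1) 0 = pderiv_at (x \<circ> \<xi>) (axis \<alpha> 1) 0))"
  by (auto simp: same_jet1_def)

lemma jet1_self: "smooth_map euclid A \<phi> \<Longrightarrow> \<phi> \<in> jet1 A \<phi>"
  by (simp add: jet1_def same_jet1_def)

lemma same_jet1_imp_jet1_eq: "same_jet1 A \<phi> \<xi> \<Longrightarrow> jet1 A \<phi> = jet1 A \<xi>"
  unfolding jet1_def same_jet1_iff by (intro Collect_cong) metis

lemma rep_jet1: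
  assumes "smooth_map euclid A \<phi>"
  shows "smooth_map euclid A (rep (jet1 A \<phi>))" "same_jet1 A \<phi> (rep (jet1 A \<phi>))"
proof -
  have "rep (jet1 A \<phi>) \<in> jet1 A \<phi>"
    unfolding rep_def by (rule someI[of "\<lambda>\<xi>. \<xi> \<in> jet1 A \<phi>", OF jet1_self[OF assms]])
  then show "smooth_map euclid A (rep (jet1 A \<phi>))" "same_jet1 A \<phi> (rep (jet1 A \<phi>))"
    by (auto simp: jet1_def)
qed

lemma jet1_in_J1: "smooth_map euclid A \<phi> \<Longrightarrow> jet1 A \<phi> \<in> J1 A"
  by (simp add: J1_def)

lemma J1_rep:
  assumes "j \<in> J1 A"
  shows "smooth_map euclid A (rep j)" "jet1 A (rep j) = j"
proof -
  obtain \<phi> where \<phi>: "smooth_map euclid A \<phi>" "j = jet1 A \<phi>" using assms by (auto simp: J1_def)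
  show "smooth_map euclid A (rep j)"
    unfolding \<phi>(2) by (rule rep_jet1(1)[OF \<phi>(1)])
  show "jet1 A (rep j) = j"
    unfolding \<phi>(2) by (rule same_jet1_imp_jet1_eq[OF rep_jet1(2)[OF \<phi>(1)], symmetric])
qed

lemma jet_proj_jet1: "smooth_map euclid A \<phi> \<Longrightarrow> jet_proj (jet1 A \<phi>) = \<phi> 0"
  using rep_jet1(2)[of A \<phi>] by (simp add: jet_proj_def same_jet1_def)

lemma jet_chart_jet1:
  assumes "smooth_map euclid A \<phi>" "(U, x) \<in> A" "\<phi> 0 \<in> U"
  shows "jet_chart x (jet1 A \<phi>) = (x (\<phi> 0), \<chi> \<alpha>. pderiv_at (x \<circ> \<phi>) (axis \<alpha> 1) 0)"
proof -
  have "pderiv_at (x \<circ> \<phi>) (axis \<alpha> 1) 0 = pderiv_at (x \<circ> rep (jet1 A \<phi>)) (axis \<alpha> 1) 0" for \<alpha>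
    using rep_jet1(2)[OF assms(1)] assms(2,3) unfolding same_jet1_def by blast
  then show ?thesis by (simp add: jet_chart_def jet_proj_jet1[OF assms(1)])
qed

lemma jet_proj_in_points:
  assumes "smooth_atlas A" "j \<in> J1 A"
  shows "jet_proj j \<in> points A"
  using jet_source_D(1)[OF assms(1) J1_rep(1)[OF assms(2)]] by (simp add: jet_proj_def)

lemma fst_jet_chart [simp]: "fst (jet_chart x j) = x (jet_proj j)"
  by (simp add: jet_chart_def)

text \<open>
  The chain rule. It shows that the derivative components depend linearly on each other for a fixed base point, and that
  equality of jets may be tested in a single chart.
\<close>

lemma jet_chart_change:
  assumes A: "smooth_atlas A" and j: "j \<in> J1 A"
    and U: "(U, x) \<in> A" "jet_proj j \<in> U" and V: "(V, y) \<in> A" "jet_proj j \<in> V"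
  shows "snd (jet_chart y j) $ \<alpha> =
    frechet_derivative (y \<circ> inv_into U x) (at (x (jet_proj j))) (snd (jet_chart x j) $ \<alpha>)"
  using chart_change_derivative[OF fin_dim_jet_source A J1_rep(1)[OF j] U(1) _ V(1), of 0]
    U(2) V(2)
  by (simp add: jet_chart_def jet_proj_def)

lemma jet_eqI:
  assumes A: "smooth_atlas A" and j: "j \<in> J1 A" "j' \<in> J1 A"
    and U: "(U, x) \<in> A" "jet_proj j \<in> U" "jet_proj j' \<in> U"
    and eq: "jet_chart x j = jet_chart x j'"
  shows "j = j'"
proof -
  have "x (jet_proj j) = x (jet_proj j')" using eq by (metis fst_jet_chart)
  then have p: "jet_proj j = jet_proj j'"
    using smooth_atlas_chart(1)[OF A U(1)] U by (auto simp: inj_on_def)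
  have "same_jet1 A (rep j) (rep j')"
    unfolding same_jet1_def
  proof (intro conjI, goal_cases)
    case 1 show ?case using p by (simp add: jet_proj_def)
  next
    case 2
    show ?case
    proof clarify
      fix V y \<alpha> assume V: "(V, y) \<in> A" "rep j 0 \<in> V"
      then have V': "jet_proj j \<in> V" by (simp add: jet_proj_def)
      have "snd (jet_chart y j) $ \<alpha> = snd (jet_chart y j') $ \<alpha>"
        using jet_chart_change[OF A j(1) U(1,2) V(1) V'] jet_chart_change[OF A j(2) U(1,3) V(1)] V' eq p
        by simp
      then show "pderiv_at (y \<circ> rep j) (axis \<alpha> 1) 0 = pderiv_at (y \<circ> rep j') (axis \<alpha> 1) 0"
        by (simp add: jet_chart_def)
    qed
  qed
  then show ?thesis using same_jet1_imp_jet1_eq J1_rep(2)[OF j(1)] J1_rep(2)[OF j(2)] by metis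
qed

text \<open>
  Realized by
  \<open>u \<mapsto> x\<^sup>-\<^sup>1(x p + \<Sum>\<^sub>\<alpha> \<theta>(u)\<^sub>\<alpha> v\<^sub>\<alpha>)\<close>,
  where \<open>\<theta>\<close> squeezes \<open>\<real>\<^sup>p\<close> into a ball so small that the argument of
  \<open>x\<^sup>-\<^sup>1\<close> stays in the range of the chart.
\<close>

lemma jet_exists:
  fixes A :: "('a, 'e::real_inner) atlas" and v :: "'e^'p::finite"
  assumes A: "smooth_atlas A" and U: "(U, x) \<in> A" "p \<in> U"
  obtains j :: "('p, 'a) jet" where "j \<in> J1 A" "jet_proj j = p" "jet_chart x j = (x p, v)"
proof -
  note i = smooth_atlas_chart(1)[OF A U(1)]
  have "continuous_on UNIV (\<lambda>w. x p + lin_comb v (fst w))"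
    by (intro continuous_intros bounded_linear.continuous_on[OF bounded_linear_lin_comb])
  then obtain c where c: "c > 0"
    and sub: "\<And>u (w :: real). x p + lin_comb v (fst (squash c u, squash c w)) \<in> x ` U"
    using squash_into_open[OF _ smooth_atlas_chart(2)[OF A U(1)], of "\<lambda>w. x p + lin_comb v (fst w)"] U(2)
    by auto
  define g where "g u = x p + lin_comb v (squash c u)" for u
  have sg: "smooth_on UNIV g"
    unfolding g_def[abs_def]
    by (intro smooth_on_add[OF open_UNIV] smooth_on_const[OF open_UNIV] smooth_on_lin_comb_squash[OF c])
  have rg: "range g \<subseteq> x ` U" using sub by (auto simp: g_def)
  let ?\<phi> = "\<lambda>u. inv_into U x (g u)"
  have sm: "smooth_map euclid A ?\<phi>"
    by (rule smooth_map_into_chart[OF fin_dim_jet_source A U(1) sg rg])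
  have \<phi>0: "?\<phi> 0 = p" using i U(2) by (simp add: g_def)
  have x\<phi>: "x \<circ> ?\<phi> = g" using rg by (intro ext) (auto intro!: f_inv_into_f)
  have "pderiv_at g w 0 = lin_comb v w" for w
    unfolding g_def[abs_def] by (rule pderiv_lin_comb_squash[OF c])
  then have "jet_chart x (jet1 A ?\<phi>) = (x p, v)"
    using jet_chart_jet1[OF sm U(1)] U(2) by (simp add: x\<phi> \<phi>0)
  then show thesis
    using that[OF jet1_in_J1[OF sm]] jet_proj_jet1[OF sm] \<phi>0 by simp
qed

lemma jet_chart_image:
  fixes A :: "('a, 'e::real_inner) atlas"
  assumes A: "smooth_atlas A" and U: "(U, x) \<in> A" and "W \<subseteq> U"
  shows "jet_chart x ` {j \<in> J1 A :: ('p::finite, 'a) jet set. jet_proj j \<in> W} = x ` W \<times> UNIV"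
proof (intro equalityI subsetI)
  fix z assume "z \<in> jet_chart x ` {j \<in> J1 A :: ('p::finite, 'a) jet set. jet_proj j \<in> W}"
  then show "z \<in> x ` W \<times> UNIV" by (auto simp: jet_chart_def)
next
  fix z :: "'e \<times> ('e^'p)" assume "z \<in> x ` W \<times> UNIV"
  then obtain p where p: "p \<in> W" "z = (x p, snd z)"
    by (auto simp: mem_Times_iff prod_eq_iff)
  obtain j :: "('p, 'a) jet" where "j \<in> J1 A" "jet_proj j = p" "jet_chart x j = (x p, snd z)"
    using jet_exists[OF A U] p \<open>W \<subseteq> U\<close> by blast
  then show "z \<in> jet_chart x ` {j \<in> J1 A. jet_proj j \<in> W}" using p by (auto intro!: image_eqI[of _ _ j])
qed

lemma jet_chart_in_jet_atlas:
  "(U, x) \<in> A \<Longrightarrow> ({j \<in> J1 A. jet_proj j \<in> U}, jet_chart x) \<in> jet_atlas A"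
  by (force simp: jet_atlas_def)

lemma jet_atlasE:
  assumes "(W, w) \<in> jet_atlas A"
  obtains U x where "(U, x) \<in> A" "W = {j \<in> J1 A. jet_proj j \<in> U}" "w = jet_chart x"
  using assms by (auto simp: jet_atlas_def)

lemma points_jet_atlas:
  assumes "smooth_atlas A"
  shows "points (jet_atlas A) = J1 A"
proof (intro equalityI subsetI)
  fix j assume "j \<in> J1 A"
  then obtain U x where "(U, x) \<in> A" "jet_proj j \<in> U"
    using jet_proj_in_points[OF assms] pointsE by metis
  then show "j \<in> points (jet_atlas A)"
    using \<open>j \<in> J1 A\<close> by (intro points_chart[OF jet_chart_in_jet_atlas]) auto
qed (auto simp: points_def jet_atlas_def)

lemma smooth_atlas_jet:
  fixes A :: "('a, 'e::real_inner) atlas"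
  assumes A: "smooth_atlas A"
  shows "smooth_atlas (jet_atlas A :: (('p::finite, 'a) jet, _) atlas)"
proof (rule smooth_atlasI)
  note fe = smooth_atlas_fin_dim[OF A]
  show "fin_dim TYPE('e \<times> ('e^'p))" by (intro fin_dim_prod fin_dim_vec fe)
  fix W w assume "(W, w) \<in> (jet_atlas A :: (('p, 'a) jet, _) atlas)"
  then obtain U x where U: "(U, x) \<in> A" and W: "W = {j \<in> J1 A. jet_proj j \<in> U}" "w = jet_chart x"
    by (rule jet_atlasE)
  show "inj_on w W" unfolding W
    by (rule inj_onI) (use jet_eqI[OF A _ _ U] in auto)
  fix W' w' assume "(W', w') \<in> (jet_atlas A :: (('p, 'a) jet, _) atlas)"
  then obtain V y where V: "(V, y) \<in> A" and W': "W' = {j \<in> J1 A. jet_proj j \<in> V}" "w' = jet_chart y"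
    by (rule jet_atlasE)
  have "W \<inter> W' = {j \<in> J1 A. jet_proj j \<in> U \<inter> V}" by (auto simp: W W')
  then have im: "w ` (W \<inter> W') = x ` (U \<inter> V) \<times> UNIV"
    using jet_chart_image[OF A U, of "U \<inter> V"] by (simp add: W(2))
  note t = smooth_atlas_transition[OF A U V]
  show o: "open (w ` (W \<inter> W'))" unfolding im by (intro open_Times t open_UNIV)
  let ?\<tau> = "y \<circ> inv_into U x"
  \<comment> \<open>The derivative components of a jet transform by the derivative of the transition map.\<close>
  let ?g = "\<lambda>z. (?\<tau> (fst z), (\<chi> \<alpha>. frechet_derivative ?\<tau> (at (fst z)) (snd z $ \<alpha>)) :: 'e^'p)"
  have sfst: "smooth_on (w ` (W \<inter> W')) fst"
    by (rule smooth_on_bounded_linear[OF bounded_linear_fst o])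
  have fst_im: "fst ` w ` (W \<inter> W') \<subseteq> x ` (U \<inter> V)" by (auto simp: im)
  obtain C :: "'e set" where C: "finite C" "\<And>x. x = (\<Sum>b\<in>C. (x \<bullet> b) *\<^sub>R b)"
    using fin_dim_orthonormal[OF fe] by blast
  have "smooth_on (w ` (W \<inter> W')) (\<lambda>z. frechet_derivative ?\<tau> (at (fst z)) (snd z $ \<alpha>))" for \<alpha>
  proof (rule smooth_on_linear_family_apply[where D = "\<lambda>z. frechet_derivative ?\<tau> (at (fst z))"
        and w = "\<lambda>z. snd z $ \<alpha>", OF C _ o])
    show "linear (frechet_derivative ?\<tau> (at (fst z)))" if "z \<in> w ` (W \<inter> W')" for z
      using smooth_on_has_derivative[OF t(2)] that fst_im has_derivative_linear by blast
    show "smooth_on (w ` (W \<inter> W')) (\<lambda>z. frechet_derivative ?\<tau> (at (fst z)) b)" for b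
      by (rule smooth_on_compose[OF fe o sfst smooth_on_frechet_derivative[OF t(2)] fst_im])
    show "smooth_on (w ` (W \<inter> W')) (\<lambda>z. snd z $ \<alpha>)"
      by (rule smooth_on_bounded_linear[OF bounded_linear_compose[OF bounded_linear_vec_nth bounded_linear_snd] o])
  qed
  then have "smooth_on (w ` (W \<inter> W')) ?g"
    by (intro smooth_on_Pair[OF o] smooth_on_vec_lambda[OF o]
        smooth_on_compose[OF fe o sfst t(2) fst_im])
  moreover have "\<forall>j\<in>W \<inter> W'. w' j = ?g (w j)"
  proof
    fix j assume "j \<in> W \<inter> W'"
    then have j: "j \<in> J1 A" "jet_proj j \<in> U" "jet_proj j \<in> V" by (auto simp: W W')
    show "w' j = ?g (w j)"
      unfolding W W' using jet_chart_change[OF A j(1) U j(2) V j(3)] j smooth_atlas_chart(1)[OF A U]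
      by (intro prod_eqI) (auto simp: vec_eq_iff)
  qed
  ultimately show "\<exists>g. smooth_on (w ` (W \<inter> W')) g \<and> (\<forall>j\<in>W \<inter> W'. w' j = g (w j))" by blast
qed

lemma smooth_jet_proj:
  fixes A :: "('a, 'e::real_inner) atlas"
  assumes A: "smooth_atlas A"
  shows "smooth_map (jet_atlas A :: (('p::finite, 'a) jet, _) atlas) A jet_proj"
proof (rule smooth_mapI[OF smooth_atlas_jet[OF A] A])
  let ?J = "jet_atlas A :: (('p, 'a) jet, _) atlas"
  fix j :: "('p, 'a) jet" assume "j \<in> points ?J"
  then have j: "j \<in> J1 A" by (simp add: points_jet_atlas[OF A])
  obtain U x where U: "(U, x) \<in> A" "jet_proj j \<in> U" using jet_proj_in_points[OF A j] by (rule pointsE)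
  let ?W = "{j \<in> J1 A :: ('p, 'a) jet set. jet_proj j \<in> U}"
  have W: "(?W, jet_chart x) \<in> ?J" by (rule jet_chart_in_jet_atlas[OF U(1)])
  have "smooth_on (jet_chart x ` ?W) fst"
    by (rule smooth_on_bounded_linear[OF bounded_linear_fst smooth_atlas_chart(2)[OF smooth_atlas_jet[OF A] W]])
  then show "\<exists>U x V y W g. (U, x) \<in> ?J \<and> (V, y) \<in> A \<and> openin (mtop ?J) W \<and> j \<in> W \<and> W \<subseteq> U \<and>
      jet_proj ` W \<subseteq> V \<and> smooth_on (x ` W) g \<and> (\<forall>q\<in>W. y (jet_proj q) = g (x q))"
    using W U j openin_chart_domain[OF smooth_atlas_jet[OF A] W]
    by (intro exI[of _ ?W] exI[of _ "jet_chart x"] exI[of _ U] exI[of _ x] exI[of _ fst]) auto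
qed

text \<open>
  Jets at different points are separated by preimages of open sets of the base, jets at the same point within one chart.
\<close>

lemma smooth_manifold_jet:
  fixes A :: "('a, 'e::real_inner) atlas"
  assumes M: "smooth_manifold A"
  shows "smooth_manifold (jet_atlas A :: (('p::finite, 'a) jet, _) atlas)"
proof -
  let ?J = "jet_atlas A :: (('p, 'a) jet, _) atlas"
  have A: "smooth_atlas A" using M by (simp add: smooth_manifold_iff)
  note J = smooth_atlas_jet[OF A, where ?'p = 'p]
  have "Hausdorff_space (mtop ?J)"
    unfolding Hausdorff_space_def
  proof (intro allI impI)
    fix j j' :: "('p, 'a) jet"
    assume "j \<in> topspace (mtop ?J) \<and> j' \<in> topspace (mtop ?J) \<and> j \<noteq> j'"
    then have j: "j \<in> J1 A" "j' \<in> J1 A" "j \<noteq> j'"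
      by (auto simp: topspace_mtop[OF J] points_jet_atlas[OF A])
    show "\<exists>V V'. openin (mtop ?J) V \<and> openin (mtop ?J) V' \<and> j \<in> V \<and> j' \<in> V' \<and> disjnt V V'"
    proof (cases "jet_proj j = jet_proj j'")
      case False
      have "Hausdorff_space (mtop A)" using M by (simp add: smooth_manifold_iff)
      then have H: "\<exists>V V'. openin (mtop A) V \<and> openin (mtop A) V' \<and> p \<in> V \<and> q \<in> V' \<and> disjnt V V'"
        if "p \<in> points A" "q \<in> points A" "p \<noteq> q" for p q
        using that by (simp add: Hausdorff_space_def topspace_mtop[OF A])
      obtain V V' where V: "openin (mtop A) V" "openin (mtop A) V'" "jet_proj j \<in> V" "jet_proj j' \<in> V'"
        "disjnt V V'"
        using H[OF jet_proj_in_points[OF A j(1)] jet_proj_in_points[OF A j(2)] False] by blast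
      show ?thesis
        using smooth_map_openin_vimage[OF J smooth_jet_proj[OF A] V(1)]
          smooth_map_openin_vimage[OF J smooth_jet_proj[OF A] V(2)] V j
        unfolding points_jet_atlas[OF A]
        by (intro exI[of _ "{j \<in> J1 A. jet_proj j \<in> V}"] exI[of _ "{j \<in> J1 A. jet_proj j \<in> V'}"])
           (auto simp: disjnt_iff)
    next
      case True
      obtain U x where U: "(U, x) \<in> A" "jet_proj j \<in> U" using jet_proj_in_points[OF A j(1)] by (rule pointsE)
      have W: "({j \<in> J1 A. jet_proj j \<in> U}, jet_chart x) \<in> ?J" by (rule jet_chart_in_jet_atlas[OF U(1)])
      have "jet_chart x j \<noteq> jet_chart x j'" using jet_eqI[OF A j(1,2) U] True U j(3) by auto
      then obtain N N' where N: "open N" "open N'" "jet_chart x j \<in> N" "jet_chart x j' \<in> N'" "N \<inter> N' = {}"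
        using hausdorff[of "jet_chart x j" "jet_chart x j'"] by metis
      show ?thesis
        using openin_chart_vimage[OF J W N(1)] openin_chart_vimage[OF J W N(2)] N U True j
        by (intro exI[of _ "{k \<in> {j \<in> J1 A. jet_proj j \<in> U}. jet_chart x k \<in> N}"]
              exI[of _ "{k \<in> {j \<in> J1 A. jet_proj j \<in> U}. jet_chart x k \<in> N'}"])
           (auto simp: disjnt_iff)
    qed
  qed
  moreover have "second_countable (mtop ?J)"
  proof -
    obtain A' where A': "countable A'" "A' \<subseteq> A" "points A \<subseteq> \<Union>(fst ` A')"
      using countable_subatlas[OF A] M by (auto simp: smooth_manifold_iff)
    let ?f = "\<lambda>(U, x). ({j \<in> J1 A :: ('p, 'a) jet set. jet_proj j \<in> U}, jet_chart x)"
    show ?thesis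
    proof (rule second_countable_mtopI[OF J])
      show "countable (?f ` A')" using A' by simp
      show "?f ` A' \<subseteq> ?J" using A' by (auto simp: jet_atlas_def)
      show "points ?J \<subseteq> \<Union>(fst ` ?f ` A')"
      proof
        fix j assume "j \<in> points ?J"
        then have j: "j \<in> J1 A" by (simp add: points_jet_atlas[OF A])
        then obtain U x where U: "(U, x) \<in> A'" "jet_proj j \<in> U"
          using A' jet_proj_in_points[OF A j] by auto
        then have "j \<in> fst (?f (U, x))" using j by simp
        then show "j \<in> \<Union>(fst ` ?f ` A')" using U by blast
      qed
    qed
  qed
  ultimately show ?thesis using J by (simp add: smooth_manifold_iff)
qed

section \<open>Coordinates of double jets\<close>

text \<open>
  The point of \<open>M\<close> over which a double jet lies, for either of the two projections.
\<close>

definition foot :: "('p::finite, ('p, 'a) jet) jet \<Rightarrow> 'a" where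
  "foot a = jet_proj (prim_proj a)"

lemma JJ_prim_proj: "smooth_atlas M \<Longrightarrow> a \<in> JJ M \<Longrightarrow> prim_proj a \<in> J1 M"
  using jet_proj_in_points[OF smooth_atlas_jet] points_jet_atlas by (metis JJ_def prim_proj_def)

lemma JJ_foot: "smooth_atlas M \<Longrightarrow> a \<in> JJ M \<Longrightarrow> foot a \<in> points M"
  by (simp add: foot_def JJ_prim_proj jet_proj_in_points)

lemma JJ_footE:
  assumes "smooth_atlas M" "a \<in> JJ M"
  obtains U x where "(U, x) \<in> M" "foot a \<in> U"
  using JJ_foot[OF assms] pointsE by metis

lemma jet_chart_prim_proj: "jet_chart x (prim_proj a) = (x (foot a), coordY x a)"
  by (simp add: prod_eq_iff foot_def coordY_def prim_proj_def jet_proj_def jet_chart_def)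

text \<open>
  The coordinates \<open>Y, X, C\<close> are those of the chart of \<open>J\<^sup>1(J\<^sup>1M)\<close> induced by
  \<open>x\<close>, up to grouping.
\<close>

lemma jet_chart_jet_chart:
  assumes M: "smooth_atlas M" and a: "a \<in> JJ M" and U: "(U, x) \<in> M" "foot a \<in> U"
  shows "jet_chart (jet_chart x) a =
    ((x (foot a), coordY x a), \<chi> \<alpha>. (coordX x a $ \<alpha>, coordC x a $ \<alpha>))"
proof -
  have "jet_proj a \<in> {j \<in> J1 M. jet_proj j \<in> U}"
    using JJ_prim_proj[OF M a] U(2) by (simp add: foot_def prim_proj_def)
  then have "rep a 0 \<in> {j \<in> J1 M. jet_proj j \<in> U}" by (simp add: jet_proj_def)
  note chart_derivative[OF fin_dim_jet_source smooth_atlas_jet[OF M]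
      J1_rep(1)[OF a[unfolded JJ_def]] jet_chart_in_jet_atlas[OF U(1)] this]
  then have d: "(jet_chart x \<circ> rep a) differentiable (at 0)" by (rule differentiableI)
  have "pderiv_at (jet_chart x \<circ> rep a) (axis \<alpha> 1) 0 = (coordX x a $ \<alpha>, coordC x a $ \<alpha>)" for \<alpha>
  proof (rule prod_eqI)
    show "fst (pderiv_at (jet_chart x \<circ> rep a) (axis \<alpha> 1) 0) = fst (coordX x a $ \<alpha>, coordC x a $ \<alpha>)"
      using pderiv_bounded_linear[OF bounded_linear_fst d] by (simp add: coordX_def o_def)
    show "snd (pderiv_at (jet_chart x \<circ> rep a) (axis \<alpha> 1) 0) = snd (coordX x a $ \<alpha>, coordC x a $ \<alpha>)"
      using pderiv_bounded_linear[OF bounded_linear_compose[OF bounded_linear_vec_nth bounded_linear_snd] d]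
      by (simp add: coordC_def o_def vec_eq_iff)
  qed
  then show ?thesis
    using jet_chart_prim_proj[of x a] by (simp add: jet_chart_def[of "jet_chart x" a] prim_proj_def)
qed

lemma JJ_eqI:
  assumes M: "smooth_atlas M" and a: "a \<in> JJ M" and b: "b \<in> JJ M"
    and U: "(U, x) \<in> M" "foot a \<in> U" and "foot b = foot a"
    and "coordY x a = coordY x b" "coordX x a = coordX x b" "coordC x a = coordC x b"
  shows "a = b"
proof (rule jet_eqI[OF smooth_atlas_jet[OF M] _ _ jet_chart_in_jet_atlas[OF U(1)]])
  show "a \<in> J1 (jet_atlas M)" "b \<in> J1 (jet_atlas M)" using a b by (simp_all add: JJ_def)
  show "jet_proj a \<in> {j \<in> J1 M. jet_proj j \<in> U}" "jet_proj b \<in> {j \<in> J1 M. jet_proj j \<in> U}"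
    using JJ_prim_proj[OF M a] JJ_prim_proj[OF M b] assms by (simp_all add: foot_def prim_proj_def)
  show "jet_chart (jet_chart x) a = jet_chart (jet_chart x) b"
    using jet_chart_jet_chart[OF M a U(1)] jet_chart_jet_chart[OF M b U(1)] assms by simp
qed

lemma JJ_exists:
  fixes M :: "('a, 'e::real_inner) atlas" and Y X :: "'e^'p::finite"
  assumes M: "smooth_atlas M" and U: "(U, x) \<in> M" "p \<in> U"
  obtains a :: "('p, ('p, 'a) jet) jet" where "a \<in> JJ M" "foot a = p"
    "coordY x a = Y" "coordX x a = X" "coordC x a = C"
proof -
  obtain j :: "('p, 'a) jet" where j: "j \<in> J1 M" "jet_proj j = p" "jet_chart x j = (x p, Y)"
    by (rule jet_exists[OF M U])
  have "j \<in> {j \<in> J1 M. jet_proj j \<in> U}" using j U by simp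
  then obtain a :: "('p, ('p, 'a) jet) jet" where a: "a \<in> J1 (jet_atlas M)" "jet_proj a = j"
      "jet_chart (jet_chart x) a = (jet_chart x j, \<chi> \<alpha>. (X $ \<alpha>, C $ \<alpha>))"
    by (rule jet_exists[OF smooth_atlas_jet[OF M] jet_chart_in_jet_atlas[OF U(1)]])
  have aJ: "a \<in> JJ M" using a by (simp add: JJ_def)
  have f: "foot a = p" using a j by (simp add: foot_def prim_proj_def)
  show thesis
    by (rule that[OF aJ f])
       (use jet_chart_jet_chart[OF M aJ U(1)] a(3) j(3) f U(2) in \<open>simp_all add: vec_eq_iff\<close>)
qed

lemma smooth_jet_proj_rep:
  assumes M: "smooth_atlas M" and a: "a \<in> JJ (M :: ('a, 'e::real_inner) atlas)"
  shows "smooth_map euclid M (jet_proj \<circ> (rep a :: real^'p::finite \<Rightarrow> ('p, 'a) jet))"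
proof (rule smooth_map_from_euclidI[OF fin_dim_jet_source M])
  fix u
  have r: "smooth_map euclid (jet_atlas M) (rep a)" using J1_rep(1) a by (simp add: JJ_def)
  note D = jet_source_D[OF smooth_atlas_jet[OF M] r]
  have "rep a u \<in> J1 M" using D(1)[of u] by (simp add: points_jet_atlas[OF M])
  then obtain U x where U: "(U, x) \<in> M" "jet_proj (rep a u) \<in> U"
    using jet_proj_in_points[OF M] pointsE by metis
  let ?N = "rep a -` {j \<in> J1 M. jet_proj j \<in> U}"
  have o: "open ?N" by (rule D(2)[OF jet_chart_in_jet_atlas[OF U(1)]])
  have "smooth_on ?N (\<lambda>u. fst (jet_chart x (rep a u)))"
    by (rule smooth_on_bounded_linear_compose[OF bounded_linear_fst o D(3)[OF jet_chart_in_jet_atlas[OF U(1)]]])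
  then show "\<exists>U x N. (U, x) \<in> M \<and> open N \<and> u \<in> N \<and> (jet_proj \<circ> rep a) ` N \<subseteq> U \<and>
      smooth_on N (\<lambda>u. x ((jet_proj \<circ> rep a) u))"
    using U o \<open>rep a u \<in> J1 M\<close>
    by (intro exI[of _ U] exI[of _ x] exI[of _ ?N]) auto
qed

lemma sec_proj_JJ:
  assumes M: "smooth_atlas M" and a: "a \<in> JJ M"
  shows "sec_proj M a \<in> J1 M" "jet_proj (sec_proj M a) = foot a"
proof -
  show "sec_proj M a \<in> J1 M"
    unfolding sec_proj_def jet_map_def by (rule jet1_in_J1[OF smooth_jet_proj_rep[OF M a]])
  show "jet_proj (sec_proj M a) = foot a"
    unfolding sec_proj_def jet_map_def jet_proj_jet1[OF smooth_jet_proj_rep[OF M a]]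
    by (simp add: foot_def prim_proj_def jet_proj_def)
qed

lemma jet_chart_sec_proj:
  assumes M: "smooth_atlas M" and a: "a \<in> JJ M" and U: "(U, x) \<in> M" "foot a \<in> U"
  shows "jet_chart x (sec_proj M a) = (x (foot a), coordX x a)"
proof -
  have f: "(jet_proj \<circ> rep a) 0 = foot a" by (simp add: foot_def prim_proj_def jet_proj_def)
  show ?thesis
    using jet_chart_jet1[OF smooth_jet_proj_rep[OF M a] U(1)] U(2)
    unfolding f sec_proj_def jet_map_def by (simp add: coordX_def o_assoc)
qed

lemma points_JJ: "smooth_atlas M \<Longrightarrow> points (JJ_atlas M) = JJ M"
  by (simp add: JJ_atlas_def JJ_def points_jet_atlas smooth_atlas_jet)

lemma smooth_atlas_JJ: "smooth_atlas M \<Longrightarrow> smooth_atlas (JJ_atlas M)"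
  by (simp add: JJ_atlas_def smooth_atlas_jet)

lemma JJ_atlas_chart:
  fixes M :: "('a, 'e::real_inner) atlas"
  assumes M: "smooth_atlas M" and U: "(U, x) \<in> M"
  shows "({a \<in> JJ M :: ('p::finite, ('p, 'a) jet) jet set. foot a \<in> U}, jet_chart (jet_chart x)) \<in> JJ_atlas M"
proof -
  have eq: "{a \<in> J1 (jet_atlas M). jet_proj a \<in> {j \<in> J1 M. jet_proj j \<in> U}} =
      {a \<in> JJ M :: ('p, ('p, 'a) jet) jet set. foot a \<in> U}"
    using JJ_prim_proj[OF M] by (auto simp: JJ_def foot_def prim_proj_def)
  show ?thesis
    unfolding JJ_atlas_def eq[symmetric] by (rule jet_chart_in_jet_atlas[OF jet_chart_in_jet_atlas[OF U]])
qed

section \<open>Double jets of maps of two variables\<close>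

text \<open>
  This is \<open>\<Lambda>(j\<^sup>2\<phi>)\<close>, but defined from the map \<open>\<phi>\<close> itself and not from
  a representative of its 2-jet.
\<close>

definition iterated_jet :: "('a, 'e::real_inner) atlas \<Rightarrow> ((real^'p) \<times> (real^'p) \<Rightarrow> 'a)
    \<Rightarrow> ('p::finite, ('p, 'a) jet) jet" where
  "iterated_jet M \<phi> = jet1 (jet_atlas M) (\<lambda>u. jet1 M (\<lambda>v. \<phi> (u, v)))"

lemma fin_dim_double_source: "fin_dim TYPE((real^'p::finite) \<times> (real^'p))"
  by (rule fin_dim_euclidean)

lemmas double_source_D = smooth_map_from_euclidD[OF fin_dim_double_source]

lemma smooth_on_Pair_const_right: "smooth_on UNIV (\<lambda>u. (u, v))"
  by (intro smooth_on_Pair[OF open_UNIV] smooth_on_ident[OF open_UNIV] smooth_on_const[OF open_UNIV])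

lemma smooth_on_Pair_const_left: "smooth_on UNIV (\<lambda>v. (u, v))"
  by (intro smooth_on_Pair[OF open_UNIV] smooth_on_ident[OF open_UNIV] smooth_on_const[OF open_UNIV])

lemma smooth_slice:
  assumes "smooth_atlas M" "smooth_map euclid M (\<phi> :: (real^'p::finite) \<times> (real^'p) \<Rightarrow> 'a)"
  shows "smooth_map euclid M (\<lambda>v. \<phi> (u, v))"
  by (rule smooth_map_from_euclid_compose[OF fin_dim_jet_source fin_dim_double_source assms smooth_on_Pair_const_left])

lemma slice_jet_chart:
  assumes "smooth_atlas M" "smooth_map euclid M (\<phi> :: (real^'p::finite) \<times> (real^'p) \<Rightarrow> 'a)"
    "(U, x) \<in> M" "\<phi> (u, 0) \<in> U"
  shows "jet_chart x (jet1 M (\<lambda>v. \<phi> (u, v))) =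
    (x (\<phi> (u, 0)), \<chi> \<beta>. pderiv_at (\<lambda>v. x (\<phi> (u, v))) (axis \<beta> 1) 0)"
  using jet_chart_jet1[OF smooth_slice[OF assms(1,2), of u] assms(3)] assms(4) by (simp add: o_def)

lemma smooth_jet_of_slices:
  fixes M :: "('a, 'e::real_inner) atlas" and \<phi> :: "(real^'p::finite) \<times> (real^'p) \<Rightarrow> 'a"
  assumes M: "smooth_atlas M" and \<phi>: "smooth_map euclid M \<phi>"
  shows "smooth_map euclid (jet_atlas M) (\<lambda>u. jet1 M (\<lambda>v. \<phi> (u, v)))"
proof (rule smooth_map_from_euclidI[OF fin_dim_jet_source smooth_atlas_jet[OF M]])
  fix u0 :: "real^'p"
  note D = double_source_D[OF M \<phi>]
  obtain U x where U: "(U, x) \<in> M" "\<phi> (u0, 0) \<in> U" using D(1)[of "(u0, 0)"] pointsE by metis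
  let ?S = "\<phi> -` U" and ?f = "\<lambda>z. x (\<phi> z)"
  let ?N = "{u. (u, 0) \<in> ?S}"
  note S = D(2)[OF U(1)] and f = D(3)[OF U(1)]
  have o: "open ?N" by (rule open_slice_left[OF S])
  have s: "smooth_on ?N (\<lambda>u. g (u, 0))" if "smooth_on ?S g" for g :: "_ \<Rightarrow> 'e"
    by (rule smooth_on_compose[OF fin_dim_double_source o smooth_on_subset[OF smooth_on_Pair_const_right] that])
       auto
  let ?g = "\<lambda>u. (?f (u, 0), (\<chi> \<beta>. pderiv_at ?f (0, axis \<beta> 1) (u, 0)) :: 'e^'p)"
  have "smooth_on ?N ?g"
    by (intro smooth_on_Pair[OF o] smooth_on_vec_lambda[OF o] s[OF f] s[OF smooth_on_frechet_derivative[OF f]])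
  moreover have "?g u = jet_chart x (jet1 M (\<lambda>v. \<phi> (u, v)))" if "u \<in> ?N" for u
  proof -
    have "pderiv_at ?f (0, w) (u, 0) = pderiv_at (\<lambda>v. x (\<phi> (u, v))) w 0" for w
      using frechet_derivative_at[OF slice_right_has_derivative[OF smooth_on_differentiable[OF f]]] that
      by (metis mem_Collect_eq)
    then show ?thesis using slice_jet_chart[OF M \<phi> U(1), of u] that by simp
  qed
  ultimately have "smooth_on ?N (\<lambda>u. jet_chart x (jet1 M (\<lambda>v. \<phi> (u, v))))"
    by (rule smooth_on_cong[OF o, rotated])
  then show "\<exists>W w N. (W, w) \<in> jet_atlas M \<and> open N \<and> u0 \<in> N \<and> (\<lambda>u. jet1 M (\<lambda>v. \<phi> (u, v))) ` N \<subseteq> W \<and>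
      smooth_on N (\<lambda>u. w (jet1 M (\<lambda>v. \<phi> (u, v))))"
    using jet_chart_in_jet_atlas[OF U(1)] o U(2) jet1_in_J1[OF smooth_slice[OF M \<phi>]] jet_proj_jet1[OF smooth_slice[OF M \<phi>]]
    by (intro exI[of _ "{j \<in> J1 M. jet_proj j \<in> U}"] exI[of _ "jet_chart x"] exI[of _ ?N]) auto
qed

lemma iterated_jet_in_JJ:
  assumes "smooth_atlas M" "smooth_map euclid M \<phi>"
  shows "iterated_jet M \<phi> \<in> JJ M"
  unfolding iterated_jet_def JJ_def by (rule jet1_in_J1[OF smooth_jet_of_slices[OF assms]])

lemma prim_proj_iterated_jet:
  assumes "smooth_atlas M" "smooth_map euclid M \<phi>"
  shows "prim_proj (iterated_jet M \<phi>) = jet1 M (\<lambda>v. \<phi> (0, v))"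
  unfolding iterated_jet_def prim_proj_def by (rule jet_proj_jet1[OF smooth_jet_of_slices[OF assms]])

lemma foot_iterated_jet:
  assumes "smooth_atlas M" "smooth_map euclid M \<phi>"
  shows "foot (iterated_jet M \<phi>) = \<phi> (0, 0)"
  unfolding foot_def prim_proj_iterated_jet[OF assms] by (rule jet_proj_jet1[OF smooth_slice[OF assms]])

lemma coords_iterated_jet:
  fixes M :: "('a, 'e::real_inner) atlas" and \<phi> :: "(real^'p::finite) \<times> (real^'p) \<Rightarrow> 'a"
  assumes M: "smooth_atlas M" and \<phi>: "smooth_map euclid M \<phi>"
    and U: "(U, x) \<in> M" "\<phi> (0, 0) \<in> U"
  shows "coordY x (iterated_jet M \<phi>) $ \<beta> = pderiv_at (\<lambda>v. x (\<phi> (0, v))) (axis \<beta> 1) 0"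
    and "coordX x (iterated_jet M \<phi>) $ \<alpha> = pderiv_at (\<lambda>u. x (\<phi> (u, 0))) (axis \<alpha> 1) 0"
    and "coordC x (iterated_jet M \<phi>) $ \<alpha> $ \<beta> =
      pderiv_at (\<lambda>u. pderiv_at (\<lambda>v. x (\<phi> (u, v))) (axis \<beta> 1) 0) (axis \<alpha> 1) 0"
proof -
  let ?a = "iterated_jet M \<phi>" and ?\<Phi> = "\<lambda>u. jet1 M (\<lambda>v. \<phi> (u, v))"
  let ?W = "{j \<in> J1 M. jet_proj j \<in> U}"
  note a = iterated_jet_in_JJ[OF M \<phi>] and s = smooth_jet_of_slices[OF M \<phi>]
  have foot: "foot ?a \<in> U" using foot_iterated_jet[OF M \<phi>] U(2) by simp
  show "coordY x ?a $ \<beta> = pderiv_at (\<lambda>v. x (\<phi> (0, v))) (axis \<beta> 1) 0"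
  proof -
    have "coordY x ?a = snd (jet_chart x (prim_proj ?a))" by (simp only: jet_chart_prim_proj snd_conv)
    then show ?thesis
      unfolding prim_proj_iterated_jet[OF M \<phi>] slice_jet_chart[OF M \<phi> U] by simp
  qed
  have W0: "?\<Phi> 0 \<in> ?W"
    using jet1_in_J1[OF smooth_slice[OF M \<phi>]] jet_proj_jet1[OF smooth_slice[OF M \<phi>]] U by simp
  have d: "(\<lambda>u. jet_chart x (?\<Phi> u)) differentiable (at 0)"
    using chart_derivative[OF fin_dim_jet_source smooth_atlas_jet[OF M] s jet_chart_in_jet_atlas[OF U(1)] W0]
    unfolding o_def by (rule differentiableI)
  have "(coordX x ?a $ \<alpha>, coordC x ?a $ \<alpha>) = snd (jet_chart (jet_chart x) ?a) $ \<alpha>" for \<alpha>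
    using jet_chart_jet_chart[OF M a U(1) foot] by simp
  also have "\<dots> \<alpha> = pderiv_at (\<lambda>u. jet_chart x (?\<Phi> u)) (axis \<alpha> 1) 0" for \<alpha>
    using jet_chart_jet1[OF s jet_chart_in_jet_atlas[OF U(1)] W0] unfolding iterated_jet_def by (simp add: o_def)
  finally have pd: "(coordX x ?a $ \<alpha>, coordC x ?a $ \<alpha>) = pderiv_at (\<lambda>u. jet_chart x (?\<Phi> u)) (axis \<alpha> 1) 0" for \<alpha> .
  let ?N = "{u. (u, 0) \<in> \<phi> -` U}"
  have N: "open ?N" "0 \<in> ?N" using open_slice_left[OF double_source_D(2)[OF M \<phi> U(1)]] U(2) by simp_all
  have "coordX x ?a $ \<alpha> = fst (pderiv_at (\<lambda>u. jet_chart x (?\<Phi> u)) (axis \<alpha> 1) 0)"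
    by (simp flip: pd)
  also have "\<dots> = pderiv_at (\<lambda>u. fst (jet_chart x (?\<Phi> u))) (axis \<alpha> 1) 0"
    by (rule pderiv_bounded_linear[OF bounded_linear_fst d, symmetric])
  finally show "coordX x ?a $ \<alpha> = pderiv_at (\<lambda>u. x (\<phi> (u, 0))) (axis \<alpha> 1) 0"
    by (simp add: jet_proj_jet1[OF smooth_slice[OF M \<phi>]])
  have bl: "bounded_linear (\<lambda>z :: 'e \<times> ('e^'p). snd z $ \<beta>)"
    by (rule bounded_linear_compose[OF bounded_linear_vec_nth bounded_linear_snd])
  have "coordC x ?a $ \<alpha> $ \<beta> = snd (pderiv_at (\<lambda>u. jet_chart x (?\<Phi> u)) (axis \<alpha> 1) 0) $ \<beta>"
    by (simp flip: pd)
  also have "\<dots> = pderiv_at (\<lambda>u. snd (jet_chart x (?\<Phi> u)) $ \<beta>) (axis \<alpha> 1) 0"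
    by (rule pderiv_bounded_linear[OF bl d, symmetric])
  also have "\<dots> = pderiv_at (\<lambda>u. pderiv_at (\<lambda>v. x (\<phi> (u, v))) (axis \<beta> 1) 0) (axis \<alpha> 1) 0"
  proof (rule pderiv_cong[OF N])
    show "(\<lambda>u. snd (jet_chart x (?\<Phi> u)) $ \<beta>) differentiable at 0"
      using bounded_linear.has_derivative[OF bl] d by (metis differentiable_def)
  qed (use slice_jet_chart[OF M \<phi> U(1)] in auto)
  finally show "coordC x ?a $ \<alpha> $ \<beta> =
      pderiv_at (\<lambda>u. pderiv_at (\<lambda>v. x (\<phi> (u, v))) (axis \<beta> 1) 0) (axis \<alpha> 1) 0" .
qed

text \<open>
  Prescribe the polynomial of degree 2 with the given coefficients in a chart, evaluated at squeezed arguments. Only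
  iterated first derivatives enter, so it is enough that squeezing preserves derivatives of first order.
\<close>

lemma iterated_jet_exists:
  fixes M :: "('a, 'e::real_inner) atlas"
  assumes M: "smooth_atlas M" and a: "(a :: ('p::finite, ('p, 'a) jet) jet) \<in> JJ M"
  obtains \<phi> where "smooth_map euclid M \<phi>" "iterated_jet M \<phi> = a"
proof -
  obtain U x where U: "(U, x) \<in> M" "foot a \<in> U" by (rule JJ_footE[OF M a])
  note i = smooth_atlas_chart(1)[OF M U(1)]
  define X Y C where "X = coordX x a" and "Y = coordY x a" and "C = coordC x a"
  \<comment> \<open>\<open>Q (s, t)\<close> is the polynomial \<open>x(foot a) + X s + Y t + C(s, t)\<close>; \<open>L s\<close> collects its terms that are linear in \<open>t\<close>.\<close>
  define L where "L s = (\<chi> \<beta>. Y $ \<beta> + lin_comb (\<chi> \<alpha>. C $ \<alpha> $ \<beta>) s)" for s :: "real^'p"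
  define Q where "Q z = x (foot a) + lin_comb X (fst z) + lin_comb (L (fst z)) (snd z)" for z :: "(real^'p) \<times> (real^'p)"
  have expand: "Q z = x (foot a) + lin_comb X (fst z) +
      (\<Sum>\<beta>\<in>UNIV. (snd z $ \<beta>) *\<^sub>R (Y $ \<beta> + lin_comb (\<chi> \<alpha>. C $ \<alpha> $ \<beta>) (fst z)))" for z
    unfolding Q_def lin_comb_def[where v = "L (fst z)"] by (simp add: L_def)
  have "continuous_on UNIV Q"
    unfolding expand[abs_def]
    by (intro continuous_intros bounded_linear.continuous_on[OF bounded_linear_lin_comb])
  moreover have "Q 0 \<in> x ` U" using U(2) by (simp add: Q_def)
  ultimately obtain c where c: "c > 0" and sub: "\<And>u v. Q (squash c u, squash c v) \<in> x ` U"
    using squash_into_open[OF _ smooth_atlas_chart(2)[OF M U(1)], of Q] by blast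
  define g where "g z = Q (squash c (fst z), squash c (snd z))" for z
  have s1: "smooth_on UNIV (\<lambda>z::(real^'p) \<times> (real^'p). squash c (fst z))"
    by (rule smooth_on_compose[OF fin_dim_jet_source open_UNIV
          smooth_on_bounded_linear[OF bounded_linear_fst open_UNIV] smooth_on_squash[OF fin_dim_jet_source c]]) simp
  have s2: "smooth_on UNIV (\<lambda>z::(real^'p) \<times> (real^'p). squash c (snd z))"
    by (rule smooth_on_compose[OF fin_dim_jet_source open_UNIV
          smooth_on_bounded_linear[OF bounded_linear_snd open_UNIV] smooth_on_squash[OF fin_dim_jet_source c]]) simp
  have sg: "smooth_on UNIV g"
    unfolding g_def[abs_def] expand fst_conv snd_conv
    by (intro smooth_on_add[OF open_UNIV] smooth_on_const[OF open_UNIV] smooth_on_sum[OF open_UNIV]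
        smooth_on_scaleR[OF open_UNIV]
        smooth_on_bounded_linear_compose[OF bounded_linear_lin_comb open_UNIV s1]
        smooth_on_bounded_linear_compose[OF bounded_linear_vec_nth open_UNIV s2])
  have rg: "range g \<subseteq> x ` U" using sub by (auto simp: g_def)
  define \<phi> where "\<phi> z = inv_into U x (g z)" for z
  have \<phi>: "smooth_map euclid M \<phi>"
    unfolding \<phi>_def[abs_def] by (rule smooth_map_into_chart[OF fin_dim_double_source M U(1) sg rg])
  have \<phi>0: "\<phi> (0, 0) = foot a" using i U(2) by (simp add: \<phi>_def g_def Q_def)
  have x\<phi>: "x (\<phi> z) = g z" for z unfolding \<phi>_def using rg by (intro f_inv_into_f) auto
  note coords = coords_iterated_jet[OF M \<phi> U(1), unfolded \<phi>0, OF U(2), unfolded x\<phi>]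
  have "coordX x (iterated_jet M \<phi>) $ \<alpha> = X $ \<alpha>" for \<alpha>
    unfolding coords(2) using pderiv_lin_comb_squash[OF c, of "x (foot a)" X] by (simp add: g_def Q_def)
  moreover have inner: "pderiv_at (\<lambda>v. g (u, v)) (axis \<beta> 1) 0 = L (squash c u) $ \<beta>" for u \<beta>
    using pderiv_lin_comb_squash[OF c, of "x (foot a) + lin_comb X (squash c u)" "L (squash c u)"]
    by (simp add: g_def Q_def)
  moreover have "coordY x (iterated_jet M \<phi>) $ \<beta> = Y $ \<beta>" for \<beta>
    unfolding coords(1) inner by (simp add: L_def)
  moreover have "coordC x (iterated_jet M \<phi>) $ \<alpha> $ \<beta> = C $ \<alpha> $ \<beta>" for \<alpha> \<beta>
    unfolding coords(3) inner using pderiv_lin_comb_squash[OF c, of "Y $ \<beta>" "\<chi> \<alpha>. C $ \<alpha> $ \<beta>"]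
    by (simp add: L_def)
  ultimately have "iterated_jet M \<phi> = a"
    using foot_iterated_jet[OF M \<phi>] \<phi>0 U(2)
    by (intro JJ_eqI[OF M iterated_jet_in_JJ[OF M \<phi>] a U(1)]) (simp_all add: vec_eq_iff X_def Y_def C_def)
  then show thesis using that \<phi> by blast
qed

lemma jet2_self: "smooth_map euclid M \<phi> \<Longrightarrow> \<phi> \<in> jet2 M \<phi>"
  by (simp add: jet2_def same_jet2_def)

lemma rep_jet2:
  assumes "smooth_map euclid M \<phi>"
  shows "smooth_map euclid M (rep (jet2 M \<phi>))" "same_jet2 M \<phi> (rep (jet2 M \<phi>))"
proof -
  have "rep (jet2 M \<phi>) \<in> jet2 M \<phi>"
    unfolding rep_def by (rule someI[of "\<lambda>\<xi>. \<xi> \<in> jet2 M \<phi>", OF jet2_self[OF assms]])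
  then show "smooth_map euclid M (rep (jet2 M \<phi>))" "same_jet2 M \<phi> (rep (jet2 M \<phi>))"
    by (auto simp: jet2_def)
qed

text \<open>
  The derivatives on the right are those recorded by 2-jets, which is what makes \<open>\<Lambda>\<close> well defined.
\<close>

lemma coords_iterated_jet_total:
  fixes M :: "('a, 'e::real_inner) atlas" and \<phi> :: "(real^'p::finite) \<times> (real^'p) \<Rightarrow> 'a"
  assumes M: "smooth_atlas M" and \<phi>: "smooth_map euclid M \<phi>"
    and U: "(U, x) \<in> M" "\<phi> 0 \<in> U"
  shows "coordY x (iterated_jet M \<phi>) $ \<beta> = pderiv_at (x \<circ> \<phi>) (0, axis \<beta> 1) 0"
    and "coordX x (iterated_jet M \<phi>) $ \<alpha> = pderiv_at (x \<circ> \<phi>) (axis \<alpha> 1, 0) 0"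
    and "coordC x (iterated_jet M \<phi>) $ \<alpha> $ \<beta> =
      pderiv_at (pderiv_at (x \<circ> \<phi>) (0, axis \<beta> 1)) (axis \<alpha> 1, 0) 0"
proof -
  have U0: "\<phi> (0, 0) \<in> U" using U(2) by (simp add: zero_prod_def)
  note coords = coords_iterated_jet[OF M \<phi> U(1) U0]
  note S = double_source_D(2)[OF M \<phi> U(1)] and f = double_source_D(3)[OF M \<phi> U(1)]
  have z: "(0, 0) \<in> \<phi> -` U" using U0 by simp
  note d = smooth_on_differentiable[OF f z]
  show "coordY x (iterated_jet M \<phi>) $ \<beta> = pderiv_at (x \<circ> \<phi>) (0, axis \<beta> 1) 0"
    unfolding coords(1) o_def zero_prod_def
    using fun_cong[OF frechet_derivative_at[OF slice_right_has_derivative[OF d]]] by simp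
  show "coordX x (iterated_jet M \<phi>) $ \<alpha> = pderiv_at (x \<circ> \<phi>) (axis \<alpha> 1, 0) 0"
    unfolding coords(2) o_def zero_prod_def
    using fun_cong[OF frechet_derivative_at[OF slice_left_has_derivative[OF d]]] by simp
  show "coordC x (iterated_jet M \<phi>) $ \<alpha> $ \<beta> =
      pderiv_at (pderiv_at (x \<circ> \<phi>) (0, axis \<beta> 1)) (axis \<alpha> 1, 0) 0"
    unfolding coords(3) o_def zero_prod_def
    using fun_cong[OF frechet_derivative_at[OF iterated_pderiv_left[OF S z f]]] by simp
qed

text \<open>
  The representative of \<open>j\<^sup>2\<phi>\<close> chosen in the definition of \<open>\<Lambda>\<close> has the same
  derivatives of order at most 2 as \<open>\<phi>\<close>, and the coordinates of the double jet are such derivatives.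
\<close>

lemma Lam_jet2:
  fixes M :: "('a, 'e::real_inner) atlas" and \<phi> :: "(real^'p::finite) \<times> (real^'p) \<Rightarrow> 'a"
  assumes M: "smooth_atlas M" and \<phi>: "smooth_map euclid M \<phi>"
  shows "Lam M (jet2 M \<phi>) = iterated_jet M \<phi>"
proof -
  let ?\<psi> = "rep (jet2 M \<phi>)"
  have \<psi>: "smooth_map euclid M ?\<psi>" and same: "same_jet2 M \<phi> ?\<psi>" by (rule rep_jet2[OF \<phi>])+
  obtain U x where U: "(U, x) \<in> M" "\<phi> 0 \<in> U" using double_source_D(1)[OF M \<phi>] pointsE by metis
  have \<psi>0: "?\<psi> 0 = \<phi> 0" using same by (simp add: same_jet2_def)
  have eq1: "pderiv_at (x \<circ> \<phi>) b 0 = pderiv_at (x \<circ> ?\<psi>) b 0" if "b \<in> Basis" for b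
    using same U that unfolding same_jet2_def by blast
  have eq2: "pderiv_at (pderiv_at (x \<circ> \<phi>) b) b' 0 = pderiv_at (pderiv_at (x \<circ> ?\<psi>) b) b' 0"
    if "b \<in> Basis" "b' \<in> Basis" for b b'
    using same U that unfolding same_jet2_def by blast
  have bas: "(axis \<alpha> 1 :: real^'p, 0 :: real^'p) \<in> Basis" "(0 :: real^'p, axis \<alpha> 1 :: real^'p) \<in> Basis" for \<alpha>
    by (auto simp: Basis_prod_def axis_in_Basis_iff)
  have "iterated_jet M ?\<psi> = iterated_jet M \<phi>"
  proof (rule JJ_eqI[OF M iterated_jet_in_JJ[OF M \<psi>] iterated_jet_in_JJ[OF M \<phi>] U(1)])
    show "foot (iterated_jet M ?\<psi>) \<in> U" "foot (iterated_jet M \<phi>) = foot (iterated_jet M ?\<psi>)"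
      using U \<psi>0 by (simp_all add: foot_iterated_jet[OF M \<phi>] foot_iterated_jet[OF M \<psi>] flip: zero_prod_def)
    note T = coords_iterated_jet_total[OF M \<phi> U]
      coords_iterated_jet_total[OF M \<psi> U(1), unfolded \<psi>0, OF U(2)]
    show "coordY x (iterated_jet M ?\<psi>) = coordY x (iterated_jet M \<phi>)"
      "coordX x (iterated_jet M ?\<psi>) = coordX x (iterated_jet M \<phi>)"
      "coordC x (iterated_jet M ?\<psi>) = coordC x (iterated_jet M \<phi>)"
      by (simp_all add: vec_eq_iff T eq1 eq2 bas)
  qed
  then show ?thesis by (simp add: Lam_def iterated_jet_def)
qed

lemma Lam_surj:
  assumes M: "smooth_atlas M" and a: "a \<in> JJ M"
  obtains j where "j \<in> J2 M" "Lam M j = a"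
proof -
  obtain \<phi> where "smooth_map euclid M \<phi>" "iterated_jet M \<phi> = a" by (rule iterated_jet_exists[OF M a])
  then show thesis using that[of "jet2 M \<phi>"] Lam_jet2[OF M] by (auto simp: J2_def)
qed

section \<open>The involution in coordinates\<close>

text \<open>
  The coordinate form \<open>(y, Y, X, C) \<mapsto> (y, X, Y, C\<^sup>T)\<close> of \<open>\<ell>\<close>, as a
  relation: that it holds in all charts at once for some \<open>b\<close> is not clear until \<open>a\<close> is
  represented by a map of two variables.
\<close>

definition flipped :: "('a, 'e::real_inner) atlas \<Rightarrow> ('p::finite, ('p, 'a) jet) jet
    \<Rightarrow> ('p, ('p, 'a) jet) jet \<Rightarrow> bool" where
  "flipped M a b \<longleftrightarrow> a \<in> JJ M \<and> b \<in> JJ M \<and> foot b = foot a \<and>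
     (\<forall>U x. (U, x) \<in> M \<and> foot a \<in> U \<longrightarrow>
        coordY x b = coordX x a \<and> coordX x b = coordY x a \<and> coordC x b = transpose (coordC x a))"

lemma flipped_sym: "flipped M a b \<Longrightarrow> flipped M b a"
  unfolding flipped_def by (auto simp: transpose_transpose)

lemma flipped_unique:
  assumes M: "smooth_atlas M" and "flipped M a b" "flipped M a c"
  shows "b = c"
proof -
  have a: "a \<in> JJ M" using assms by (simp add: flipped_def)
  obtain U x where "(U, x) \<in> M" "foot a \<in> U" by (rule JJ_footE[OF M a])
  then show ?thesis
    using assms by (intro JJ_eqI[OF M, of b c U x]) (auto simp: flipped_def)
qed

lemma smooth_map_swap:
  assumes "smooth_atlas M" "smooth_map euclid M (\<phi> :: (real^'p::finite) \<times> (real^'p) \<Rightarrow> 'a)"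
  shows "smooth_map euclid M (\<phi> \<circ> prod.swap)"
proof -
  have "smooth_on UNIV (\<lambda>z :: (real^'p) \<times> (real^'p). (snd z, fst z))"
    by (intro smooth_on_Pair smooth_on_bounded_linear bounded_linear_fst bounded_linear_snd open_UNIV)
  from smooth_map_from_euclid_compose[OF fin_dim_double_source fin_dim_double_source assms this]
  show ?thesis by (simp add: o_def prod.swap_def)
qed

text \<open>
  For \<open>X\<close> and \<open>Y\<close> this is immediate from their description as partial derivatives; for
  \<open>C\<close> it is the symmetry of second derivatives.
\<close>

lemma flipped_iterated_jet:
  fixes M :: "('a, 'e::real_inner) atlas" and \<phi> :: "(real^'p::finite) \<times> (real^'p) \<Rightarrow> 'a"
  assumes M: "smooth_atlas M" and \<phi>: "smooth_map euclid M \<phi>"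
  shows "flipped M (iterated_jet M \<phi>) (iterated_jet M (\<phi> \<circ> prod.swap))"
  unfolding flipped_def
proof (intro conjI allI impI)
  note \<psi> = smooth_map_swap[OF M \<phi>]
  show "iterated_jet M \<phi> \<in> JJ M" "iterated_jet M (\<phi> \<circ> prod.swap) \<in> JJ M"
    by (intro iterated_jet_in_JJ M \<phi> \<psi>)+
  show "foot (iterated_jet M (\<phi> \<circ> prod.swap)) = foot (iterated_jet M \<phi>)"
    by (simp add: foot_iterated_jet[OF M \<phi>] foot_iterated_jet[OF M \<psi>])
  fix U x assume "(U, x) \<in> M \<and> foot (iterated_jet M \<phi>) \<in> U"
  then have U: "(U, x) \<in> M" "\<phi> (0, 0) \<in> U" by (simp_all add: foot_iterated_jet[OF M \<phi>])
  then have U': "(\<phi> \<circ> prod.swap) (0, 0) \<in> U" by simp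
  note c = coords_iterated_jet[OF M \<phi> U] and c' = coords_iterated_jet[OF M \<psi> U(1) U']
  show "coordY x (iterated_jet M (\<phi> \<circ> prod.swap)) = coordX x (iterated_jet M \<phi>)"
    "coordX x (iterated_jet M (\<phi> \<circ> prod.swap)) = coordY x (iterated_jet M \<phi>)"
    by (simp_all add: vec_eq_iff c c')
  have "pderiv_at (\<lambda>u. pderiv_at (\<lambda>v. x (\<phi> (v, u))) b 0) b' 0 =
      pderiv_at (\<lambda>u. pderiv_at (\<lambda>v. x (\<phi> (u, v))) b' 0) b 0" for b b'
    using iterated_pderiv_commute[OF double_source_D(2)[OF M \<phi> U(1)] _ double_source_D(3)[OF M \<phi> U(1)], of 0 0] U(2)
    by simp
  then show "coordC x (iterated_jet M (\<phi> \<circ> prod.swap)) = transpose (coordC x (iterated_jet M \<phi>))"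
    by (simp add: vec_eq_iff c c' transpose_def)
qed

lemma flipped_Lam_ell_hat:
  assumes M: "smooth_atlas M" and j: "j \<in> J2 M"
  shows "flipped M (Lam M j) (Lam M (ell_hat M j))"
proof -
  obtain \<phi> where \<phi>: "smooth_map euclid M \<phi>" "j = jet2 M \<phi>" using j by (auto simp: J2_def)
  have r: "smooth_map euclid M (rep j)" unfolding \<phi>(2) by (rule rep_jet2(1)[OF \<phi>(1)])
  have "Lam M (ell_hat M j) = iterated_jet M (rep j \<circ> prod.swap)"
    unfolding ell_hat_def by (rule Lam_jet2[OF M smooth_map_swap[OF M r]])
  moreover have "Lam M j = iterated_jet M (rep j)" by (simp add: Lam_def iterated_jet_def)
  ultimately show ?thesis using flipped_iterated_jet[OF M r] by simp
qed

text \<open>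
  By surjectivity of \<open>\<Lambda>\<close> the relation \<open>flipped\<close> is a function on double jets, and it
  satisfies the equation that determines \<open>\<ell>\<close>; conversely, that equation leaves no choice.
\<close>

lemma flipped_ell:
  fixes M :: "('a, 'e::real_inner) atlas" and a :: "('p::finite, ('p, 'a) jet) jet"
  assumes M: "smooth_atlas M" and a: "a \<in> JJ M"
  shows "flipped M a (ell M a)"
proof -
  define l :: "('p, ('p, 'a) jet) jet \<Rightarrow> ('p, ('p, 'a) jet) jet" where "l = (\<lambda>a\<in>JJ M. THE b. flipped M a b)"
  have l: "flipped M a (l a)" if a: "a \<in> JJ M" for a :: "('p, ('p, 'a) jet) jet"
  proof -
    obtain j where "j \<in> J2 M" "Lam M j = a" by (rule Lam_surj[OF M a])
    then have "flipped M a (Lam M (ell_hat M j))" using flipped_Lam_ell_hat[OF M] by metis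
    then have "\<exists>!b. flipped M a b" using flipped_unique[OF M] by blast
    from theI'[OF this] show ?thesis using a by (simp add: l_def)
  qed
  have "ell M = l"
    unfolding ell_def
  proof (rule the_equality)
    have "l (Lam M j) = Lam M (ell_hat M j)" if "j \<in> J2 M" for j
      using flipped_Lam_ell_hat[OF M that] l flipped_unique[OF M] by (metis flipped_def)
    moreover have "l \<in> JJ M \<rightarrow>\<^sub>E JJ M"
      using l by (auto simp: l_def flipped_def)
    ultimately show "l \<in> JJ M \<rightarrow>\<^sub>E JJ M \<and> (\<forall>j\<in>J2 M. l (Lam M j) = Lam M (ell_hat M j))" by blast
  next
    fix k :: "('p, ('p, 'a) jet) jet \<Rightarrow> ('p, ('p, 'a) jet) jet"
    assume k: "k \<in> JJ M \<rightarrow>\<^sub>E JJ M \<and> (\<forall>j\<in>J2 M. k (Lam M j) = Lam M (ell_hat M j))"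
    show "k = l"
    proof
      fix a
      show "k a = l a"
      proof (cases "a \<in> JJ M")
        case True
        obtain j where j: "j \<in> J2 M" "Lam M j = a" by (rule Lam_surj[OF M True])
        then have "flipped M a (k a)" using k flipped_Lam_ell_hat[OF M j(1)] by auto
        then show ?thesis using l[OF True] flipped_unique[OF M] by blast
      next
        case False
        then show ?thesis using k by (auto simp: l_def PiE_def extensional_def)
      qed
    qed
  qed
  then show ?thesis using l[OF a] by simp
qed

lemma ell_JJ:
  assumes M: "smooth_atlas M" and a: "a \<in> JJ M"
  shows "ell M a \<in> JJ M" "foot (ell M a) = foot a" "ell M (ell M a) = a"
proof -
  note f = flipped_ell[OF M a]
  show e: "ell M a \<in> JJ M" "foot (ell M a) = foot a" using f by (simp_all add: flipped_def)
  show "ell M (ell M a) = a"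
    by (rule flipped_unique[OF M flipped_ell[OF M e(1)] flipped_sym[OF f]])
qed

lemma coords_ell:
  assumes M: "smooth_atlas M" and a: "a \<in> JJ M" and "(U, x) \<in> M" "foot a \<in> U"
  shows "coordY x (ell M a) = coordX x a" "coordX x (ell M a) = coordY x a"
    "coordC x (ell M a) = transpose (coordC x a)"
  using flipped_ell[OF M a] assms(3,4) by (auto simp: flipped_def)

text \<open>
  Both sides are 1-jets with coordinates \<open>(y, Y)\<close>.
\<close>

lemma sec_proj_ell:
  assumes M: "smooth_atlas M" and a: "a \<in> JJ M"
  shows "sec_proj M (ell M a) = prim_proj a"
proof -
  obtain U x where U: "(U, x) \<in> M" "foot a \<in> U" by (rule JJ_footE[OF M a])
  note e = ell_JJ[OF M a]
  show ?thesis
  proof (rule jet_eqI[OF M sec_proj_JJ(1)[OF M e(1)] JJ_prim_proj[OF M a] U(1)])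
    show "jet_proj (sec_proj M (ell M a)) \<in> U" "jet_proj (prim_proj a) \<in> U"
      using U(2) by (simp_all add: sec_proj_JJ(2)[OF M e(1)] e(2) flip: foot_def)
    show "jet_chart x (sec_proj M (ell M a)) = jet_chart x (prim_proj a)"
      using U by (simp add: jet_chart_sec_proj[OF M e(1) U(1)] e(2) jet_chart_prim_proj coords_ell[OF M a U])
  qed
qed

lemma sec_proj_eq:
  assumes "smooth_atlas M" "a \<in> JJ M"
  shows "sec_proj M a = prim_proj (ell M a)"
  using sec_proj_ell[OF assms(1) ell_JJ(1)[OF assms]] ell_JJ(3)[OF assms] by simp

section \<open>The two sets of fibre operations\<close>

text \<open>
  Existence: take the double jet with the right coordinates in one chart; it has them in every other chart since
  \<open>(X, C)\<close> transforms linearly over a fixed 1-jet. Addition and scalar multiplication are the cases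
  \<open>r = s = 1\<close> and \<open>s = 0\<close>.
\<close>

lemma JJ_combination:
  fixes M :: "('a, 'e::real_inner) atlas" and a b :: "('p::finite, ('p, 'a) jet) jet"
  assumes M: "smooth_atlas M" and a: "a \<in> JJ M" and b: "b \<in> JJ M" and ab: "prim_proj a = prim_proj b"
  shows "\<exists>!c. c \<in> JJ M \<and> prim_proj c = prim_proj a \<and>
     (\<forall>(U, x)\<in>M. jet_proj (prim_proj a) \<in> U \<longrightarrow>
        coordX x c = r *\<^sub>R coordX x a + s *\<^sub>R coordX x b \<and>
        coordC x c = r *\<^sub>R coordC x a + s *\<^sub>R coordC x b)" (is "\<exists>!c. ?P c")
proof (rule ex_ex1I)
  note J = smooth_atlas_jet[OF M, where ?'p = 'p]
  obtain U x where U: "(U, x) \<in> M" "foot a \<in> U" by (rule JJ_footE[OF M a])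
  have fab: "foot b = foot a" using ab by (simp add: foot_def)
  obtain c :: "('p, ('p, 'a) jet) jet" where c: "c \<in> JJ M" "foot c = foot a" "coordY x c = coordY x a"
      "coordX x c = r *\<^sub>R coordX x a + s *\<^sub>R coordX x b"
      "coordC x c = r *\<^sub>R coordC x a + s *\<^sub>R coordC x b"
    by (rule JJ_exists[OF M U])
  have pc: "prim_proj c = prim_proj a"
    by (rule jet_eqI[OF M JJ_prim_proj[OF M c(1)] JJ_prim_proj[OF M a] U(1)])
       (use U c in \<open>simp_all add: jet_chart_prim_proj flip: foot_def\<close>)
  have "coordX x' c = r *\<^sub>R coordX x' a + s *\<^sub>R coordX x' b \<and>
        coordC x' c = r *\<^sub>R coordC x' a + s *\<^sub>R coordC x' b"
    if V: "(V, x') \<in> M" "foot a \<in> V" for V x'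
  proof -
    \<comment> \<open>Over a fixed 1-jet, \<open>(X, C)\<close> transforms by the derivative of a transition map of \<open>J\<^sup>1M\<close>, which is linear.\<close>
    let ?\<tau> = "jet_chart x' \<circ> inv_into {j \<in> J1 M. jet_proj j \<in> U} (jet_chart x)"
    let ?D = "frechet_derivative ?\<tau> (at (jet_chart x (prim_proj a)))"
    have mem: "jet_proj d \<in> {j \<in> J1 M. jet_proj j \<in> W}" if "d \<in> JJ M" "prim_proj d = prim_proj a" "foot a \<in> W"
      for d :: "('p, ('p, 'a) jet) jet" and W
      using that JJ_prim_proj[OF M that(1)] by (simp add: foot_def prim_proj_def)
    have lin: "linear ?D"
      using transition_derivative[OF J jet_chart_in_jet_atlas[OF U(1)] jet_chart_in_jet_atlas[OF V(1)] mem mem, OF a refl U(2) a refl V(2)]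
      by (simp add: prim_proj_def has_derivative_linear)
    have tr: "(coordX x' d $ \<alpha>, coordC x' d $ \<alpha>) = ?D (coordX x d $ \<alpha>, coordC x d $ \<alpha>)"
      if d: "d \<in> JJ M" "prim_proj d = prim_proj a" for d :: "('p, ('p, 'a) jet) jet" and \<alpha>
    proof -
      have fd: "foot d = foot a" using d by (simp add: foot_def)
      show ?thesis
        using jet_chart_change[OF J _ jet_chart_in_jet_atlas[OF U(1)] mem[OF d U(2)] jet_chart_in_jet_atlas[OF V(1)] mem[OF d V(2)], of \<alpha>]
          d U(2) V(2) fd
        by (simp add: jet_chart_jet_chart[OF M d(1) U(1)] jet_chart_jet_chart[OF M d(1) V(1)] JJ_def
            flip: prim_proj_def)
    qed
    have "(coordX x' c $ \<alpha>, coordC x' c $ \<alpha>) =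
        r *\<^sub>R (coordX x' a $ \<alpha>, coordC x' a $ \<alpha>) + s *\<^sub>R (coordX x' b $ \<alpha>, coordC x' b $ \<alpha>)" for \<alpha>
    proof -
      have "(coordX x c $ \<alpha>, coordC x c $ \<alpha>) =
          r *\<^sub>R (coordX x a $ \<alpha>, coordC x a $ \<alpha>) + s *\<^sub>R (coordX x b $ \<alpha>, coordC x b $ \<alpha>)"
        by (simp add: c)
      then show ?thesis
        unfolding tr[OF c(1) pc] tr[OF a refl] tr[OF b ab[symmetric]]
        by (simp only: linear_add[OF lin] linear_scale[OF lin])
    qed
    then show ?thesis by (simp add: vec_eq_iff)
  qed
  then show "\<exists>c. ?P c" using c(1) pc unfolding foot_def by blast
next
  fix c d assume c: "?P c" and d: "?P d"
  obtain U x where U: "(U, x) \<in> M" "foot a \<in> U" by (rule JJ_footE[OF M a])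
  have "snd (jet_chart x (prim_proj c)) = snd (jet_chart x (prim_proj d))" using c d by simp
  then have "coordY x c = coordY x d" by (simp only: jet_chart_prim_proj snd_conv)
  moreover have "coordX x e = r *\<^sub>R coordX x a + s *\<^sub>R coordX x b \<and>
      coordC x e = r *\<^sub>R coordC x a + s *\<^sub>R coordC x b" if "?P e" for e
    using that U by (auto simp: foot_def)
  from this[OF c] this[OF d]
  have "coordX x c = coordX x d" "coordC x c = coordC x d" by simp_all
  ultimately show "c = d"
    using c d U by (intro JJ_eqI[OF M, of c d U x]) (simp_all add: foot_def)
qed

lemma prim_add_spec:
  fixes M :: "('a, 'e::real_inner) atlas" and a b :: "('p::finite, ('p, 'a) jet) jet"
  assumes M: "smooth_atlas M" and a: "a \<in> JJ M" and b: "b \<in> JJ M" and ab: "prim_proj a = prim_proj b"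
  shows "prim_add M a b \<in> JJ M" "prim_proj (prim_add M a b) = prim_proj a"
    "\<And>U x. (U, x) \<in> M \<Longrightarrow> foot a \<in> U \<Longrightarrow> coordX x (prim_add M a b) = coordX x a + coordX x b"
    "\<And>U x. (U, x) \<in> M \<Longrightarrow> foot a \<in> U \<Longrightarrow> coordC x (prim_add M a b) = coordC x a + coordC x b"
  using theI'[OF JJ_combination[OF M a b ab, where r = 1 and s = 1]]
  unfolding prim_add_def[symmetric] scaleR_one foot_def by auto

lemma prim_scale_spec:
  fixes M :: "('a, 'e::real_inner) atlas" and a :: "('p::finite, ('p, 'a) jet) jet"
  assumes M: "smooth_atlas M" and a: "a \<in> JJ M"
  shows "prim_scale M r a \<in> JJ M" "prim_proj (prim_scale M r a) = prim_proj a"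
    "\<And>U x. (U, x) \<in> M \<Longrightarrow> foot a \<in> U \<Longrightarrow> coordX x (prim_scale M r a) = r *\<^sub>R coordX x a"
    "\<And>U x. (U, x) \<in> M \<Longrightarrow> foot a \<in> U \<Longrightarrow> coordC x (prim_scale M r a) = r *\<^sub>R coordC x a"
  using theI'[OF JJ_combination[OF M a a refl, where r = r and s = 0]]
  unfolding scaleR_zero_left add_0_right prim_scale_def[symmetric] foot_def by auto

lemma sec_proj_determines:
  assumes M: "smooth_atlas M" and c: "c \<in> JJ M" and d: "d \<in> JJ M"
    and eq: "sec_proj M c = sec_proj M d" and U: "(U, x) \<in> M" "foot c \<in> U"
    and "coordY x c = coordY x d" "coordC x c = coordC x d"
  shows "c = d"
proof -
  have f: "foot d = foot c" using sec_proj_JJ(2)[OF M] c d eq by metis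
  have "snd (jet_chart x (sec_proj M c)) = snd (jet_chart x (sec_proj M d))" using eq by simp
  then have "coordX x c = coordX x d"
    using U f by (simp only: jet_chart_sec_proj[OF M c U] jet_chart_sec_proj[OF M d U(1)] snd_conv)
  then show ?thesis using assms f by (intro JJ_eqI[OF M c d U]) auto
qed

lemma transpose_add: "transpose (A + B) = transpose A + transpose B"
  by (simp add: transpose_def vec_eq_iff)

lemma transpose_scaleR: "transpose (r *\<^sub>R A) = r *\<^sub>R transpose A"
  by (simp add: transpose_def vec_eq_iff)

text \<open>
  The map \<open>\<ell>\<close> turns the conditions that characterize the primary sum into those for the secondary sum,
  as \<open>\<ell>\<close> exchanges the projections and the coordinates \<open>X\<close> and \<open>Y\<close>, and
  transposition is linear.
\<close>

lemma ell_prim_add: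
  fixes M :: "('a, 'e::real_inner) atlas" and a b :: "('p::finite, ('p, 'a) jet) jet"
  assumes M: "smooth_atlas M" and a: "a \<in> JJ M" and b: "b \<in> JJ M" and ab: "prim_proj a = prim_proj b"
  shows "ell M (prim_add M a b) = sec_add M (ell M a) (ell M b)"
  unfolding sec_add_def
proof (rule the_equality[symmetric])
  note s = prim_add_spec[OF M a b ab]
  note ea = ell_JJ[OF M a] and eb = ell_JJ[OF M b] and es = ell_JJ[OF M s(1)]
  have fs: "foot (prim_add M a b) = foot a" and fb: "foot b = foot a" using s(2) ab by (simp_all add: foot_def)
  have coords: "coordY x (ell M (prim_add M a b)) = coordY x (ell M a) + coordY x (ell M b)"
    "coordC x (ell M (prim_add M a b)) = coordC x (ell M a) + coordC x (ell M b)"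
    if U: "(U, x) \<in> M" "foot a \<in> U" for U x
    using U coords_ell[OF M a U] coords_ell[OF M b U(1)] coords_ell[OF M s(1) U(1)]
    by (simp_all add: fs fb s(3,4)[OF U] transpose_add)
  have proj: "sec_proj M (ell M (prim_add M a b)) = sec_proj M (ell M a)"
    using sec_proj_ell[OF M a] sec_proj_ell[OF M s(1)] s(2) by simp
  show "ell M (prim_add M a b) \<in> JJ M \<and> sec_proj M (ell M (prim_add M a b)) = sec_proj M (ell M a) \<and>
    (\<forall>(U, x)\<in>M. jet_proj (prim_proj (ell M a)) \<in> U \<longrightarrow>
      coordY x (ell M (prim_add M a b)) = coordY x (ell M a) + coordY x (ell M b) \<and>
      coordC x (ell M (prim_add M a b)) = coordC x (ell M a) + coordC x (ell M b))"
    using es(1) proj coords ea(2) unfolding foot_def by auto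
  fix c assume c: "c \<in> JJ M \<and> sec_proj M c = sec_proj M (ell M a) \<and>
    (\<forall>(U, x)\<in>M. jet_proj (prim_proj (ell M a)) \<in> U \<longrightarrow>
      coordY x c = coordY x (ell M a) + coordY x (ell M b) \<and>
      coordC x c = coordC x (ell M a) + coordC x (ell M b))"
  obtain U x where U: "(U, x) \<in> M" "foot a \<in> U" by (rule JJ_footE[OF M a])
  have "foot c = foot a" using c sec_proj_JJ(2)[OF M] ea(1,2) by metis
  moreover have "coordY x c = coordY x (ell M a) + coordY x (ell M b) \<and>
      coordC x c = coordC x (ell M a) + coordC x (ell M b)"
    using c U ea(2) by (auto simp: foot_def)
  ultimately show "c = ell M (prim_add M a b)"
    using c proj U coords[OF U] by (intro sec_proj_determines[OF M _ es(1) _ U(1)]) auto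
qed

lemma ell_prim_scale:
  fixes M :: "('a, 'e::real_inner) atlas" and a :: "('p::finite, ('p, 'a) jet) jet"
  assumes M: "smooth_atlas M" and a: "a \<in> JJ M"
  shows "ell M (prim_scale M r a) = sec_scale M r (ell M a)"
  unfolding sec_scale_def
proof (rule the_equality[symmetric])
  note s = prim_scale_spec[OF M a, where r = r]
  note ea = ell_JJ[OF M a] and es = ell_JJ[OF M s(1)]
  have fs: "foot (prim_scale M r a) = foot a" using s(2) by (simp add: foot_def)
  have coords: "coordY x (ell M (prim_scale M r a)) = r *\<^sub>R coordY x (ell M a)"
    "coordC x (ell M (prim_scale M r a)) = r *\<^sub>R coordC x (ell M a)"
    if U: "(U, x) \<in> M" "foot a \<in> U" for U x
    using U coords_ell[OF M a U] coords_ell[OF M s(1) U(1)]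
    by (simp_all add: fs s(3,4)[OF U] transpose_scaleR)
  have proj: "sec_proj M (ell M (prim_scale M r a)) = sec_proj M (ell M a)"
    using sec_proj_ell[OF M a] sec_proj_ell[OF M s(1)] s(2) by simp
  show "ell M (prim_scale M r a) \<in> JJ M \<and> sec_proj M (ell M (prim_scale M r a)) = sec_proj M (ell M a) \<and>
    (\<forall>(U, x)\<in>M. jet_proj (prim_proj (ell M a)) \<in> U \<longrightarrow>
      coordY x (ell M (prim_scale M r a)) = r *\<^sub>R coordY x (ell M a) \<and>
      coordC x (ell M (prim_scale M r a)) = r *\<^sub>R coordC x (ell M a))"
    using es(1) proj coords ea(2) unfolding foot_def by auto
  fix c assume c: "c \<in> JJ M \<and> sec_proj M c = sec_proj M (ell M a) \<and>
    (\<forall>(U, x)\<in>M. jet_proj (prim_proj (ell M a)) \<in> U \<longrightarrow>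
      coordY x c = r *\<^sub>R coordY x (ell M a) \<and> coordC x c = r *\<^sub>R coordC x (ell M a))"
  obtain U x where U: "(U, x) \<in> M" "foot a \<in> U" by (rule JJ_footE[OF M a])
  have "foot c = foot a" using c sec_proj_JJ(2)[OF M] ea(1,2) by metis
  moreover have "coordY x c = r *\<^sub>R coordY x (ell M a) \<and> coordC x c = r *\<^sub>R coordC x (ell M a)"
    using c U ea(2) by (auto simp: foot_def)
  ultimately show "c = ell M (prim_scale M r a)"
    using c proj U coords[OF U] by (intro sec_proj_determines[OF M _ es(1) _ U(1)]) auto
qed

text \<open>
  As \<open>\<ell>\<close> is an involution, every secondary sum is the image of a primary sum, which gives existence of
  the secondary sum in all charts without the transformation law of \<open>C\<close>.
\<close>

lemma sec_add_spec:
  fixes M :: "('a, 'e::real_inner) atlas" and a b :: "('p::finite, ('p, 'a) jet) jet"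
  assumes M: "smooth_atlas M" and a: "a \<in> JJ M" and b: "b \<in> JJ M" and ab: "sec_proj M a = sec_proj M b"
  shows "sec_add M a b \<in> JJ M" "sec_proj M (sec_add M a b) = sec_proj M a"
    "\<And>U x. (U, x) \<in> M \<Longrightarrow> foot a \<in> U \<Longrightarrow> coordY x (sec_add M a b) = coordY x a + coordY x b"
    "\<And>U x. (U, x) \<in> M \<Longrightarrow> foot a \<in> U \<Longrightarrow> coordC x (sec_add M a b) = coordC x a + coordC x b"
proof -
  note ea = ell_JJ[OF M a] and eb = ell_JJ[OF M b]
  have p: "prim_proj (ell M a) = prim_proj (ell M b)" using ab sec_proj_eq[OF M a] sec_proj_eq[OF M b] by simp
  note s = prim_add_spec[OF M ea(1) eb(1) p]
  have eq: "sec_add M a b = ell M (prim_add M (ell M a) (ell M b))"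
    using ell_prim_add[OF M ea(1) eb(1) p] ea(3) eb(3) by simp
  show "sec_add M a b \<in> JJ M" unfolding eq by (rule ell_JJ(1)[OF M s(1)])
  show "sec_proj M (sec_add M a b) = sec_proj M a"
    unfolding eq sec_proj_ell[OF M s(1)] s(2) by (rule sec_proj_eq[OF M a, symmetric])
  fix U x assume U: "(U, x) \<in> M" "foot a \<in> U"
  have f: "foot (prim_add M (ell M a) (ell M b)) = foot a" "foot b = foot a"
    using s(2) p ea(2) eb(2) by (simp_all add: foot_def)
  show "coordY x (sec_add M a b) = coordY x a + coordY x b"
    "coordC x (sec_add M a b) = coordC x a + coordC x b"
    unfolding eq using U coords_ell[OF M a U] coords_ell[OF M b U(1)] coords_ell[OF M s(1) U(1)] s(3,4)[OF U(1)]
    by (simp_all add: f ea(2) transpose_add transpose_transpose)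
qed

lemma sec_scale_spec:
  fixes M :: "('a, 'e::real_inner) atlas" and a :: "('p::finite, ('p, 'a) jet) jet"
  assumes M: "smooth_atlas M" and a: "a \<in> JJ M"
  shows "sec_scale M r a \<in> JJ M" "sec_proj M (sec_scale M r a) = sec_proj M a"
    "\<And>U x. (U, x) \<in> M \<Longrightarrow> foot a \<in> U \<Longrightarrow> coordY x (sec_scale M r a) = r *\<^sub>R coordY x a"
    "\<And>U x. (U, x) \<in> M \<Longrightarrow> foot a \<in> U \<Longrightarrow> coordC x (sec_scale M r a) = r *\<^sub>R coordC x a"
proof -
  note ea = ell_JJ[OF M a]
  note s = prim_scale_spec[OF M ea(1), where r = r]
  have eq: "sec_scale M r a = ell M (prim_scale M r (ell M a))"
    using ell_prim_scale[OF M ea(1), where r = r] ea(3) by simp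
  show "sec_scale M r a \<in> JJ M" unfolding eq by (rule ell_JJ(1)[OF M s(1)])
  show "sec_proj M (sec_scale M r a) = sec_proj M a"
    unfolding eq sec_proj_ell[OF M s(1)] s(2) by (rule sec_proj_eq[OF M a, symmetric])
  fix U x assume U: "(U, x) \<in> M" "foot a \<in> U"
  have f: "foot (prim_scale M r (ell M a)) = foot a"
    using s(2) ea(2) by (simp add: foot_def)
  show "coordY x (sec_scale M r a) = r *\<^sub>R coordY x a"
    "coordC x (sec_scale M r a) = r *\<^sub>R coordC x a"
    unfolding eq using U coords_ell[OF M a U] coords_ell[OF M s(1) U(1)] s(3,4)[OF U(1)]
    by (simp_all add: f ea(2) transpose_scaleR transpose_transpose)
qed

section \<open>Smoothness of the involution and the two bundles\<close>

text \<open>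
  From the grouping \<open>((y, Y), (X\<^sub>\<alpha>, C\<^sub>\<alpha>)\<^sub>\<alpha>)\<close> of the charts of
  \<open>J\<^sup>1(J\<^sup>1M)\<close> to \<open>((y, Y), (X, C))\<close>, which separates the primary base point
  from the primary fibre coordinates.
\<close>

definition shuffle :: "('e::real_inner \<times> ('e^'p::finite)) \<times> (('e \<times> ('e^'p))^'p)
    \<Rightarrow> ('e \<times> ('e^'p)) \<times> (('e^'p) \<times> ('e^'p^'p))" where
  "shuffle z = (fst z, ((\<chi> \<alpha>. fst (snd z $ \<alpha>)), (\<chi> \<alpha>. snd (snd z $ \<alpha>))))"

definition unshuffle :: "('e::real_inner \<times> ('e^'p::finite)) \<times> (('e^'p) \<times> ('e^'p^'p))
    \<Rightarrow> ('e \<times> ('e^'p)) \<times> (('e \<times> ('e^'p))^'p)" where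
  "unshuffle z = (fst z, (\<chi> \<alpha>. (fst (snd z) $ \<alpha>, snd (snd z) $ \<alpha>)))"

text \<open>
  From \<open>((y, Y), (X, C))\<close> to \<open>((y, X), (Y, C))\<close>, which separates the secondary base
  point from the secondary fibre coordinates.
\<close>

definition exchange :: "('e::real_inner \<times> ('e^'p::finite)) \<times> (('e^'p) \<times> ('e^'p^'p))
    \<Rightarrow> ('e \<times> ('e^'p)) \<times> (('e^'p) \<times> ('e^'p^'p))" where
  "exchange z = ((fst (fst z), fst (snd z)), (snd (fst z), snd (snd z)))"

definition transpose_last :: "('e::real_inner \<times> ('e^'p::finite)) \<times> (('e^'p) \<times> ('e^'p^'p))
    \<Rightarrow> ('e \<times> ('e^'p)) \<times> (('e^'p) \<times> ('e^'p^'p))" where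
  "transpose_last z = (fst z, (fst (snd z), transpose (snd (snd z))))"

lemmas bl_fst = bounded_linear_compose[OF bounded_linear_fst]
  and bl_snd = bounded_linear_compose[OF bounded_linear_snd]
  and bl_nth = bounded_linear_compose[OF bounded_linear_vec_nth]

lemma bounded_linear_shuffle: "bounded_linear shuffle"
  unfolding shuffle_def[abs_def]
  by (intro bounded_linear_Pair bounded_linear_vec_lambda bl_fst bl_snd bl_nth bounded_linear_ident)

lemma bounded_linear_unshuffle: "bounded_linear unshuffle"
  unfolding unshuffle_def[abs_def]
  by (intro bounded_linear_Pair bounded_linear_vec_lambda bl_fst bl_snd bl_nth bounded_linear_ident)

lemma bounded_linear_exchange: "bounded_linear exchange"
  unfolding exchange_def[abs_def]
  by (intro bounded_linear_Pair bl_fst bl_snd bounded_linear_ident)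

lemma bounded_linear_transpose_last: "bounded_linear transpose_last"
  unfolding transpose_last_def[abs_def] transpose_def
  by (intro bounded_linear_Pair bounded_linear_vec_lambda bl_fst bl_snd bl_nth bounded_linear_ident)

lemma unshuffle_shuffle [simp]: "unshuffle (shuffle z) = z"
  by (simp add: shuffle_def unshuffle_def prod_eq_iff vec_eq_iff)

lemma shuffle_unshuffle [simp]: "shuffle (unshuffle z) = z"
  by (simp add: shuffle_def unshuffle_def prod_eq_iff vec_eq_iff)

lemma exchange_exchange [simp]: "exchange (exchange z) = z"
  by (simp add: exchange_def)

lemma shuffle_jet_chart:
  assumes "smooth_atlas M" "a \<in> JJ M" "(U, x) \<in> M" "foot a \<in> U"
  shows "shuffle (jet_chart (jet_chart x) a) = ((x (foot a), coordY x a), (coordX x a, coordC x a))"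
  by (simp add: jet_chart_jet_chart[OF assms] shuffle_def)

text \<open>
  Stated for maps that agree with \<open>\<ell>\<close> on double jets, so that it also covers the inverse of
  \<open>\<ell>\<close>.
\<close>

lemma smooth_map_ell:
  fixes M :: "('a, 'e::real_inner) atlas"
  assumes M: "smooth_atlas M"
    and h: "\<And>a. a \<in> JJ M \<Longrightarrow> h a = (ell M a :: ('p::finite, ('p, 'a) jet) jet)"
  shows "smooth_map (JJ_atlas M) (JJ_atlas M) h"
proof (rule smooth_mapI[OF smooth_atlas_JJ[OF M] smooth_atlas_JJ[OF M]])
  let ?J = "JJ_atlas M :: (('p, ('p, 'a) jet) jet, _) atlas"
  fix a :: "('p, ('p, 'a) jet) jet" assume "a \<in> points ?J"
  then have a: "a \<in> JJ M" by (simp add: points_JJ[OF M])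
  obtain U x where U: "(U, x) \<in> M" "foot a \<in> U" by (rule JJ_footE[OF M a])
  let ?W = "{a \<in> JJ M :: ('p, ('p, 'a) jet) jet set. foot a \<in> U}" and ?w = "jet_chart (jet_chart x)"
  let ?g = "\<lambda>z. unshuffle (transpose_last (exchange (shuffle z)))"
  have W: "(?W, ?w) \<in> ?J" by (rule JJ_atlas_chart[OF M U(1)])
  have sm: "smooth_on (?w ` ?W) ?g"
    by (intro smooth_on_bounded_linear smooth_atlas_chart(2)[OF smooth_atlas_JJ[OF M] W]
        bounded_linear_compose[OF bounded_linear_unshuffle] bounded_linear_compose[OF bounded_linear_transpose_last]
        bounded_linear_compose[OF bounded_linear_exchange] bounded_linear_shuffle)
  have g: "?w (h b) = ?g (?w b)" if "b \<in> ?W" for b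
  proof -
    have b: "b \<in> JJ M" "foot b \<in> U" using that by auto
    have "shuffle (?w (ell M b)) = transpose_last (exchange (shuffle (?w b)))"
      using b ell_JJ[OF M b(1)]
      by (simp add: shuffle_jet_chart[OF M _ U(1)] coords_ell[OF M b(1) U(1) b(2)]
          exchange_def transpose_last_def)
    then show ?thesis using h[OF b(1)] by (metis unshuffle_shuffle)
  qed
  show "\<exists>U x V y W g. (U, x) \<in> ?J \<and> (V, y) \<in> ?J \<and> openin (mtop ?J) W \<and> a \<in> W \<and> W \<subseteq> U \<and>
      h ` W \<subseteq> V \<and> smooth_on (x ` W) g \<and> (\<forall>q\<in>W. y (h q) = g (x q))"
  proof (intro exI conjI)
    show "(?W, ?w) \<in> ?J" "(?W, ?w) \<in> ?J" by (rule W)+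
    show "openin (mtop ?J) ?W" by (rule openin_chart_domain[OF smooth_atlas_JJ[OF M] W])
    show "a \<in> ?W" using a U by simp
    show "?W \<subseteq> ?W" by simp
    show "h ` ?W \<subseteq> ?W" by (auto simp: h ell_JJ[OF M])
    show "smooth_on (?w ` ?W) ?g" by (rule sm)
    show "\<forall>q\<in>?W. ?w (h q) = ?g (?w q)" using g by blast
  qed
qed

lemma diffeomorphism_ell:
  fixes M :: "('a, 'e::real_inner) atlas"
  assumes M: "smooth_atlas M"
  shows "diffeomorphism (JJ_atlas M) (JJ_atlas M)
    (ell M :: ('p::finite, ('p, 'a) jet) jet \<Rightarrow> ('p, ('p, 'a) jet) jet)"
proof -
  let ?P = "JJ M :: ('p, ('p, 'a) jet) jet set"
  have bij: "bij_betw (ell M) ?P ?P"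
    by (rule bij_betw_byWitness[where f' = "ell M"]) (use ell_JJ[OF M] in auto)
  have "inv_into ?P (ell M) a = ell M a" if "a \<in> ?P" for a
    using inv_into_f_f[OF bij_betw_imp_inj_on[OF bij] ell_JJ(1)[OF M that]] ell_JJ(3)[OF M that] by simp
  then show ?thesis
    unfolding diffeomorphism_def points_JJ[OF M]
    using bij smooth_map_ell[OF M, of "ell M"] smooth_map_ell[OF M, of "inv_into ?P (ell M)"] by simp
qed

lemma JJ_chart_realizes:
  fixes M :: "('a, 'e::real_inner) atlas" and Y X :: "'e^'p::finite"
  assumes M: "smooth_atlas M" and U: "(U, x) \<in> M" "p \<in> U"
  shows "unshuffle ((x p, Y), (X, C)) \<in>
    jet_chart (jet_chart x) ` {a \<in> JJ M :: ('p, ('p, 'a) jet) jet set. foot a \<in> U}"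
proof -
  obtain a :: "('p, ('p, 'a) jet) jet" where a: "a \<in> JJ M" "foot a = p"
    "coordY x a = Y" "coordX x a = X" "coordC x a = C" by (rule JJ_exists[OF M U])
  have "shuffle (jet_chart (jet_chart x) a) = ((x p, Y), (X, C))"
    using shuffle_jet_chart[OF M a(1) U(1)] a U(2) by simp
  then have "unshuffle ((x p, Y), (X, C)) = jet_chart (jet_chart x) a" by (metis unshuffle_shuffle)
  then show ?thesis using a U(2) by auto
qed

lemma fin_dim_JJ_fibre:
  "fin_dim TYPE('e::real_inner) \<Longrightarrow> fin_dim TYPE(('e^'p::finite) \<times> ('e^'p^'p))"
  by (intro fin_dim_prod fin_dim_vec)

lemma vector_bundle_prim:
  fixes M :: "('a, 'e::real_inner) atlas"
  assumes man: "smooth_manifold M"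
  shows "vector_bundle TYPE(('e^'p::finite) \<times> ('e^'p^'p)) (JJ_atlas M) (jet_atlas M)
    (prim_proj :: ('p, ('p, 'a) jet) jet \<Rightarrow> ('p, 'a) jet) (prim_add M) (prim_scale M)"
proof -
  have M: "smooth_atlas M" using man by (simp add: smooth_manifold_iff)
  let ?P = "JJ M :: ('p, ('p, 'a) jet) jet set"
  show ?thesis
  proof (rule vector_bundleI, unfold points_JJ[OF M] points_jet_atlas[OF M])
    show "smooth_manifold (JJ_atlas M :: (('p, ('p, 'a) jet) jet, _) atlas)"
      unfolding JJ_atlas_def by (intro smooth_manifold_jet man)
    show "smooth_manifold (jet_atlas M :: (('p, 'a) jet, _) atlas)" by (rule smooth_manifold_jet[OF man])
    show "fin_dim TYPE(('e^'p) \<times> ('e^'p^'p))" by (rule fin_dim_JJ_fibre[OF smooth_atlas_fin_dim[OF M]])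
    show "prim_proj a \<in> J1 M" if "a \<in> ?P" for a by (rule JJ_prim_proj[OF M that])
    show "prim_add M a b \<in> JJ M \<and> prim_proj (prim_add M a b) = prim_proj a"
      if "a \<in> ?P" "b \<in> ?P" "prim_proj a = prim_proj b" for a b
      using prim_add_spec(1,2)[OF M that] by simp
    show "prim_scale M r a \<in> JJ M \<and> prim_proj (prim_scale M r a) = prim_proj a" if "a \<in> ?P" for r a
      using prim_scale_spec(1,2)[OF M that] by simp
    fix j :: "('p, 'a) jet" assume j: "j \<in> J1 M"
    obtain U x where U: "(U, x) \<in> M" "jet_proj j \<in> U" using jet_proj_in_points[OF M j] by (rule pointsE)
    let ?W = "{a \<in> ?P. foot a \<in> U}" and ?V = "{j \<in> J1 M :: ('p, 'a) jet set. jet_proj j \<in> U}"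
    have ad: "adapted_chart (JJ_atlas M) (jet_atlas M) prim_proj (prim_add M) (prim_scale M)
        ?W (jet_chart (jet_chart x)) ?V (jet_chart x) (\<lambda>a. (coordX x a, coordC x a)) shuffle unshuffle"
      unfolding adapted_chart_def points_JJ[OF M]
    proof (intro conjI)
      show "(?W, jet_chart (jet_chart x)) \<in> JJ_atlas M" by (rule JJ_atlas_chart[OF M U(1)])
      show "(?V, jet_chart x) \<in> jet_atlas M" by (rule jet_chart_in_jet_atlas[OF U(1)])
      show "?W = {a \<in> JJ M. prim_proj a \<in> ?V}" by (auto simp: foot_def JJ_prim_proj[OF M])
      show "bounded_linear shuffle" "bounded_linear unshuffle"
        by (rule bounded_linear_shuffle bounded_linear_unshuffle)+
      show "\<forall>z. shuffle (unshuffle z) = z" "\<forall>z. unshuffle (shuffle z) = z" by simp_all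
      show "\<forall>a\<in>?W. shuffle (jet_chart (jet_chart x) a) =
          (jet_chart x (prim_proj a), (coordX x a, coordC x a))"
        by (simp add: shuffle_jet_chart[OF M _ U(1)] jet_chart_prim_proj)
      show "\<forall>q\<in>?V. \<forall>v. unshuffle (jet_chart x q, v) \<in> jet_chart (jet_chart x) ` ?W"
      proof (intro ballI allI)
        fix q v assume "q \<in> ?V"
        then show "unshuffle (jet_chart x q, v) \<in> jet_chart (jet_chart x) ` ?W"
          using JJ_chart_realizes[OF M U(1), of "jet_proj q" "snd (jet_chart x q)" "fst v" "snd v"]
          by (metis (no_types, lifting) fst_jet_chart mem_Collect_eq prod.collapse)
      qed
      show "\<forall>a\<in>?W. \<forall>b\<in>?W. prim_proj a = prim_proj b \<longrightarrow>
          (coordX x (prim_add M a b), coordC x (prim_add M a b)) =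
          (coordX x a, coordC x a) + (coordX x b, coordC x b)"
        by (simp add: prim_add_spec(3,4)[OF M _ _ _ U(1)])
      show "\<forall>r. \<forall>a\<in>?W. (coordX x (prim_scale M r a), coordC x (prim_scale M r a)) =
          r *\<^sub>R (coordX x a, coordC x a)"
        by (simp add: prim_scale_spec(3,4)[OF M _ U(1)])
    qed
    have jV: "j \<in> ?V" using j U by simp
    show "\<exists>W w V y \<psi> L L'. j \<in> V \<and>
        adapted_chart (JJ_atlas M) (jet_atlas M) prim_proj (prim_add M) (prim_scale M)
          W w V y (\<psi> :: _ \<Rightarrow> ('e^'p) \<times> ('e^'p^'p)) L L'"
      by (intro exI) (rule conjI[OF jV ad])
  qed
qed

lemma vector_bundle_sec:
  fixes M :: "('a, 'e::real_inner) atlas"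
  assumes man: "smooth_manifold M"
  shows "vector_bundle TYPE(('e^'p::finite) \<times> ('e^'p^'p)) (JJ_atlas M) (jet_atlas M)
    (sec_proj M :: ('p, ('p, 'a) jet) jet \<Rightarrow> ('p, 'a) jet) (sec_add M) (sec_scale M)"
proof -
  have M: "smooth_atlas M" using man by (simp add: smooth_manifold_iff)
  let ?P = "JJ M :: ('p, ('p, 'a) jet) jet set"
  show ?thesis
  proof (rule vector_bundleI, unfold points_JJ[OF M] points_jet_atlas[OF M])
    show "smooth_manifold (JJ_atlas M :: (('p, ('p, 'a) jet) jet, _) atlas)"
      unfolding JJ_atlas_def by (intro smooth_manifold_jet man)
    show "smooth_manifold (jet_atlas M :: (('p, 'a) jet, _) atlas)" by (rule smooth_manifold_jet[OF man])
    show "fin_dim TYPE(('e^'p) \<times> ('e^'p^'p))" by (rule fin_dim_JJ_fibre[OF smooth_atlas_fin_dim[OF M]])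
    show "sec_proj M a \<in> J1 M" if "a \<in> ?P" for a by (rule sec_proj_JJ(1)[OF M that])
    show "sec_add M a b \<in> JJ M \<and> sec_proj M (sec_add M a b) = sec_proj M a"
      if "a \<in> ?P" "b \<in> ?P" "sec_proj M a = sec_proj M b" for a b
      using sec_add_spec(1,2)[OF M that] by simp
    show "sec_scale M r a \<in> JJ M \<and> sec_proj M (sec_scale M r a) = sec_proj M a" if "a \<in> ?P" for r a
      using sec_scale_spec(1,2)[OF M that] by simp
    fix j :: "('p, 'a) jet" assume j: "j \<in> J1 M"
    obtain U x where U: "(U, x) \<in> M" "jet_proj j \<in> U" using jet_proj_in_points[OF M j] by (rule pointsE)
    let ?W = "{a \<in> ?P. foot a \<in> U}" and ?V = "{j \<in> J1 M :: ('p, 'a) jet set. jet_proj j \<in> U}"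
    let ?L = "\<lambda>z. exchange (shuffle z)" and ?L' = "\<lambda>z. unshuffle (exchange z)"
    have ad: "adapted_chart (JJ_atlas M) (jet_atlas M) (sec_proj M) (sec_add M) (sec_scale M)
        ?W (jet_chart (jet_chart x)) ?V (jet_chart x) (\<lambda>a. (coordY x a, coordC x a)) ?L ?L'"
      unfolding adapted_chart_def points_JJ[OF M]
    proof (intro conjI)
      show "(?W, jet_chart (jet_chart x)) \<in> JJ_atlas M" by (rule JJ_atlas_chart[OF M U(1)])
      show "(?V, jet_chart x) \<in> jet_atlas M" by (rule jet_chart_in_jet_atlas[OF U(1)])
      show "?W = {a \<in> JJ M. sec_proj M a \<in> ?V}" by (auto simp: sec_proj_JJ[OF M])
      show "bounded_linear ?L" "bounded_linear ?L'"
        by (rule bounded_linear_compose[OF bounded_linear_exchange bounded_linear_shuffle]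
            bounded_linear_compose[OF bounded_linear_unshuffle bounded_linear_exchange])+
      show "\<forall>z. ?L (?L' z) = z" "\<forall>z. ?L' (?L z) = z" by simp_all
      show "\<forall>a\<in>?W. ?L (jet_chart (jet_chart x) a) =
          (jet_chart x (sec_proj M a), (coordY x a, coordC x a))"
        by (simp add: shuffle_jet_chart[OF M _ U(1)] jet_chart_sec_proj[OF M _ U(1)] exchange_def)
      show "\<forall>q\<in>?V. \<forall>v. ?L' (jet_chart x q, v) \<in> jet_chart (jet_chart x) ` ?W"
      proof (intro ballI allI)
        fix q v assume "q \<in> ?V"
        then show "?L' (jet_chart x q, v) \<in> jet_chart (jet_chart x) ` ?W"
          using JJ_chart_realizes[OF M U(1), of "jet_proj q" "fst v" "snd (jet_chart x q)" "snd v"]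
          by (simp add: exchange_def)
      qed
      show "\<forall>a\<in>?W. \<forall>b\<in>?W. sec_proj M a = sec_proj M b \<longrightarrow>
          (coordY x (sec_add M a b), coordC x (sec_add M a b)) =
          (coordY x a, coordC x a) + (coordY x b, coordC x b)"
        by (simp add: sec_add_spec(3,4)[OF M _ _ _ U(1)])
      show "\<forall>r. \<forall>a\<in>?W. (coordY x (sec_scale M r a), coordC x (sec_scale M r a)) =
          r *\<^sub>R (coordY x a, coordC x a)"
        by (simp add: sec_scale_spec(3,4)[OF M _ U(1)])
    qed
    have jV: "j \<in> ?V" using j U by simp
    show "\<exists>W w V y \<psi> L L'. j \<in> V \<and>
        adapted_chart (JJ_atlas M) (jet_atlas M) (sec_proj M) (sec_add M) (sec_scale M)
          W w V y (\<psi> :: _ \<Rightarrow> ('e^'p) \<times> ('e^'p^'p)) L L'"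
      by (intro exI) (rule conjI[OF jV ad])
  qed
qed

theorem proposition11:
  fixes M :: "('a, 'e::real_inner) atlas"
  assumes "smooth_manifold M"
  shows "vector_bundle_iso TYPE(('e^'p) \<times> ('e^'p^'p)) (jet_atlas M)
           (JJ_atlas M) prim_proj (prim_add M) (prim_scale M)
           (JJ_atlas M) (sec_proj M) (sec_add M) (sec_scale M)
           (ell M :: ('p::finite, ('p, 'a) jet) jet \<Rightarrow> ('p, ('p, 'a) jet) jet) \<and>
         (\<forall>a \<in> (JJ M :: ('p, ('p, 'a) jet) jet set). sec_proj M (ell M a) = prim_proj a)"
proof -
  have M: "smooth_atlas M" using assms by (simp add: smooth_manifold_iff)
  show ?thesis
    unfolding vector_bundle_iso_def points_JJ[OF M]
    using vector_bundle_prim[OF assms] vector_bundle_sec[OF assms] diffeomorphism_ell[OF M]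
      sec_proj_ell[OF M] ell_prim_add[OF M] ell_prim_scale[OF M]
    by blast
qed

end
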